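(* Let $\alpha>0$, $M_0>0$, $0<M_{\min}<M$ and $\tau\in(0,1/2)$. There exist constants $C,C_1>0$ depending only on $\alpha,M,M_0,M_{\min},\tau$ such that the following holds for all positive integers $n,p$, all $\alpha_0,\kappa>0$ and every $\epsilon\in[0,\tau/3)$. Set $k=\lceil n^{\frac1{2\alpha+1}}\rceil\wedge p$ and let $\hat\Gamma$ be any maximizer of $\mathcal{D}_{\mathcal{U}_k}(\Gamma,\{X_i\}_{i=1}^n)$ over $\Gamma\in\mathcal{F}_k$. Then for any $\delta\in(0,1/2)$ satisfying $C_1\frac{\min(n^{\frac{1}{2\alpha+1}}+\log p,\;p)+\log(1/\delta)}{n}<1$, $$\|\hat\Gamma-\Gamma\|_{\rm op}^2\le C\kappa\left(\left(\min\left\{n^{-\frac{2\alpha}{2\alpha+1}}+\frac{\log p}{n},\ \frac pn\right\}\vee\epsilon^2\right)+\frac{\log(1/\delta)}{n}\right)$$ with $\mathbb{P}_{(\epsilon,\Gamma,Q)}$-probability at least $1-2\delta$, uniformly over all $\Gamma\in\mathcal{F}_\alpha(M,M_0,M_{\min})$ and all probability distributions $Q$ on $\mathbb{R}^p$, where $P_\Gamma=EC(0,\Gamma,\eta)$ is a non-degenerate elliptical distribution in canonical representation satisfying the marginal condition with parameters $(\tau,\alpha_0,\kappa)$.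
   Context: Elliptical distributions: $X\sim EC(0,\Sigma,\xi)$ on $\mathbb{R}^p$ means $X=\xi AU$ in distribution, where $A\in\mathbb{R}^{p\times r}$ is deterministic, $\Sigma=AA^T$, $U$ is uniform on the unit sphere of $\mathbb{R}^r$, and $\xi\ge0$ is a real random variable independent of $U$. If $s_{\min}(\Sigma)>0$ (non-degenerate), the law of $u^TX/\sqrt{u^T\Sigma u}$ does not depend on $u\in S^{p-1}=\{u\in\mathbb{R}^p:\|u\|=1\}$. $EC(0,\Gamma,\eta)$ is the canonical representation of $EC(0,\Sigma,\xi)$ if $\Gamma=a^{-2}\Sigma$, $\eta=a\xi$ for some $a>0$, and $P_\Gamma\left(\frac{|u^TX|^2}{u^T\Gamma u}\le1\right)=\frac12$, where $P_\Gamma=EC(0,\Gamma,\eta)$; $\Gamma$ is the scatter matrix. $P_\Gamma$ always denotes a canonical representation. Marginal condition with parameters $(\tau,\alpha_0,\kappa)$, $\tau\in(0,1/2)$, $\alpha_0,\kappa>0$: with $G(t)=P_\Gamma\left(\frac{|u^TX|^2}{u^T\Gamma u}\le t\right)$ (independent of $u$), $G$ is continuous at $t=1$, $\inf_{|t|\ge\alpha_0}|G(1)-G(1+t)|\ge\tau$, and $\inf_{0<|t|<\alpha_0}\frac{|G(1)-G(1+t)|}{|t|}\ge\kappa^{-1/2}$. Contamination model: $\mathbb{P}_{(\epsilon,\Gamma,Q)}=(1-\epsilon)P_\Gamma+\epsilon Q$ with $Q$ an arbitrary probability distribution; $X_1,\dots,X_n$ are i.i.d. from it, and the same symbol denotes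 their joint law. Classes: $\mathcal{F}_k=\{\Gamma=(\gamma_{ij})\in\mathbb{R}^{p\times p},\Gamma\succeq0:\gamma_{ij}=0\text{ if }|i-j|>k\}$; $\mathcal{F}(M)=\{\Gamma=\Gamma^T\succeq0:s_{\max}(\Gamma)\le M\}$; $$\mathcal{F}_\alpha(M,M_0,M_{\min})=\Big\{\Gamma=(\gamma_{ij})\in\mathcal{F}(M):\ \max_j\sum_{\{i:|i-j|>k\}}|\gamma_{ij}|\le M_0k^{-\alpha}\text{ for all integers }k\ge1,\ s_{\min}(\Gamma)>M_{\min}\Big\},$$ where $s_{\max},s_{\min}$ are largest and smallest singular values. Directions: $\mathcal{V}_{[l_1,l_2]}=\{u\in S^{p-1}:u_i=0\text{ if }i\notin[l_1,l_2]\}$; $\mathcal{U}_k=\bigcup_{l=1}^{p+1-2k}\mathcal{V}_{[l,l+2k-1]}$ if $2k\le p$, and $\mathcal{U}_k=S^{p-1}$ if $2k>p$. Empirical matrix depth relative to $\mathcal{U}$: $$\mathcal{D}_{\mathcal{U}}(\Gamma,\{X_i\}_{i=1}^n)=\min_{u\in\mathcal{U}}\min\left\{\frac1n\sum_{i=1}^n\mathbb{I}\{|u^TX_i|^2\le u^T\Gamma u\},\ \frac1n\sum_{i=1}^n\mathbb{I}\{|u^TX_i|^2\ge u^T\Gamma u\}\right\};$$ it takes finitely many values, so maximizers exist. $\|\cdot\|_{\rm op}$ is the operator norm; $a\vee b=\max(a,b)$, $a\wedge b=\min(a,b)$. *)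

theory Defs
  imports "HOL-Probability.Probability"
begin

text \<open>
  The constants of the theorem must not depend on the dimension \<open>p\<close>, so \<open>p\<close> has to be quantified
  inside the statement and cannot be a type.  A vector of \<open>\<real>\<^sup>p\<close> is a function in
  \<open>extensional {1..p}\<close>, which is the carrier of \<open>Rn p\<close>.  A \<open>p \<times> r\<close> matrix is a function
  \<open>nat \<Rightarrow> nat \<Rightarrow> real\<close> of which only the entries with index in \<open>{1..p} \<times> {1..r}\<close> are ever read.
\<close>

type_synonym vector = "nat \<Rightarrow> real"
type_synonym matrix = "nat \<Rightarrow> nat \<Rightarrow> real"

definition Rn :: "nat \<Rightarrow> vector measure" where
  "Rn p = PiM {1..p} (\<lambda>_. borel)"

definition enorm :: "nat \<Rightarrow> vector \<Rightarrow> real" where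
  "enorm p x = L2_set x {1..p}"

definition dot :: "nat \<Rightarrow> vector \<Rightarrow> vector \<Rightarrow> real" where
  "dot p u x = (\<Sum>i=1..p. u i * x i)"

definition mat_vec :: "nat \<Rightarrow> nat \<Rightarrow> matrix \<Rightarrow> vector \<Rightarrow> vector" where
  "mat_vec m r A x = (\<lambda>i\<in>{1..m}. \<Sum>j=1..r. A i j * x j)"

definition quad_form :: "nat \<Rightarrow> matrix \<Rightarrow> vector \<Rightarrow> real" where
  "quad_form p \<Gamma> u = dot p u (mat_vec p p \<Gamma> u)"

definition unit_sphere :: "nat \<Rightarrow> vector set" where
  "unit_sphere p = {u \<in> extensional {1..p}. enorm p u = 1}"

definition op_norm :: "nat \<Rightarrow> matrix \<Rightarrow> real" where
  "op_norm p \<Delta> = (SUP u\<in>unit_sphere p. enorm p (mat_vec p p \<Delta> u))"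

definition psd :: "nat \<Rightarrow> matrix \<Rightarrow> bool" where
  "psd p \<Gamma> \<longleftrightarrow> (\<forall>i\<in>{1..p}. \<forall>j\<in>{1..p}. \<Gamma> i j = \<Gamma> j i) \<and> (\<forall>u\<in>extensional {1..p}. 0 \<le> quad_form p \<Gamma> u)"

text \<open>Singular values are the square roots of the eigenvalues of \<open>\<Gamma>\<^sup>T \<Gamma>\<close>.\<close>

definition singular_values :: "nat \<Rightarrow> matrix \<Rightarrow> real set" where
  "singular_values p \<Gamma> = {s. 0 \<le> s \<and> (\<exists>v\<in>extensional {1..p}. (\<exists>i\<in>{1..p}. v i \<noteq> 0) \<and>
     mat_vec p p (\<lambda>i j. \<Sum>l=1..p. \<Gamma> l i * \<Gamma> l j) v = (\<lambda>i\<in>{1..p}. s\<^sup>2 * v i))}"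

definition s_max :: "nat \<Rightarrow> matrix \<Rightarrow> real" where
  "s_max p \<Gamma> = Max (singular_values p \<Gamma>)"

definition s_min :: "nat \<Rightarrow> matrix \<Rightarrow> real" where
  "s_min p \<Gamma> = Min (singular_values p \<Gamma>)"

definition orthogonal_mat :: "nat \<Rightarrow> matrix \<Rightarrow> bool" where
  "orthogonal_mat r R \<longleftrightarrow>
     (\<forall>i\<in>{1..r}. \<forall>j\<in>{1..r}. (\<Sum>l=1..r. R l i * R l j) = (if i = j then 1 else 0))"

text \<open>The uniform distribution on the unit sphere of \<open>\<real>\<^sup>r\<close> is the rotation-invariant probability
  measure carried by it.  There is none for \<open>r = 0\<close>, where the sphere is empty.\<close>

definition uniform_on_sphere :: "nat \<Rightarrow> vector measure \<Rightarrow> bool" where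
  "uniform_on_sphere r U \<longleftrightarrow> prob_space U \<and> sets U = sets (Rn r) \<and> (AE x in U. x \<in> unit_sphere r) \<and>
     (\<forall>R. orthogonal_mat r R \<longrightarrow> distr U (Rn r) (mat_vec r r R) = U)"

text \<open>\<open>elliptical p \<Sigma> \<xi> P\<close> says that \<open>P\<close> is the law \<open>EC(0, \<Sigma>, \<xi>)\<close> on \<open>\<real>\<^sup>p\<close>.  Here \<open>\<xi>\<close> is the law of
  the radial variable, and independence from the spherical variable is the product measure.\<close>

definition elliptical :: "nat \<Rightarrow> matrix \<Rightarrow> real measure \<Rightarrow> vector measure \<Rightarrow> bool" where
  "elliptical p \<Sigma> \<xi> P \<longleftrightarrow>
     prob_space \<xi> \<and> sets \<xi> = sets borel \<and> (AE s in \<xi>. 0 \<le> s) \<and>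
     (\<exists>r A U. uniform_on_sphere r U \<and>
        (\<forall>i\<in>{1..p}. \<forall>j\<in>{1..p}. \<Sigma> i j = (\<Sum>l=1..r. A i l * A j l)) \<and>
        P = distr (\<xi> \<Otimes>\<^sub>M U) (Rn p) (\<lambda>(s, x). \<lambda>i\<in>{1..p}. s * mat_vec p r A x i))"

definition marginal_cdf :: "nat \<Rightarrow> vector measure \<Rightarrow> matrix \<Rightarrow> vector \<Rightarrow> real \<Rightarrow> real" where
  "marginal_cdf p P \<Gamma> u t = measure P {x \<in> space P. \<bar>dot p u x\<bar>\<^sup>2 / quad_form p \<Gamma> u \<le> t}"

text \<open>Non-degenerate and normalised so that the squared marginals have median one.  Every
  \<open>EC(0, \<Gamma>, \<eta>)\<close> normalised in this way is its own canonical representation (take \<open>a = 1\<close>), so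
  canonical representations are exactly these.  The marginal distribution does not depend on \<open>u\<close>
  (lemma \<open>marginal_cdf_indep\<close> below), so quantifying over all \<open>u\<close> here and in
  \<open>marginal_condition\<close> is no restriction.\<close>

definition canonical_elliptical :: "nat \<Rightarrow> matrix \<Rightarrow> real measure \<Rightarrow> vector measure \<Rightarrow> bool" where
  "canonical_elliptical p \<Gamma> \<eta> P \<longleftrightarrow> elliptical p \<Gamma> \<eta> P \<and> s_min p \<Gamma> > 0 \<and>
     (\<forall>u\<in>unit_sphere p. marginal_cdf p P \<Gamma> u 1 = 1 / 2)"

definition marginal_condition ::
    "nat \<Rightarrow> vector measure \<Rightarrow> matrix \<Rightarrow> real \<Rightarrow> real \<Rightarrow> real \<Rightarrow> bool" where
  "marginal_condition p P \<Gamma> \<tau> \<alpha>\<^sub>0 \<kappa> \<longleftrightarrow> (\<forall>u\<in>unit_sphere p. let G = marginal_cdf p P \<Gamma> u in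
     isCont G 1 \<and>
     (INF t\<in>{t. \<bar>t\<bar> \<ge> \<alpha>\<^sub>0}. \<bar>G 1 - G (1 + t)\<bar>) \<ge> \<tau> \<and>
     (INF t\<in>{t. 0 < \<bar>t\<bar> \<and> \<bar>t\<bar> < \<alpha>\<^sub>0}. \<bar>G 1 - G (1 + t)\<bar> / \<bar>t\<bar>) \<ge> \<kappa> powr (- 1 / 2))"

definition contamination :: "real \<Rightarrow> 'a measure \<Rightarrow> 'a measure \<Rightarrow> 'a measure" where
  "contamination \<epsilon> P Q = measure_of (space P) (sets P)
     (\<lambda>A. ennreal (1 - \<epsilon>) * emeasure P A + ennreal \<epsilon> * emeasure Q A)"

definition iid_sample :: "nat \<Rightarrow> 'a measure \<Rightarrow> (nat \<Rightarrow> 'a) measure" where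
  "iid_sample n P = PiM {1..n} (\<lambda>_. P)"

definition banded :: "nat \<Rightarrow> nat \<Rightarrow> matrix set" where
  "banded p k = {\<Gamma>. psd p \<Gamma> \<and>
     (\<forall>i\<in>{1..p}. \<forall>j\<in>{1..p}. \<bar>int i - int j\<bar> > int k \<longrightarrow> \<Gamma> i j = 0)}"

definition bounded_class :: "nat \<Rightarrow> real \<Rightarrow> matrix set" where
  "bounded_class p M = {\<Gamma>. psd p \<Gamma> \<and> s_max p \<Gamma> \<le> M}"

definition bandable_class :: "nat \<Rightarrow> real \<Rightarrow> real \<Rightarrow> real \<Rightarrow> real \<Rightarrow> matrix set" where
  "bandable_class p \<alpha> M M\<^sub>0 M_min = {\<Gamma> \<in> bounded_class p M.
     (\<forall>k::nat. k \<ge> 1 \<longrightarrow>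
        (MAX j\<in>{1..p}. \<Sum>i\<in>{i\<in>{1..p}. \<bar>int i - int j\<bar> > int k}. \<bar>\<Gamma> i j\<bar>) \<le> M\<^sub>0 * real k powr (- \<alpha>)) \<and>
     s_min p \<Gamma> > M_min}"

definition interval_directions :: "nat \<Rightarrow> nat \<Rightarrow> nat \<Rightarrow> vector set" where
  "interval_directions p l\<^sub>1 l\<^sub>2 = {u \<in> unit_sphere p. \<forall>i\<in>{1..p}. i \<notin> {l\<^sub>1..l\<^sub>2} \<longrightarrow> u i = 0}"

definition directions :: "nat \<Rightarrow> nat \<Rightarrow> vector set" where
  "directions p k = (if 2 * k \<le> p
     then \<Union>l\<in>{1..p + 1 - 2 * k}. interval_directions p l (l + 2 * k - 1)
     else unit_sphere p)"

text \<open>The infimum is over finitely many values, hence a minimum.\<close>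

definition matrix_depth ::
    "nat \<Rightarrow> nat \<Rightarrow> vector set \<Rightarrow> matrix \<Rightarrow> (nat \<Rightarrow> vector) \<Rightarrow> real" where
  "matrix_depth p n \<U> \<Gamma> X = (INF u\<in>\<U>. min
     (1 / real n * (\<Sum>i=1..n. of_bool (\<bar>dot p u (X i)\<bar>\<^sup>2 \<le> quad_form p \<Gamma> u)))
     (1 / real n * (\<Sum>i=1..n. of_bool (\<bar>dot p u (X i)\<bar>\<^sup>2 \<ge> quad_form p \<Gamma> u))))"

definition is_depth_maximizer ::
    "nat \<Rightarrow> nat \<Rightarrow> nat \<Rightarrow> matrix \<Rightarrow> (nat \<Rightarrow> vector) \<Rightarrow> bool" where
  "is_depth_maximizer p n k \<Gamma> X \<longleftrightarrow> \<Gamma> \<in> banded p k \<and>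
     (\<forall>\<Gamma>'\<in>banded p k. matrix_depth p n (directions p k) \<Gamma>' X \<le> matrix_depth p n (directions p k) \<Gamma> X)"

text \<open>An arbitrary selection of maximizers need not be measurable, so a lower bound on the
  probability of a property is read as a lower bound on its inner probability.\<close>

definition with_prob_at_least :: "'a measure \<Rightarrow> real \<Rightarrow> ('a \<Rightarrow> bool) \<Rightarrow> bool" where
  "with_prob_at_least N q \<phi> \<longleftrightarrow> (\<exists>E\<in>sets N. measure N E \<ge> q \<and> (\<forall>x\<in>E. \<phi> x))"

lemma emeasure_contamination:
  assumes "sets Q = sets P" "A \<in> sets P"
  shows "emeasure (contamination \<epsilon> P Q) A = ennreal (1 - \<epsilon>) * emeasure P A + ennreal \<epsilon> * emeasure Q A"
  unfolding contamination_def
proof (rule emeasure_measure_of_sigma[OF sets.sigma_algebra_axioms _ _ assms(2)])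
  show "positive (sets P) (\<lambda>A. ennreal (1 - \<epsilon>) * emeasure P A + ennreal \<epsilon> * emeasure Q A)"
    by (simp add: positive_def)
  show "countably_additive (sets P) (\<lambda>A. ennreal (1 - \<epsilon>) * emeasure P A + ennreal \<epsilon> * emeasure Q A)"
  proof (rule countably_additiveI)
    fix F :: "nat \<Rightarrow> 'a set" assume F: "range F \<subseteq> sets P" "disjoint_family F"
    have "(\<Sum>i. ennreal (1 - \<epsilon>) * emeasure P (F i) + ennreal \<epsilon> * emeasure Q (F i))
        = (\<Sum>i. ennreal (1 - \<epsilon>) * emeasure P (F i)) + (\<Sum>i. ennreal \<epsilon> * emeasure Q (F i))"
      by (rule suminf_add[symmetric]) auto
    also have "\<dots> = ennreal (1 - \<epsilon>) * emeasure P (\<Union>i. F i) + ennreal \<epsilon> * emeasure Q (\<Union>i. F i)"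
      using F suminf_emeasure[OF F] suminf_emeasure[of F Q] assms(1) by (simp add: ennreal_suminf_cmult)
    finally show "(\<Sum>i. ennreal (1 - \<epsilon>) * emeasure P (F i) + ennreal \<epsilon> * emeasure Q (F i))
        = ennreal (1 - \<epsilon>) * emeasure P (\<Union>i. F i) + ennreal \<epsilon> * emeasure Q (\<Union>i. F i)" .
  qed
qed

lemma space_contamination [simp]: "space (contamination \<epsilon> P Q) = space P"
  and sets_contamination [simp]: "sets (contamination \<epsilon> P Q) = sets P"
  by (simp_all add: contamination_def)

lemma mat_vec_measurable [measurable]: "mat_vec m r A \<in> Rn r \<rightarrow>\<^sub>M Rn m"
  unfolding mat_vec_def Rn_def by measurable

lemma dot_measurable [measurable]: "dot p u \<in> borel_measurable (Rn p)"
  unfolding dot_def Rn_def by measurable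

text \<open>A reflection taking one unit vector to another.\<close>

lemma orthogonal_mat_exists:
  assumes v: "(\<Sum>i=1..r. (v i)\<^sup>2) = (1::real)" and w: "(\<Sum>i=1..r. (w i)\<^sup>2) = 1"
  shows "\<exists>R. orthogonal_mat r R \<and> (\<forall>y. dot r v (mat_vec r r R y) = dot r w y)"
proof -
  define h where "h i = v i - w i" for i
  define c where "c = (\<Sum>i=1..r. (h i)\<^sup>2)"
  define R :: matrix where "R i j = (if i = j then 1 else 0) - 2 * h i * h j / c" for i j
  have hh: "c = 2 - 2 * (\<Sum>i=1..r. v i * w i)"
    unfolding c_def h_def power2_diff sum.distrib sum_subtractf v w
    by (simp add: sum_distrib_left mult.assoc)
  have vh: "(\<Sum>i=1..r. v i * h i) = c / 2"
    unfolding hh h_def right_diff_distrib using v by (simp add: sum_subtractf power2_eq_square)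
  have "orthogonal_mat r R"
    unfolding orthogonal_mat_def
  proof (intro ballI)
    fix i j assume ij: "i \<in> {1..r}" "j \<in> {1..r}"
    have "(\<Sum>l=1..r. R l i * R l j)
      = (\<Sum>l=1..r. (if l = i then (if l = j then 1 else 0) else 0) - (if l = i then 2 * h l * h j / c else 0)
            - (if l = j then 2 * h l * h i / c else 0) + (h l)\<^sup>2 * (4 * h i * h j / c\<^sup>2))"
      by (rule sum.cong) (auto simp: R_def algebra_simps power2_eq_square)
    also have "\<dots> = (if i = j then 1 else 0) - 2 * h i * h j / c - 2 * h j * h i / c + c * (4 * h i * h j / c\<^sup>2)"
      using ij unfolding sum.distrib sum_subtractf sum_distrib_right[symmetric] c_def[symmetric]
      by (simp add: sum.delta)
    also have "\<dots> = (if i = j then 1 else 0)"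
      by (simp add: power2_eq_square)
    finally show "(\<Sum>l=1..r. R l i * R l j) = (if i = j then 1 else 0)" .
  qed
  moreover have "dot r v (mat_vec r r R y) = dot r w y" for y
  proof -
    have "dot r v (mat_vec r r R y) = (\<Sum>i=1..r. \<Sum>j=1..r. v i * R i j * y j)"
      by (simp add: dot_def mat_vec_def sum_distrib_left mult.assoc)
    also have "\<dots> = (\<Sum>j=1..r. (\<Sum>i=1..r. v i * R i j) * y j)"
      by (subst sum.swap) (simp add: sum_distrib_right)
    also have "\<dots> = (\<Sum>j=1..r. w j * y j)"
    proof (rule sum.cong[OF refl])
      fix j assume j: "j \<in> {1..r}"
      have "(\<Sum>i=1..r. v i * R i j) = (\<Sum>i=1..r. (if i = j then v i else 0) - v i * h i * (2 * h j / c))"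
        by (rule sum.cong) (auto simp: R_def algebra_simps)
      also have "\<dots> = v j - c / 2 * (2 * h j / c)"
        using j unfolding sum_subtractf sum_distrib_right[symmetric] vh by (simp add: sum.delta)
      also have "\<dots> = w j"
      proof (cases "c = 0")
        case True
        then have "h j = 0" using j unfolding c_def by (simp add: sum_nonneg_eq_0_iff)
        then show ?thesis by (simp add: h_def True)
      qed (simp add: h_def field_simps)
      finally show "(\<Sum>i=1..r. v i * R i j) * y j = w j * y j" by simp
    qed
    finally show ?thesis by (simp add: dot_def)
  qed
  ultimately show ?thesis by blast
qed

lemma marginal_cdf_indep:
  assumes P: "elliptical p \<Gamma> \<eta> P"
    and u: "quad_form p \<Gamma> u > 0" and v: "quad_form p \<Gamma> v > 0"
  shows "marginal_cdf p P \<Gamma> u t = marginal_cdf p P \<Gamma> v t"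
proof -
  from P obtain r A U where \<eta>: "prob_space \<eta>" "sets \<eta> = sets borel" and U: "uniform_on_sphere r U"
    and \<Gamma>: "\<forall>i\<in>{1..p}. \<forall>j\<in>{1..p}. \<Gamma> i j = (\<Sum>l=1..r. A i l * A j l)"
    and Peq: "P = distr (\<eta> \<Otimes>\<^sub>M U) (Rn p) (\<lambda>(s, x). \<lambda>i\<in>{1..p}. s * mat_vec p r A x i)"
    unfolding elliptical_def by blast
  interpret \<eta>: prob_space \<eta> by fact
  interpret U: prob_space U using U by (simp add: uniform_on_sphere_def)
  have [measurable_cong]: "sets \<eta> = sets borel" "sets U = sets (Rn r)"
    using \<eta> U by (auto simp: uniform_on_sphere_def)
  define a where "a u j = (\<Sum>i=1..p. u i * A i j)" for u :: vector and j
  define w where "w u j = a u j / sqrt (quad_form p \<Gamma> u)" for u :: vector and j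
  have quad: "quad_form p \<Gamma> u = (\<Sum>l=1..r. (a u l)\<^sup>2)" for u
  proof -
    have "quad_form p \<Gamma> u = (\<Sum>i=1..p. \<Sum>j=1..p. \<Sum>l=1..r. (u i * A i l) * (u j * A j l))"
      using \<Gamma> by (simp add: quad_form_def dot_def mat_vec_def sum_distrib_left sum_distrib_right mult_ac)
    also have "\<dots> = (\<Sum>i=1..p. \<Sum>l=1..r. \<Sum>j=1..p. (u i * A i l) * (u j * A j l))"
      by (intro sum.cong refl sum.swap)
    also have "\<dots> = (\<Sum>l=1..r. \<Sum>i=1..p. \<Sum>j=1..p. (u i * A i l) * (u j * A j l))"
      by (rule sum.swap)
    finally show ?thesis
      by (simp add: a_def power2_eq_square sum_product)
  qed
  have w1: "(\<Sum>l=1..r. (w u l)\<^sup>2) = 1" if "quad_form p \<Gamma> u > 0" for u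
  proof -
    have "(\<Sum>l=1..r. (w u l)\<^sup>2) = (\<Sum>l=1..r. (a u l)\<^sup>2) / quad_form p \<Gamma> u"
      using that by (simp add: w_def power_divide sum_divide_distrib)
    then show ?thesis using that quad[of u] by simp
  qed
  define B where "B u = {z \<in> space (\<eta> \<Otimes>\<^sub>M U). \<bar>fst z * dot r (w u) (snd z)\<bar>\<^sup>2 \<le> t}" for u
  have meas[measurable]: "(\<lambda>(s, x). \<lambda>i\<in>{1..p}. s * mat_vec p r A x i) \<in> \<eta> \<Otimes>\<^sub>M U \<rightarrow>\<^sub>M Rn p"
  proof -
    have "(\<lambda>(s, x). \<lambda>i\<in>{1..p}. s * mat_vec p r A x i) \<in> borel \<Otimes>\<^sub>M Rn r \<rightarrow>\<^sub>M Rn p"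
    proof -
      have "(\<lambda>(s, x). \<lambda>i\<in>{1..p}. s * (\<Sum>j=1..r. A i j * x j)) \<in> borel \<Otimes>\<^sub>M Rn r \<rightarrow>\<^sub>M Rn p"
        unfolding Rn_def by measurable
      then show ?thesis by (simp add: mat_vec_def cong: restrict_cong)
    qed
    moreover have "sets (\<eta> \<Otimes>\<^sub>M U) = sets (borel \<Otimes>\<^sub>M Rn r)"
      by (rule sets_pair_measure_cong) fact+
    ultimately show ?thesis by (simp cong: measurable_cong_sets)
  qed
  have cdf: "marginal_cdf p P \<Gamma> u t = measure (\<eta> \<Otimes>\<^sub>M U) (B u)" if q: "quad_form p \<Gamma> u > 0" for u
  proof -
    have [measurable]: "{x \<in> space (Rn p). \<bar>dot p u x\<bar>\<^sup>2 / quad_form p \<Gamma> u \<le> t} \<in> sets (Rn p)"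
      by measurable
    have d: "(dot p u (\<lambda>i\<in>{1..p}. s * mat_vec p r A x i))\<^sup>2 / quad_form p \<Gamma> u = (s * dot r (w u) x)\<^sup>2" for s x
    proof -
      have "dot p u (\<lambda>i\<in>{1..p}. s * mat_vec p r A x i) = s * (\<Sum>i=1..p. \<Sum>j=1..r. u i * A i j * x j)"
        by (simp add: dot_def mat_vec_def sum_distrib_left mult_ac)
      also have "\<dots> = s * (\<Sum>j=1..r. a u j * x j)"
        by (subst sum.swap) (simp add: a_def sum_distrib_right)
      also have "\<dots> = s * dot r (w u) x * sqrt (quad_form p \<Gamma> u)"
        using q by (simp add: dot_def w_def sum_distrib_right mult.assoc)
      finally show ?thesis using q by (simp add: power_mult_distrib)
    qed
    show ?thesis
      unfolding marginal_cdf_def Peq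
      by (subst measure_distr[OF meas], simp) 
         (rule arg_cong[where f = "measure _"],
          use measurable_space[OF meas] in \<open>auto simp: B_def d simp del: One_nat_def\<close>)
  qed
  obtain R where R: "orthogonal_mat r R" "\<And>y. dot r (w u) (mat_vec r r R y) = dot r (w v) y"
    using orthogonal_mat_exists[OF w1[OF u] w1[OF v]] by blast
  have UR: "distr U (Rn r) (mat_vec r r R) = U"
    using U R by (simp add: uniform_on_sphere_def)
  have "distr \<eta> \<eta> (\<lambda>s. s) \<Otimes>\<^sub>M distr U (Rn r) (mat_vec r r R)
      = distr (\<eta> \<Otimes>\<^sub>M U) (\<eta> \<Otimes>\<^sub>M Rn r) (\<lambda>(s, y). (s, mat_vec r r R y))"
    by (rule pair_measure_distr) (auto simp: UR U.sigma_finite_measure_axioms)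
  then have eq: "\<eta> \<Otimes>\<^sub>M U = distr (\<eta> \<Otimes>\<^sub>M U) (\<eta> \<Otimes>\<^sub>M Rn r) (\<lambda>(s, y). (s, mat_vec r r R y))"
    by (simp add: UR distr_id)
  have Bu: "B u \<in> sets (\<eta> \<Otimes>\<^sub>M Rn r)"
  proof -
    have "space (\<eta> \<Otimes>\<^sub>M U) = space (\<eta> \<Otimes>\<^sub>M Rn r)"
      by (rule sets_eq_imp_space_eq) (simp add: \<open>sets U = _\<close> cong: sets_pair_measure_cong)
    then show ?thesis unfolding B_def by simp
  qed
  have mR: "(\<lambda>(s, y). (s, mat_vec r r R y)) \<in> \<eta> \<Otimes>\<^sub>M U \<rightarrow>\<^sub>M \<eta> \<Otimes>\<^sub>M Rn r" by measurable
  have mR': "(\<lambda>(s, y). (s, mat_vec r r R y)) \<in> \<eta> \<Otimes>\<^sub>M U \<rightarrow>\<^sub>M \<eta> \<Otimes>\<^sub>M U" by measurable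
  have "measure (\<eta> \<Otimes>\<^sub>M U) (B u)
      = measure (\<eta> \<Otimes>\<^sub>M U) ((\<lambda>(s, y). (s, mat_vec r r R y)) -` B u \<inter> space (\<eta> \<Otimes>\<^sub>M U))"
    by (subst eq) (rule measure_distr[OF mR Bu])
  also have "(\<lambda>(s, y). (s, mat_vec r r R y)) -` B u \<inter> space (\<eta> \<Otimes>\<^sub>M U) = B v"
    using measurable_space[OF mR'] R(2) by (auto simp: B_def)
  finally show ?thesis using cdf u v by simp
qed

end

theory Submission
  imports Defs
begin

text \<open>Fix a direction \<open>u\<close> and put \<open>q = u\<^sup>T \<Gamma> u\<close>. In a canonical representation \<open>\<bar>u\<^sup>T X\<bar>\<^sup>2 / q\<close> has median \<open>1\<close>, and
the marginal condition says that its distribution function moves away from \<open>1/2\<close> at slope at least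
\<open>1 / sqrt \<kappa>\<close>. Hence, if both \<open>\<bar>u\<^sup>T X\<bar>\<^sup>2 \<le> c\<close> and \<open>\<bar>u\<^sup>T X\<bar>\<^sup>2 \<ge> c\<close> have \<open>P\<close>-probability at least \<open>1/2 - e\<close>
with \<open>e < \<tau>\<close>, then \<open>\<bar>c - q\<bar> \<le> e * sqrt \<kappa> * q\<close> (lemma \<open>ratio_close_from_depth\<close>). For
\<open>c = u\<^sup>T \<Gamma>\<^sub>h u\<close> this controls the estimator \<open>\<Gamma>\<^sub>h\<close> in the direction \<open>u\<close>, so that everything
reduces to a lower bound for the depth of \<open>\<Gamma>\<^sub>h\<close> under \<open>P\<close>, uniformly over the admissible directions.

That bound comes from comparing \<open>\<Gamma>\<^sub>h\<close> with the truncation \<open>\<Gamma>\<^sub>0\<close> of \<open>\<Gamma>\<close> to the band of width \<open>k\<close>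
(lemma \<open>maximizer_ratio_bound\<close>). The truncation changes every quadratic form by a factor
\<open>1 \<plusminus> \<beta>\<close> with \<open>\<beta>\<close> of order \<open>k powr - \<alpha>\<close>. Its depth under \<open>P\<close> is at least \<open>1/2 - 3 * \<beta>\<close>, because the
distribution functions are Lipschitz. Contamination costs at most \<open>\<epsilon>\<close>. If all empirical frequencies
of the slabs \<open>\<bar>u\<^sup>T x\<bar>\<^sup>2 \<le> c\<close> and \<open>\<bar>u\<^sup>T x\<bar>\<^sup>2 \<ge> c\<close> are within \<open>s\<close> of their probabilities, passing to the
sample and back costs \<open>2 * s\<close>. As \<open>\<Gamma>\<^sub>h\<close> is at least as deep as \<open>\<Gamma>\<^sub>0\<close> in the sample, its depth under
\<open>P\<close> is at least \<open>1/2 - e\<close> with \<open>e = 3 * \<beta> + (\<epsilon> + 2 * s) / (1 - \<epsilon>)\<close>.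

Three ingredients make this quantitative.

\<^item> A uniform deviation bound of the exact order \<open>s\<^sup>2 = O((k + log p + log (1/\<delta>)) / n)\<close>, with no
  logarithm in front of \<open>k\<close>. Slabs whose normal lives on a fixed window of at most \<open>2 * k\<close> coordinates are
  built from half-spaces of Vapnik-Chervonenkis dimension at most \<open>2 * k + 1\<close>. Symmetrization
  reduces the deviation to Rademacher sums, which the packing bound \<open>packing_bound\<close> and chaining
  (\<open>chaining\<close>) control at the rate \<open>sqrt (n * D)\<close> in dimension \<open>D\<close>. A union bound over at
  most \<open>p\<close> windows gives \<open>directional_deviation\<close>.

\<^item> The Lipschitz bound \<open>marginal_cdf_lipschitz\<close>, for which only ellipticity is available, as the
  radial variable is arbitrary. For \<open>p \<ge> 3\<close> one averages over the directions in a three-dimensional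
  subspace on which \<open>\<Gamma>\<close> is the Euclidean form. By Archimedes' theorem the projection of the uniform
  distribution on the two-sphere to an axis is uniform, which bounds the average for each fixed
  sample point. The dimensions \<open>p \<le> 2\<close> do not matter: there, for large \<open>C\<^sub>1\<close>, one has \<open>k = p\<close>
  and \<open>\<beta> = 0\<close>.

\<^item> A passage from the windows to the operator norm (\<open>banded_quad_form_bound\<close>): the quadratic form of a
  matrix of bandwidth \<open>k\<close> is the sum of its values on pairs of adjacent blocks of length \<open>k\<close> minus
  the sum of its values on single blocks.

The bias \<open>op_norm p (\<Gamma>\<^sub>0 - \<Gamma>)\<close> enters without a factor \<open>\<kappa>\<close>. It is absorbed because the lower slope
\<open>1 / sqrt \<kappa>\<close> cannot exceed the Lipschitz constant \<open>3/2\<close>, so that \<open>\<kappa> \<ge> 4/9\<close> whenever truncation takes place.\<close>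

section \<open>Shattering and packing numbers\<close>

text \<open>Gaussian elimination. Linear dependence is needed below for coefficient families indexed by
arbitrary finite sets: coordinates, sample points and singular values.\<close>

lemma homogeneous_system_nontrivial:
  fixes a :: "'i \<Rightarrow> 'j \<Rightarrow> real"
  assumes "finite I" "finite J" "card I < card J"
  shows "\<exists>c. (\<exists>j\<in>J. c j \<noteq> 0) \<and> (\<forall>i\<in>I. (\<Sum>j\<in>J. a i j * c j) = 0)"
  using assms
proof (induction I arbitrary: J a rule: finite_induct)
  case empty
  then have "\<exists>j. j \<in> J" by (auto simp: card_gt_0_iff)
  then show ?case by (intro exI[of _ "\<lambda>_. 1"]) auto
next
  case (insert i I)
  show ?case
  proof (cases "\<forall>j\<in>J. a i j = 0")
    case True
    have "card I < card J" using insert by simp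
    from insert.IH[OF insert.prems(1) this, of a] obtain c
      where "(\<exists>j\<in>J. c j \<noteq> 0) \<and> (\<forall>i\<in>I. (\<Sum>j\<in>J. a i j * c j) = 0)" by blast
    then show ?thesis using True by (intro exI[of _ c]) auto
  next
    case False
    then obtain j0 where j0: "j0 \<in> J" "a i j0 \<noteq> 0" by blast
    \<comment> \<open>Eliminate the unknown \<open>c j0\<close> with the equation of the pivot row \<open>i\<close>.\<close>
    define b where "b i' j = a i' j - a i' j0 * a i j / a i j0" for i' j
    have "card I < card (J - {j0})" using insert j0 by simp
    from insert.IH[OF _ this, of b] insert.prems(1) obtain c
      where c: "\<exists>j\<in>J - {j0}. c j \<noteq> 0" "\<And>i'. i' \<in> I \<Longrightarrow> (\<Sum>j\<in>J - {j0}. b i' j * c j) = 0" by auto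
    define s where "s = (\<Sum>j\<in>J - {j0}. a i j * c j)"
    define c' where "c' = c(j0 := - s / a i j0)"
    have split: "(\<Sum>j\<in>J. a i' j * c' j) = (\<Sum>j\<in>J - {j0}. a i' j * c j) - a i' j0 * s / a i j0" for i'
    proof -
      have "(\<Sum>j\<in>J. a i' j * c' j) = a i' j0 * c' j0 + (\<Sum>j\<in>J - {j0}. a i' j * c' j)"
        by (rule sum.remove) (use insert.prems j0 in auto)
      moreover have "(\<Sum>j\<in>J - {j0}. a i' j * c' j) = (\<Sum>j\<in>J - {j0}. a i' j * c j)"
        by (rule sum.cong) (auto simp: c'_def)
      ultimately show ?thesis by (simp add: c'_def)
    qed
    have "(\<Sum>j\<in>J. a i j * c' j) = 0"
      unfolding split using j0 by (simp add: s_def)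
    moreover have "(\<Sum>j\<in>J. a i' j * c' j) = 0" if "i' \<in> I" for i'
    proof -
      have "(\<Sum>j\<in>J - {j0}. b i' j * c j) = (\<Sum>j\<in>J - {j0}. a i' j * c j - a i' j0 / a i j0 * (a i j * c j))"
        by (rule sum.cong) (auto simp: b_def algebra_simps)
      also have "\<dots> = (\<Sum>j\<in>J - {j0}. a i' j * c j) - a i' j0 / a i j0 * s"
        by (simp add: sum_subtractf s_def sum_distrib_left)
      finally show ?thesis unfolding split using c(2)[OF that] by simp
    qed
    moreover have "\<exists>j\<in>J. c' j \<noteq> 0" using c(1) by (auto simp: c'_def)
    ultimately show ?thesis by (intro exI[of _ c']) auto
  qed
qed

definition shatters :: "'a set set \<Rightarrow> 'a set \<Rightarrow> bool" where
  "shatters F S \<longleftrightarrow> (\<forall>T\<subseteq>S. \<exists>A\<in>F. A \<inter> S = T)"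

lemma shattersD: "shatters F S \<Longrightarrow> T \<subseteq> S \<Longrightarrow> \<exists>A\<in>F. A \<inter> S = T"
  by (auto simp: shatters_def)

text \<open>Pajor's form of the Sauer-Shelah lemma. Removing a point \<open>x\<close> splits \<open>F\<close> into the sets that avoid
\<open>x\<close> and the sets that contain it. A set shattered by only one part is shattered by \<open>F\<close>, and a set
\<open>S\<close> shattered by both counts twice, since then \<open>insert x S\<close> is shattered as well.\<close>

lemma card_le_card_shattered:
  assumes "finite X" "F \<subseteq> Pow X"
  shows "card F \<le> card {S. S \<subseteq> X \<and> shatters F S}"
  using assms
proof (induction X arbitrary: F rule: finite_induct)
  case empty
  then have "F = {} \<or> F = {{}}" by auto
  then show ?case
  proof
    assume "F = {{}}"
    then have "{S. S \<subseteq> {} \<and> shatters F S} = {{}}" by (auto simp: shatters_def)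
    then show ?thesis using \<open>F = {{}}\<close> by simp
  qed simp
next
  case (insert x X)
  define F0 where "F0 = {A\<in>F. x \<notin> A}"
  define F1 where "F1 = (\<lambda>A. A - {x}) ` {A\<in>F. x \<in> A}"
  define S0 where "S0 = {S. S \<subseteq> X \<and> shatters F0 S}"
  define S1 where "S1 = {S. S \<subseteq> X \<and> shatters F1 S}"
  have fin: "finite F" using insert finite_subset[of F "Pow (insert x X)"] by simp
  have "inj_on (\<lambda>A. A - {x}) {A\<in>F. x \<in> A}" by (auto simp: inj_on_def)
  then have c1: "card F1 = card {A\<in>F. x \<in> A}" unfolding F1_def by (rule card_image)
  have "F = F0 \<union> {A\<in>F. x \<in> A}" "F0 \<inter> {A\<in>F. x \<in> A} = {}" by (auto simp: F0_def)
  then have "card F = card F0 + card F1"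
    using fin c1 card_Un_disjoint[of F0 "{A\<in>F. x \<in> A}"] by (simp add: F0_def)
  also have "\<dots> \<le> card S0 + card S1"
    unfolding S0_def S1_def by (intro add_mono insert.IH) (use insert.prems in \<open>auto simp: F0_def F1_def\<close>)
  also have "\<dots> = card (S0 \<union> S1) + card (S0 \<inter> S1)"
    by (rule card_Un_Int) (use insert in \<open>auto simp: S0_def S1_def\<close>)
  also have "card (S0 \<inter> S1) = card (insert x ` (S0 \<inter> S1))"
    by (rule card_image[symmetric]) (use insert.hyps in \<open>auto simp: S0_def intro!: inj_onI dest!: insert_ident[THEN iffD1, rotated 2]\<close>)
  also have "card (S0 \<union> S1) + card (insert x ` (S0 \<inter> S1)) = card ((S0 \<union> S1) \<union> insert x ` (S0 \<inter> S1))"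
    by (rule card_Un_disjoint[symmetric]) (use insert in \<open>auto simp: S0_def S1_def\<close>)
  also have "\<dots> \<le> card {S. S \<subseteq> insert x X \<and> shatters F S}"
  proof (rule card_mono)
    show "finite {S. S \<subseteq> insert x X \<and> shatters F S}" using insert by simp
    have sh01: "shatters F S" if "S \<in> S0 \<union> S1" for S
      unfolding shatters_def
    proof (intro allI impI)
      fix T assume T: "T \<subseteq> S"
      have xS: "x \<notin> S" using that insert by (auto simp: S0_def S1_def)
      from that show "\<exists>A\<in>F. A \<inter> S = T"
      proof
        assume "S \<in> S0"
        then obtain A where "A \<in> F0" "A \<inter> S = T" using T shattersD[of F0 S T] by (auto simp: S0_def)
        then show ?thesis by (auto simp: F0_def)
      next
        assume "S \<in> S1"
        then obtain A where "A \<in> F1" "A \<inter> S = T" using T shattersD[of F1 S T] by (auto simp: S1_def)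
        then show ?thesis using xS by (auto simp: F1_def)
      qed
    qed
    have sh2: "shatters F (insert x S)" if S: "S \<in> S0 \<inter> S1" for S
      unfolding shatters_def
    proof (intro allI impI)
      fix T assume T: "T \<subseteq> insert x S"
      have xS: "x \<notin> S" using that insert by (auto simp: S0_def)
      show "\<exists>A\<in>F. A \<inter> insert x S = T"
      proof (cases "x \<in> T")
        case False
        then obtain A where "A \<in> F0" "A \<inter> S = T"
          using T S shattersD[of F0 S T] by (auto simp: S0_def)
        then show ?thesis using False by (auto simp: F0_def)
      next
        case True
        then obtain A where "A \<in> F1" "A \<inter> S = T - {x}"
          using T S shattersD[of F1 S "T - {x}"] by (auto simp: S1_def)
        then obtain B where B: "B \<in> F" "x \<in> B" "A = B - {x}" by (auto simp: F1_def)
        then have "B \<inter> insert x S = T" using \<open>A \<inter> S = T - {x}\<close> True xS by auto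
        then show ?thesis using B by blast
      qed
    qed
    show "(S0 \<union> S1) \<union> insert x ` (S0 \<inter> S1) \<subseteq> {S. S \<subseteq> insert x X \<and> shatters F S}"
      using sh01 sh2 by (auto simp: S0_def S1_def)
  qed
  finally show ?case .
qed

lemma sum_Pow_power_card:
  fixes x :: real
  assumes "finite X"
  shows "(\<Sum>S\<in>Pow X. x ^ card S) = (1 + x) ^ card X"
proof -
  have "(\<Prod>i\<in>X. x + 1) = (\<Sum>S\<in>Pow X. (\<Prod>i\<in>S. x) * (\<Prod>i\<in>X - S. 1))"
    by (rule prod_add[OF assms])
  then show ?thesis by (simp add: add.commute)
qed

text \<open>The free parameter \<open>x\<close> replaces the usual binomial sum: weighting each shattered set by
\<open>x ^ card S\<close> turns the bound into \<open>(1 + x) ^ card X\<close>, and \<open>x\<close> can be adapted to the application.\<close>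

lemma sauer_shelah:
  fixes x :: real
  assumes X: "finite X" "F \<subseteq> Pow X" and vc: "\<And>S. S \<subseteq> X \<Longrightarrow> shatters F S \<Longrightarrow> card S \<le> D"
    and x: "0 < x" "x \<le> 1"
  shows "card F * x ^ D \<le> exp (x * card X)"
proof -
  have "card F * x ^ D \<le> card {S. S \<subseteq> X \<and> shatters F S} * x ^ D"
    using card_le_card_shattered[OF X] x by (intro mult_right_mono) auto
  also have "\<dots> = (\<Sum>S\<in>{S. S \<subseteq> X \<and> shatters F S}. x ^ D)" by simp
  also have "\<dots> \<le> (\<Sum>S\<in>{S. S \<subseteq> X \<and> shatters F S}. x ^ card S)"
    using vc x by (intro sum_mono power_decreasing) auto
  also have "\<dots> \<le> (\<Sum>S\<in>Pow X. x ^ card S)"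
    using X x by (intro sum_mono2) auto
  also have "\<dots> = (1 + x) ^ card X" by (rule sum_Pow_power_card[OF X(1)])
  also have "\<dots> \<le> exp x ^ card X"
    using x by (intro power_mono) auto
  also have "\<dots> = exp (x * card X)" by (simp add: exp_of_nat_mult[symmetric] mult.commute)
  finally show ?thesis .
qed

text \<open>A random tuple of length \<open>m\<close> misses the symmetric difference of a fixed pair with probability at
most \<open>(1 - e) ^ m \<le> exp (- e * m)\<close>, so by the union bound over all pairs some tuple separates all
members of \<open>F\<close>. The probability is expressed by counting tuples.\<close>

lemma exists_distinguishing_tuple:
  fixes e :: real and m :: nat
  assumes I: "finite I" "I \<noteq> {}" and F: "finite F" "F \<subseteq> Pow I"
    and sep: "\<And>A B. A \<in> F \<Longrightarrow> B \<in> F \<Longrightarrow> A \<noteq> B \<Longrightarrow> e * card I \<le> card (sym_diff A B)"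
    and e: "e \<le> 1" and m: "real (card F) ^ 2 * exp (- e * m) < 1"
  shows "\<exists>f. f \<in> {..<m} \<rightarrow>\<^sub>E I \<and> (\<forall>A\<in>F. \<forall>B\<in>F. A \<noteq> B \<longrightarrow> (\<exists>i<m. f i \<in> sym_diff A B))"
proof (rule ccontr)
  assume contra: "\<not> ?thesis"
  \<comment> \<open>The tuples that fail to separate the pair.\<close>
  define bad where "bad = (\<lambda>(A, B). {..<m} \<rightarrow>\<^sub>E (I - sym_diff A B))"
  define P where "P = {(A, B) \<in> F \<times> F. A \<noteq> B}"
  have n0: "card I > 0" using I by (simp add: card_gt_0_iff)
  have finP: "finite P" using F unfolding P_def by (auto intro: finite_subset[of _ "F \<times> F"])
  have sub: "{..<m} \<rightarrow>\<^sub>E I \<subseteq> (\<Union>q\<in>P. bad q)"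
  proof
    fix f assume f: "f \<in> {..<m} \<rightarrow>\<^sub>E I"
    define d where "d A B i \<longleftrightarrow> f i \<in> sym_diff A B" for A B i
    have "\<not> (\<forall>A\<in>F. \<forall>B\<in>F. A \<noteq> B \<longrightarrow> (\<exists>i<m. d A B i))"
      unfolding d_def by (rule contrapos_nn[OF contra], intro exI[of _ f] conjI f)
    then obtain A B where AB: "A \<in> F" "B \<in> F" "A \<noteq> B" "\<And>i. i < m \<Longrightarrow> \<not> d A B i" by auto
    have "f \<in> bad (A, B)" unfolding bad_def prod.case
    proof (rule PiE_I)
      fix i assume i: "i \<in> {..<m}"
      show "f i \<in> I - sym_diff A B"
        by (rule DiffI[OF PiE_mem[OF f i] AB(4)[unfolded d_def]]) (use i in simp)
    qed (rule PiE_arb[OF f])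
    moreover have "(A, B) \<in> P" using AB(1-3) by (simp add: P_def)
    ultimately show "f \<in> (\<Union>q\<in>P. bad q)" by (rule UN_I[rotated])
  qed
  have finbad: "finite (bad q)" if "q \<in> P" for q
    unfolding bad_def by (cases q) (simp, intro finite_PiE finite_Diff I finite_lessThan)
  have cb: "real (card (bad q)) \<le> exp (- e * m) * real (card I) ^ m" if qP: "q \<in> P" for q
  proof -
    obtain A B where q: "q = (A, B)" "A \<in> F" "B \<in> F" "A \<noteq> B" using qP by (auto simp: P_def)
    have sI: "sym_diff A B \<subseteq> I" using q F by auto
    have "real (card (I - sym_diff A B)) = real (card I) - real (card (sym_diff A B))"
      using card_Diff_subset[OF finite_subset[OF sI I(1)] sI] card_mono[OF I(1) sI] by simp
    also have "\<dots> \<le> (1 - e) * card I" using sep[OF q(2-4)] by (simp add: algebra_simps)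
    also have "\<dots> \<le> exp (- e) * card I"
      using exp_ge_add_one_self[of "-e"] by (intro mult_right_mono) auto
    finally have "real (card (I - sym_diff A B)) ^ m \<le> (exp (- e) * card I) ^ m"
      by (intro power_mono) auto
    also have "\<dots> = exp (- e * m) * real (card I) ^ m"
      by (simp add: power_mult_distrib exp_of_nat_mult[symmetric] mult.commute)
    finally show ?thesis by (simp add: q bad_def card_PiE)
  qed
  have "real (card I) ^ m = real (card ({..<m} \<rightarrow>\<^sub>E I))" by (simp add: card_PiE)
  also have "\<dots> \<le> real (card (\<Union>q\<in>P. bad q))"
    by (intro of_nat_mono card_mono sub finite_UN_I finP finbad)
  also have "\<dots> \<le> (\<Sum>q\<in>P. real (card (bad q)))"
    using card_UN_le[OF finP, of bad] by (simp flip: of_nat_sum)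
  also have "\<dots> \<le> (\<Sum>q\<in>P. exp (- e * m) * real (card I) ^ m)" by (intro sum_mono cb)
  also have "\<dots> = card P * (exp (- e * m) * real (card I) ^ m)" by simp
  also have "\<dots> \<le> (card F)\<^sup>2 * (exp (- e * m) * real (card I) ^ m)"
  proof (intro mult_right_mono of_nat_mono)
    have "card P \<le> card (F \<times> F)" using F by (intro card_mono) (auto simp: P_def)
    then show "card P \<le> (card F)\<^sup>2" by (simp add: card_cartesian_product power2_eq_square)
  qed auto
  also have "\<dots> = ((card F)\<^sup>2 * exp (- e * m)) * real (card I) ^ m" by simp
  also have "\<dots> < 1 * real (card I) ^ m" using m n0 by (intro mult_strict_right_mono) auto
  finally show False by simp
qed

text \<open>A separated family of dimension \<open>D\<close> has at most \<open>O(1 / e) ^ (2 * D)\<close> members, independently of the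
size of the ground set. With \<open>N = card F\<close>, about \<open>2 * ln N / e\<close> sample points already distinguish all
members, and the Sauer-Shelah bound on that sample with \<open>x = e / 4\<close> reads
\<open>N * (e / 4) ^ D \<le> C * sqrt N\<close>: the choice of \<open>x\<close> makes the right-hand side grow only like \<open>sqrt N\<close>.\<close>

lemma packing_bound:
  fixes e :: real
  assumes I: "finite I" and F: "F \<subseteq> Pow I"
    and vc: "\<And>S. S \<subseteq> I \<Longrightarrow> shatters F S \<Longrightarrow> card S \<le> D"
    and e: "0 < e" "e \<le> 1"
    and sep: "\<And>A B. A \<in> F \<Longrightarrow> B \<in> F \<Longrightarrow> A \<noteq> B \<Longrightarrow> e * card I \<le> card (sym_diff A B)"
  shows "card F \<le> 2 * (4 / e) ^ (2 * D)"
proof (cases "card F \<le> 1")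
  case True
  have "1 \<le> (4 / e) ^ (2 * D)" using e by (intro one_le_power) (auto simp: field_simps)
  then show ?thesis using True by linarith
next
  case False
  define N where "N = real (card F)"
  have N: "N \<ge> 2" using False by (simp add: N_def)
  have finF: "finite F" using I F finite_subset by auto
  have Ine: "I \<noteq> {}"
  proof
    assume "I = {}"
    then have "F \<subseteq> {{}}" using F by auto
    then have "card F \<le> card {{}::'a set}" by (intro card_mono) auto
    then show False using False by simp
  qed
  \<comment> \<open>The least length with \<open>N\<^sup>2 * exp (- e * m) < 1\<close>.\<close>
  define m where "m = nat \<lfloor>2 * ln N / e\<rfloor> + 1"
  have m: "2 * ln N / e < m" "real m \<le> 2 * ln N / e + 1"
    using N e unfolding m_def by (auto simp: floor_le_iff) linarith+
  have "N ^ 2 * exp (- e * m) < 1"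
  proof -
    have "2 * ln N < e * m" using m e by (simp add: field_simps)
    then have "exp (2 * ln N - e * m) < 1" by simp
    moreover have "exp (2 * ln N - e * m) = N ^ 2 * exp (- e * m)"
      using N by (simp add: exp_diff exp_minus divide_inverse exp_double)
    ultimately show ?thesis by simp
  qed
  then have m': "real (card F) ^ 2 * exp (- e * m) < 1" by (simp only: N_def)
  have "\<exists>f. f \<in> {..<m} \<rightarrow>\<^sub>E I \<and> (\<forall>A\<in>F. \<forall>B\<in>F. A \<noteq> B \<longrightarrow> (\<exists>i<m. f i \<in> sym_diff A B))"
    by (rule exists_distinguishing_tuple[where e = e, OF I Ine finF F sep e(2) m'])
  then obtain f where f: "f \<in> {..<m} \<rightarrow>\<^sub>E I"
    and dist: "\<forall>A\<in>F. \<forall>B\<in>F. A \<noteq> B \<longrightarrow> (\<exists>i<m. f i \<in> sym_diff A B)" by (elim exE conjE)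
  define J where "J = f ` {..<m}"
  have J: "J \<subseteq> I" "finite J" "card J \<le> m"
    using f card_image_le[of "{..<m}" f] by (auto simp: J_def)
  have inj: "inj_on (\<lambda>A. A \<inter> J) F"
  proof (rule inj_onI, rule ccontr)
    fix A B assume AB: "A \<in> F" "B \<in> F" "A \<inter> J = B \<inter> J" "A \<noteq> B"
    with dist obtain i where "i < m" "f i \<in> sym_diff A B" by meson
    then have "f i \<in> J" by (auto simp: J_def)
    then show False using AB(3) \<open>f i \<in> sym_diff A B\<close> by auto
  qed
  have "card ((\<lambda>A. A \<inter> J) ` F) * (e / 4) ^ D \<le> exp (e / 4 * card J)"
  proof (rule sauer_shelah)
    fix S assume S: "S \<subseteq> J" "shatters ((\<lambda>A. A \<inter> J) ` F) S"
    have "shatters F S"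
      unfolding shatters_def
    proof (intro allI impI)
      fix T assume "T \<subseteq> S"
      then obtain A where "A \<in> F" "A \<inter> J \<inter> S = T" using shattersD[OF S(2)] by blast
      then show "\<exists>A\<in>F. A \<inter> S = T" using S(1) by (intro bexI[of _ A]) auto
    qed
    then show "card S \<le> D" using vc S J by blast
  qed (use J e in auto)
  then have "N * (e / 4) ^ D \<le> exp (e / 4 * card J)" using card_image[OF inj] by (simp add: N_def)
  also have "\<dots> \<le> exp (e / 4 * (2 * ln N / e + 1))"
    using J m e by (intro exp_le_cancel_iff[THEN iffD2] mult_left_mono) auto
  \<comment> \<open>Squaring turns the factor \<open>sqrt N\<close> on the right into \<open>N\<close>, which cancels against the left-hand side.\<close>
  finally have "(N * (e / 4) ^ D)\<^sup>2 \<le> (exp (e / 4 * (2 * ln N / e + 1)))\<^sup>2"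
    using N e by (intro power_mono) auto
  also have "\<dots> = exp (2 * (e / 4 * (2 * ln N / e + 1)))" by (rule exp_double[symmetric])
  also have "2 * (e / 4 * (2 * ln N / e + 1)) = ln N + e / 2" using e by (simp add: field_simps)
  also have "exp (ln N + e / 2) = N * exp (e / 2)" using N by (simp add: exp_add)
  also have "\<dots> \<le> N * 2"
  proof -
    have "exp (e / 2) \<le> exp (1 / 2)" using e by simp
    also have "exp (1 / 2 :: real) \<le> 2"
      using exp_bound[of "1/2::real"] by (simp add: power2_eq_square)
    finally show ?thesis using N by simp
  qed
  finally have "(N * (e / 4) ^ D)\<^sup>2 \<le> N * 2" .
  moreover have "(N * (e / 4) ^ D)\<^sup>2 = N * (N * (e / 4) ^ (2 * D))"
    by (simp add: power2_eq_square mult_2 power_add)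
  ultimately have "N * (e / 4) ^ (2 * D) \<le> 2" using N by simp
  then have "N \<le> 2 / (e / 4) ^ (2 * D)" using e by (simp add: pos_le_divide_eq)
  also have "\<dots> = 2 * (4 / e) ^ (2 * D)" using e by (simp add: power_divide)
  finally show ?thesis by (simp add: N_def)
qed

lemma shatters_mono: "shatters F S \<Longrightarrow> F \<subseteq> G \<Longrightarrow> shatters G S"
  unfolding shatters_def by (meson subsetD)

section \<open>Chaining for Rademacher sums\<close>

text \<open>The quotient \<open>exp (x\<^sup>2 / 2) / cosh x\<close> increases for \<open>x \<ge> 0\<close>, because \<open>sinh y \<le> y * cosh y\<close>.\<close>

lemma cosh_real_le_exp_half_square: "cosh (x::real) \<le> exp (x\<^sup>2 / 2)"
proof -
  have 1: "cosh x \<le> exp (x\<^sup>2 / 2)" if "x \<ge> 0" for x :: real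
  proof -
    define f where "f x = exp (x\<^sup>2 / 2) / cosh x" for x :: real
    have "f 0 \<le> f x"
    proof (rule DERIV_nonneg_imp_nondecreasing[OF that])
      fix y :: real assume y: "0 \<le> y" "y \<le> x"
      have "sinh y \<le> y * cosh y"
      proof -
        have "(\<lambda>y. y * cosh y - sinh y) 0 \<le> (\<lambda>y. y * cosh y - sinh y) y"
        proof (rule DERIV_nonneg_imp_nondecreasing[OF y(1)])
          fix z :: real assume "0 \<le> z" "z \<le> y"
          then show "\<exists>d. ((\<lambda>y. y * cosh y - sinh y) has_real_derivative d) (at z) \<and> 0 \<le> d"
            by (intro exI[of _ "z * sinh z"]) (auto intro!: derivative_eq_intros)
        qed
        then show ?thesis by simp
      qed
      then show "\<exists>d. (f has_real_derivative d) (at y) \<and> 0 \<le> d"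
        unfolding f_def
        by (intro exI[of _ "(exp (y\<^sup>2 / 2) * (y * cosh y - sinh y)) / (cosh y * cosh y)"] conjI)
           (auto intro!: derivative_eq_intros simp: field_simps)
    qed
    then show ?thesis by (simp add: f_def field_simps)
  qed
  show ?thesis using 1[of "\<bar>x\<bar>"] by simp
qed

text \<open>A subset \<open>S\<close> encodes the sign vector that is \<open>+1\<close> on \<open>S\<close> and \<open>-1\<close> elsewhere. Probabilities over
uniform random signs thus become cardinalities of sets of subsets.\<close>

definition sgn_of :: "'a set \<Rightarrow> 'a \<Rightarrow> real" where
  "sgn_of S i = (if i \<in> S then 1 else -1)"

lemma rademacher_mgf:
  assumes "finite I"
  shows "(\<Sum>S\<in>Pow I. exp (\<Sum>i\<in>I. sgn_of S i * v i)) \<le> 2 ^ card I * exp ((\<Sum>i\<in>I. (v i)\<^sup>2) / 2)"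
proof -
  have "(\<Sum>S\<in>Pow I. exp (\<Sum>i\<in>I. sgn_of S i * v i)) = (\<Sum>S\<in>Pow I. (\<Prod>i\<in>S. exp (v i)) * (\<Prod>i\<in>I - S. exp (- v i)))"
  proof (rule sum.cong[OF refl])
    fix S assume S: "S \<in> Pow I"
    then have fin: "finite S" using assms finite_subset by auto
    have "(\<Sum>i\<in>I. sgn_of S i * v i) = (\<Sum>i\<in>S. v i) + (\<Sum>i\<in>I - S. - v i)"
      using S assms by (subst sum.subset_diff[of S I]) (auto simp: sgn_of_def sum_negf)
    then show "exp (\<Sum>i\<in>I. sgn_of S i * v i) = (\<Prod>i\<in>S. exp (v i)) * (\<Prod>i\<in>I - S. exp (- v i))"
      using fin assms by (simp add: exp_add exp_sum del: sum_negf)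
  qed
  also have "\<dots> = (\<Prod>i\<in>I. exp (v i) + exp (- v i))" by (rule prod_add[OF assms, symmetric])
  also have "\<dots> \<le> (\<Prod>i\<in>I. 2 * exp ((v i)\<^sup>2 / 2))"
  proof (rule prod_mono)
    fix i
    show "0 \<le> exp (v i) + exp (- v i) \<and> exp (v i) + exp (- v i) \<le> 2 * exp ((v i)\<^sup>2 / 2)"
      using cosh_real_le_exp_half_square[of "v i"] by (simp add: cosh_field_def add_nonneg_nonneg)
  qed
  also have "\<dots> = 2 ^ card I * exp ((\<Sum>i\<in>I. (v i)\<^sup>2) / 2)"
    using assms by (simp add: prod.distrib exp_sum sum_divide_distrib)
  finally show ?thesis .
qed

text \<open>The Chernoff bound at the optimal parameter \<open>s / V\<close>.\<close>

lemma rademacher_tail: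
  assumes I: "finite I" and V: "(\<Sum>i\<in>I. (v i)\<^sup>2) \<le> V" "V > 0" and s: "s \<ge> 0"
  shows "card {S\<in>Pow I. \<bar>\<Sum>i\<in>I. sgn_of S i * v i\<bar> > s} \<le> 2 * (2 ^ card I * exp (- (s\<^sup>2 / (2 * V))))"
proof -
  have one: "card {S\<in>Pow I. (\<Sum>i\<in>I. sgn_of S i * w i) > s} \<le> 2 ^ card I * exp (- (s\<^sup>2 / (2 * V)))"
    if w: "(\<Sum>i\<in>I. (w i)\<^sup>2) \<le> V" for w
  proof -
    define l where "l = s / V"
    have l: "l \<ge> 0" using V s by (simp add: l_def)
    have "card {S\<in>Pow I. (\<Sum>i\<in>I. sgn_of S i * w i) > s} * exp (l * s)
        = (\<Sum>S\<in>{S\<in>Pow I. (\<Sum>i\<in>I. sgn_of S i * w i) > s}. exp (l * s))" by simp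
    also have "\<dots> \<le> (\<Sum>S\<in>{S\<in>Pow I. (\<Sum>i\<in>I. sgn_of S i * w i) > s}. exp (\<Sum>i\<in>I. sgn_of S i * (l * w i)))"
    proof (rule sum_mono)
      fix S assume "S \<in> {S\<in>Pow I. (\<Sum>i\<in>I. sgn_of S i * w i) > s}"
      then have "l * s \<le> l * (\<Sum>i\<in>I. sgn_of S i * w i)" using l by (intro mult_left_mono) auto
      then show "exp (l * s) \<le> exp (\<Sum>i\<in>I. sgn_of S i * (l * w i))"
        by (simp add: sum_distrib_left mult_ac)
    qed
    also have "\<dots> \<le> (\<Sum>S\<in>Pow I. exp (\<Sum>i\<in>I. sgn_of S i * (l * w i)))"
      using I by (intro sum_mono2) auto
    also have "\<dots> \<le> 2 ^ card I * exp ((\<Sum>i\<in>I. (l * w i)\<^sup>2) / 2)" by (rule rademacher_mgf[OF I])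
    also have "\<dots> \<le> 2 ^ card I * exp (l\<^sup>2 * V / 2)"
      using w by (auto simp: power_mult_distrib simp flip: sum_distrib_left intro!: mult_left_mono)
    finally have "card {S\<in>Pow I. (\<Sum>i\<in>I. sgn_of S i * w i) > s} \<le> 2 ^ card I * exp (l\<^sup>2 * V / 2) / exp (l * s)"
      by (simp add: pos_le_divide_eq)
    also have "\<dots> = 2 ^ card I * exp (l\<^sup>2 * V / 2 - l * s)" by (simp add: exp_diff)
    also have "l\<^sup>2 * V / 2 - l * s = - (s\<^sup>2 / (2 * V))" using V by (simp add: l_def field_simps power2_eq_square)
    finally show ?thesis .
  qed
  have "{S\<in>Pow I. \<bar>\<Sum>i\<in>I. sgn_of S i * v i\<bar> > s} \<subseteq>
      {S\<in>Pow I. (\<Sum>i\<in>I. sgn_of S i * v i) > s} \<union> {S\<in>Pow I. (\<Sum>i\<in>I. sgn_of S i * (- v i)) > s}"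
    by (auto simp: sum_negf)
  then have "card {S\<in>Pow I. \<bar>\<Sum>i\<in>I. sgn_of S i * v i\<bar> > s} \<le>
      card ({S\<in>Pow I. (\<Sum>i\<in>I. sgn_of S i * v i) > s} \<union> {S\<in>Pow I. (\<Sum>i\<in>I. sgn_of S i * (- v i)) > s})"
    using I by (intro card_mono) auto
  also have "\<dots> \<le> card {S\<in>Pow I. (\<Sum>i\<in>I. sgn_of S i * v i) > s} + card {S\<in>Pow I. (\<Sum>i\<in>I. sgn_of S i * (- v i)) > s}"
    by (rule card_Un_le)
  finally show ?thesis using one[of v] one[of "\<lambda>i. - v i"] V by simp
qed

text \<open>Maximal separated sets are nets. The lemma supplies the approximating sets of the chaining
argument at each scale.\<close>

lemma maximal_separated_subset:
  fixes d :: "'a \<Rightarrow> 'a \<Rightarrow> real"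
  assumes "finite T" and sym: "\<And>A B. d A B = d B A" and refl: "\<And>A. d A A \<le> r"
  shows "\<exists>N\<subseteq>T. (\<forall>A\<in>N. \<forall>B\<in>N. A \<noteq> B \<longrightarrow> d A B > r) \<and> (\<forall>A\<in>T. \<exists>B\<in>N. d A B \<le> r)"
  using assms(1)
proof (induction T rule: finite_induct)
  case (insert A T)
  then obtain N where N: "N \<subseteq> T" "\<forall>A\<in>N. \<forall>B\<in>N. A \<noteq> B \<longrightarrow> d A B > r" "\<forall>A\<in>T. \<exists>B\<in>N. d A B \<le> r" by blast
  show ?case
  proof (cases "\<exists>B\<in>N. d A B \<le> r")
    case True
    then show ?thesis using N by (intro exI[of _ N]) auto
  next
    case False
    then show ?thesis using N sym refl by (intro exI[of _ "insert A N"]) (auto simp: not_le)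
  qed
qed auto

lemma sum_Suc_div_power2: "(\<Sum>i<m. (real i + 1) / 2 ^ i) \<le> 4"
proof -
  have "(\<Sum>i<m. (real i + 1) / 2 ^ i) = 4 - (2 * real m + 4) / 2 ^ m"
  proof (induction m)
    case (Suc m)
    have "(\<Sum>i<Suc m. (real i + 1) / 2 ^ i) = 4 - (2 * real m + 4) / 2 ^ m + (real m + 1) / 2 ^ m"
      using Suc by simp
    also have "\<dots> = 4 - (2 * real (Suc m) + 4) / 2 ^ Suc m" by (simp add: field_simps)
    finally show ?case .
  qed simp
  then show ?thesis by simp
qed

lemma sum_half_power: "(\<Sum>i<m. 1 / 2 ^ Suc i) \<le> (1::real)"
proof -
  have "(\<Sum>i<m. 1 / 2 ^ Suc i) = 1 - 1 / (2::real) ^ m"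
    by (induction m) (auto simp: field_simps)
  then show ?thesis by simp
qed

text \<open>One step of the chain: each set of the finer net \<open>N\<close> is replaced by a set of the coarser net \<open>N'\<close>
at distance at most \<open>V\<close>. The sum over the set changes by a Rademacher sum with variance proxy \<open>V\<close>, and
one such link per element of \<open>N\<close> has to be controlled.\<close>

lemma chaining_level:
  fixes s t V :: real
  assumes I: "finite I" and N: "finite N" and s: "s \<ge> 0" and V: "V > 0"
    and close: "\<And>A. A \<in> N \<Longrightarrow> A \<subseteq> I \<and> (\<exists>B\<in>N'. B \<subseteq> I \<and> card (sym_diff A B) \<le> V)"
  shows "real (card {S\<in>Pow I. \<exists>A\<in>N. \<bar>\<Sum>i\<in>A. sgn_of S i\<bar> > t + s})
     \<le> card {S\<in>Pow I. \<exists>B\<in>N'. \<bar>\<Sum>i\<in>B. sgn_of S i\<bar> > t} + card N * (2 * (2 ^ card I * exp (- (s\<^sup>2 / (2 * V)))))"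
proof -
  \<comment> \<open>The parent of \<open>A\<close> in the coarser net.\<close>
  define b where "b A = (SOME B. B \<in> N' \<and> B \<subseteq> I \<and> card (sym_diff A B) \<le> V)" for A
  have b: "b A \<in> N'" "b A \<subseteq> I" "card (sym_diff A (b A)) \<le> V" if "A \<in> N" for A
    using someI_ex[of "\<lambda>B. B \<in> N' \<and> B \<subseteq> I \<and> card (sym_diff A B) \<le> V"] close[OF that]
    unfolding b_def by blast+
  define link where "link A S = (\<Sum>i\<in>I. sgn_of S i * (indicat_real A i - indicat_real (b A) i))" for A S
  have *: "(\<Sum>i\<in>I. sgn_of S i * indicat_real B i) = (\<Sum>i\<in>B. sgn_of S i)" if "B \<subseteq> I" for B S
    using I that by (simp add: indicator_def sum.If_cases Int_absorb1 if_distrib cong: if_cong)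
  have link: "link A S = (\<Sum>i\<in>A. sgn_of S i) - (\<Sum>i\<in>b A. sgn_of S i)" if "A \<in> N" for A S
    using *[of A] *[of "b A"] close[OF that] b[OF that]
    by (simp add: link_def right_diff_distrib sum_subtractf)
  define P where "P A = {S\<in>Pow I. \<bar>link A S\<bar> > s}" for A
  have P: "real (card (P A)) \<le> 2 * (2 ^ card I * exp (- (s\<^sup>2 / (2 * V))))" if A: "A \<in> N" for A
    unfolding P_def link_def
  proof (rule rademacher_tail[OF I _ V s])
    have sI: "sym_diff A (b A) \<subseteq> I" using close[OF A] b[OF A] by auto
    have "(\<Sum>i\<in>I. (indicat_real A i - indicat_real (b A) i)\<^sup>2) = (\<Sum>i\<in>I. indicat_real (sym_diff A (b A)) i)"
      by (rule sum.cong) (auto simp: indicator_def)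
    also have "\<dots> = (\<Sum>i\<in>sym_diff A (b A). indicat_real (sym_diff A (b A)) i)"
      by (rule sum.mono_neutral_right[OF I sI]) (simp add: indicator_def)
    also have "\<dots> = (\<Sum>i\<in>sym_diff A (b A). 1)"
      by (rule sum.cong[OF refl]) (simp only: indicator_simps)
    also have "\<dots> = card (sym_diff A (b A))" by (simp only: sum_constant mult_1_right)
    finally show "(\<Sum>i\<in>I. (indicat_real A i - indicat_real (b A) i)\<^sup>2) \<le> V" using b(3)[OF A] by linarith
  qed
  let ?E = "{S\<in>Pow I. \<exists>B\<in>N'. \<bar>\<Sum>i\<in>B. sgn_of S i\<bar> > t}"
  have "{S\<in>Pow I. \<exists>A\<in>N. \<bar>\<Sum>i\<in>A. sgn_of S i\<bar> > t + s} \<subseteq> ?E \<union> (\<Union>A\<in>N. P A)"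
  proof
    fix S assume "S \<in> {S\<in>Pow I. \<exists>A\<in>N. \<bar>\<Sum>i\<in>A. sgn_of S i\<bar> > t + s}"
    then obtain A where A: "S \<in> Pow I" "A \<in> N" "\<bar>\<Sum>i\<in>A. sgn_of S i\<bar> > t + s" by blast
    show "S \<in> ?E \<union> (\<Union>A\<in>N. P A)"
    proof (cases "\<bar>link A S\<bar> > s")
      case True
      then show ?thesis using A by (auto simp: P_def)
    next
      case False
      then have "\<bar>\<Sum>i\<in>b A. sgn_of S i\<bar> > t" using A(3) link[OF A(2), of S] by linarith
      then show ?thesis using A b(1)[OF A(2)] by auto
    qed
  qed
  then have "card {S\<in>Pow I. \<exists>A\<in>N. \<bar>\<Sum>i\<in>A. sgn_of S i\<bar> > t + s} \<le> card (?E \<union> (\<Union>A\<in>N. P A))"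
    by (intro card_mono finite_UnI finite_UN_I N) (use I in \<open>auto simp: P_def\<close>)
  also have "\<dots> \<le> card ?E + (\<Sum>A\<in>N. card (P A))"
    using card_Un_le[of ?E "\<Union>A\<in>N. P A"] card_UN_le[OF N, of P] by linarith
  finally have "real (card {S\<in>Pow I. \<exists>A\<in>N. \<bar>\<Sum>i\<in>A. sgn_of S i\<bar> > t + s}) \<le> real (card ?E) + (\<Sum>A\<in>N. real (card (P A)))"
    by (simp flip: of_nat_sum of_nat_add)
  also have "(\<Sum>A\<in>N. real (card (P A))) \<le> (\<Sum>A\<in>N. 2 * (2 ^ card I * exp (- (s\<^sup>2 / (2 * V)))))"
    by (intro sum_mono P)
  finally show ?thesis by simp
qed

lemma ln_2_ln_4: "ln 2 \<le> (9 / 10 :: real)" "ln 4 = 2 * ln (2 :: real)"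
proof -
  show "ln 4 = 2 * ln (2 :: real)" using ln_realpow[of "2::real" 2] by simp
  have "(2::real) \<le> exp (9/10)"
    using exp_lower_Taylor_quadratic[of "9/10::real"] by (simp add: power2_eq_square)
  then show "ln 2 \<le> (9 / 10 :: real)" using ln_le_cancel_iff[of 2 "exp (9/10::real)"] by simp
qed

text \<open>The balance between entropy and variance. At scale \<open>4 ^ - j\<close> there are \<open>exp (O(D * (j + 1)))\<close> links
of variance \<open>4 * n / 4 ^ j\<close>. The threshold \<open>s\<close> gives the exponent \<open>9/2 * (j + 1)\<^sup>2 * (D + L)\<close>,
which beats the entropy and leaves \<open>exp (- L)\<close> times a summable factor.\<close>

lemma chaining_link_probability:
  fixes L n c :: real and D j :: nat
  assumes D: "D \<ge> 1" and L: "L \<ge> 0" and n: "n > 0" and c: "c \<le> 2 * (4 * 4 ^ j) ^ (2 * D)"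
  defines "s \<equiv> 6 * ((real j + 1) / 2 ^ j) * sqrt (n * (D + L))"
  shows "c * (2 * exp (- (s\<^sup>2 / (2 * (4 * n / 4 ^ j))))) \<le> 4 * (exp (- L) * (1 / 2 ^ Suc j))"
proof -
  have s2: "s\<^sup>2 / (2 * (4 * n / 4 ^ j)) = 36 / 8 * (real j + 1)\<^sup>2 * (D + L)"
  proof -
    have "((2::real) ^ j)\<^sup>2 = 4 ^ j" by (simp add: power2_eq_square flip: power_mult_distrib)
    moreover have "s\<^sup>2 = 36 * ((real j + 1)\<^sup>2 / (2 ^ j)\<^sup>2) * (n * (D + L))"
      using n D L unfolding s_def power_mult_distrib power_divide by simp
    ultimately have "s\<^sup>2 = 36 * ((real j + 1)\<^sup>2 / 4 ^ j) * (n * (D + L))" by simp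
    then show ?thesis using n by (simp add: field_simps)
  qed
  have e4: "(4::real) * 4 ^ j = exp ((real j + 1) * ln 4)"
    by (simp add: exp_of_nat_mult distrib_right exp_add)
  have "2 * (4 * 4 ^ j) ^ (2 * D) * (2 * exp (- (s\<^sup>2 / (2 * (4 * n / 4 ^ j)))))
      = 4 * exp (2 * D * ((real j + 1) * ln 4) - 36 / 8 * (real j + 1)\<^sup>2 * (D + L))"
    unfolding s2 e4 exp_diff exp_minus exp_of_nat_mult[symmetric] by (simp add: field_simps)
  also have "\<dots> \<le> 4 * exp (- L - (real j + 1) * ln 2)"
  proof -
    let ?x = "real j + 1"
    \<comment> \<open>The products are named to leave a linear inequality between them.\<close>
    define y z w v where "y = ?x * D" and "z = ?x * L" and "w = D * (?x * ln 2)" and "v = ?x * ln 2"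
    have x: "?x \<ge> 1" "?x\<^sup>2 \<ge> ?x" by (auto simp: power2_eq_square)
    have "?x * (D + L) \<le> ?x\<^sup>2 * (D + L)" using x D L by (intro mult_right_mono) auto
    then have 1: "y + z \<le> ?x\<^sup>2 * (D + L)" by (simp add: y_def z_def algebra_simps)
    have 2: "L \<le> z" using x L by (simp add: z_def mult_le_cancel_right1)
    have 3: "v \<le> ?x * (9/10)" unfolding v_def using ln_2_ln_4(1) x by (intro mult_left_mono) auto
    have "?x * 1 \<le> ?x * D" using D x by (intro mult_left_mono) auto
    then have 4: "?x \<le> y" by (simp add: y_def)
    have "D * (?x * ln 2) \<le> D * (?x * (9/10))" using ln_2_ln_4(1) x D by (intro mult_left_mono) auto
    then have 5: "w \<le> 9/10 * y" by (simp add: w_def y_def algebra_simps)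
    have 6: "2 * D * (?x * ln 4) = 4 * w" unfolding ln_2_ln_4(2) w_def by simp
    define q where "q = ?x\<^sup>2 * (D + L)"
    have 7: "36 / 8 * ?x\<^sup>2 * (D + L) = 9 / 2 * q" by (simp add: q_def)
    have 8: "v \<le> 9 / 10 * y" using 3 4 by argo
    have "2 * D * (?x * ln 4) - 36 / 8 * ?x\<^sup>2 * (D + L) \<le> - L - ?x * ln 2"
      unfolding 6 7 v_def[symmetric] using 1[folded q_def] 2 8 5 L by argo
    then show ?thesis by simp
  qed
  also have "exp (- L - (real j + 1) * ln 2) = exp (- L) * (1 / 2 ^ Suc j)"
    by (simp add: exp_diff exp_of_nat_mult distrib_right exp_add)
  finally have "2 * (4 * 4 ^ j) ^ (2 * D) * (2 * exp (- (s\<^sup>2 / (2 * (4 * n / 4 ^ j))))) \<le> 4 * (exp (- L) * (1 / 2 ^ Suc j))" .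
  moreover have "c * (2 * exp (- (s\<^sup>2 / (2 * (4 * n / 4 ^ j))))) \<le> 2 * (4 * 4 ^ j) ^ (2 * D) * (2 * exp (- (s\<^sup>2 / (2 * (4 * n / 4 ^ j)))))"
    by (intro mult_right_mono c) auto
  ultimately show ?thesis by linarith
qed

text \<open>A class of dimension \<open>D\<close> has Rademacher sums of order \<open>sqrt (n * D)\<close>. Since the links have
standard deviation of order \<open>sqrt n / 2 ^ j\<close> and entropy of order \<open>D * j\<close>, the thresholds are proportional to
\<open>(j + 1) / 2 ^ j\<close>, which is summable. This avoids the factor \<open>ln n\<close> of a single union bound over all traces.\<close>

theorem chaining:
  fixes L :: real and D :: nat
  assumes I: "finite I" "I \<noteq> {}" and T: "T \<subseteq> Pow I"
    and vc: "\<And>S. S \<subseteq> I \<Longrightarrow> shatters T S \<Longrightarrow> card S \<le> D" and D: "D \<ge> 1" and L: "L \<ge> 0"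
  shows "card {S\<in>Pow I. \<exists>A\<in>T. \<bar>\<Sum>i\<in>A. sgn_of S i\<bar> > 24 * sqrt (card I * (D + L))} \<le> 4 * (2 ^ card I * exp (- L))"
proof -
  define n where "n = card I"
  have n: "n > 0" using I by (simp add: n_def card_gt_0_iff)
  have finT: "finite T" using T I finite_subset by auto
  have "\<exists>N. \<forall>j. N j \<subseteq> T \<and> (\<forall>A\<in>N j. \<forall>B\<in>N j. A \<noteq> B \<longrightarrow> real (card (sym_diff A B)) > n / 4 ^ j) \<and>
      (\<forall>A\<in>T. \<exists>B\<in>N j. real (card (sym_diff A B)) \<le> n / 4 ^ j)"
    by (intro choice allI maximal_separated_subset finT) (auto simp: Un_commute)
  then obtain N where N0: "\<forall>j. N j \<subseteq> T \<and> (\<forall>A\<in>N j. \<forall>B\<in>N j. A \<noteq> B \<longrightarrow> real (card (sym_diff A B)) > n / 4 ^ j) \<and>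
      (\<forall>A\<in>T. \<exists>B\<in>N j. real (card (sym_diff A B)) \<le> n / 4 ^ j)" by (elim exE)
  have N1: "N j \<subseteq> T" for j by (rule N0[THEN spec, THEN conjunct1])
  have N2: "real (card (sym_diff A B)) > n / 4 ^ j" if "A \<in> N j" "B \<in> N j" "A \<noteq> B" for j A B
    by (rule N0[THEN spec, THEN conjunct2, THEN conjunct1, rule_format, OF that])
  have N3: "\<exists>B\<in>N j. real (card (sym_diff A B)) \<le> n / 4 ^ j" if "A \<in> T" for j A
    by (rule N0[THEN spec, THEN conjunct2, THEN conjunct2, rule_format, OF that])
  \<comment> \<open>The chain starts at the empty set, whose sum is zero; the index is shifted by one against \<open>N\<close>.\<close>
  define N' where "N' j = (case j of 0 \<Rightarrow> {{}} | Suc j \<Rightarrow> N j)" for j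
  \<comment> \<open>The thresholds sum up to at most \<open>24 * sqrt (n * (D + L))\<close>, since \<open>(j + 1) / 2 ^ j\<close> sums up to \<open>4\<close>.\<close>
  define s where "s j = 6 * ((real j + 1) / 2 ^ j) * sqrt (n * (D + L))" for j
  have cN: "real (card (N j)) \<le> 2 * (4 * 4 ^ j) ^ (2 * D)" for j
  proof -
    have "real (card (N j)) \<le> 2 * (4 / (1 / 4 ^ j)) ^ (2 * D)"
    proof (rule packing_bound[OF I(1)])
      show "card S \<le> D" if "S \<subseteq> I" "shatters (N j) S" for S
        by (rule vc[OF that(1) shatters_mono[OF that(2) N1]])
      show "1 / 4 ^ j * real (card I) \<le> real (card (sym_diff A B))" if "A \<in> N j" "B \<in> N j" "A \<noteq> B" for A B
        using N2[OF that] by (simp add: n_def)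
    qed (use order.trans[OF N1[of j] T] in simp_all)
    then show ?thesis by simp
  qed
  have N'T: "N' j \<subseteq> Pow I" for j using N1 T by (cases j) (auto simp: N'_def)
  have step: "real (card {S\<in>Pow I. \<exists>A\<in>N' j. \<bar>\<Sum>i\<in>A. sgn_of S i\<bar> > (\<Sum>i<j. s i)})
      \<le> 4 * 2 ^ n * exp (- L) * (\<Sum>i<j. 1 / 2 ^ Suc i)" for j
  proof (induction j)
    case 0
    show ?case by (simp add: N'_def)
  next
    case (Suc j)
    have "real (card {S\<in>Pow I. \<exists>A\<in>N' (Suc j). \<bar>\<Sum>i\<in>A. sgn_of S i\<bar> > (\<Sum>i<j. s i) + s j})
      \<le> card {S\<in>Pow I. \<exists>B\<in>N' j. \<bar>\<Sum>i\<in>B. sgn_of S i\<bar> > (\<Sum>i<j. s i)}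
         + card (N' (Suc j)) * (2 * (2 ^ card I * exp (- ((s j)\<^sup>2 / (2 * (4 * real n / 4 ^ j))))))"
    proof (rule chaining_level[OF I(1)])
      show "finite (N' (Suc j))" using finite_subset[OF N1[of j] finT] by (simp add: N'_def)
      show "s j \<ge> 0" using D L by (simp add: s_def)
      show "4 * real n / 4 ^ j > 0" using n by simp
      fix A assume A: "A \<in> N' (Suc j)"
      then have AT: "A \<in> T" using N1[of j] by (auto simp: N'_def)
      then have AI: "A \<subseteq> I" using T by auto
      have "\<exists>B\<in>N' j. real (card (sym_diff A B)) \<le> 4 * real n / 4 ^ j"
      proof (cases j)
        case 0
        have "card A \<le> n" unfolding n_def by (rule card_mono[OF I(1) AI])
        then show ?thesis using 0 by (simp add: N'_def)
      next
        case (Suc j')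
        then show ?thesis using N3[OF AT, of j'] by (simp add: N'_def)
      qed
      then show "A \<subseteq> I \<and> (\<exists>B\<in>N' j. B \<subseteq> I \<and> real (card (sym_diff A B)) \<le> 4 * real n / 4 ^ j)"
        using AI N'T[of j] by blast
    qed
    also have "card (N' (Suc j)) * (2 * (2 ^ card I * exp (- ((s j)\<^sup>2 / (2 * (4 * real n / 4 ^ j))))))
        = 2 ^ n * (card (N j) * (2 * exp (- ((s j)\<^sup>2 / (2 * (4 * real n / 4 ^ j))))))"
      by (simp add: N'_def n_def)
    also have "\<dots> \<le> 2 ^ n * (4 * (exp (- L) * (1 / 2 ^ Suc j)))"
      unfolding s_def using n by (intro mult_left_mono chaining_link_probability[OF D L _ cN]) auto
    finally have "real (card {S\<in>Pow I. \<exists>A\<in>N' (Suc j). \<bar>\<Sum>i\<in>A. sgn_of S i\<bar> > (\<Sum>i<j. s i) + s j})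
      \<le> 4 * 2 ^ n * exp (- L) * (\<Sum>i<j. 1 / 2 ^ Suc i) + 2 ^ n * (4 * (exp (- L) * (1 / 2 ^ Suc j)))"
      using Suc.IH by linarith
    also have "\<dots> = 4 * 2 ^ n * exp (- L) * (\<Sum>i<Suc j. 1 / 2 ^ Suc i)"
      unfolding sum.lessThan_Suc distrib_left by (simp only: mult_ac)
    finally show ?case unfolding sum.lessThan_Suc .
  qed
  \<comment> \<open>At a scale below one point the net is the whole class.\<close>
  obtain J :: nat where J: "n / 4 ^ J < (1::real)"
  proof -
    obtain J :: nat where "real n < 4 ^ J" using real_arch_pow[of 4 "real n"] by auto
    then show ?thesis by (intro that[of J]) (simp add: field_simps)
  qed
  have TN: "T \<subseteq> N' (Suc J)"
  proof
    fix A assume A: "A \<in> T"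
    then obtain B where B: "B \<in> N J" "real (card (sym_diff A B)) \<le> n / 4 ^ J" using N3 by blast
    then have "card (sym_diff A B) = 0" using J by linarith
    moreover have "finite A" "finite B" using A B(1) N1[of J] T I(1) finite_subset by blast+
    ultimately have "sym_diff A B = {}" by simp
    then have "A = B" by blast
    then show "A \<in> N' (Suc J)" using B by (simp add: N'_def)
  qed
  have ss: "(\<Sum>i<Suc J. s i) \<le> 24 * sqrt (n * (D + L))"
  proof -
    have "(\<Sum>i<Suc J. s i) = 6 * (\<Sum>i<Suc J. (real i + 1) / 2 ^ i) * sqrt (n * (D + L))"
      unfolding s_def sum_distrib_left sum_distrib_right ..
    also have "\<dots> \<le> 6 * 4 * sqrt (n * (D + L))"
      using sum_Suc_div_power2[of "Suc J"] D L by (intro mult_right_mono mult_left_mono) auto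
    finally show ?thesis by simp
  qed
  have "card {S\<in>Pow I. \<exists>A\<in>T. \<bar>\<Sum>i\<in>A. sgn_of S i\<bar> > 24 * sqrt (card I * (D + L))}
      \<le> card {S\<in>Pow I. \<exists>A\<in>N' (Suc J). \<bar>\<Sum>i\<in>A. sgn_of S i\<bar> > (\<Sum>i<Suc J. s i)}"
  proof (intro card_mono)
    show "finite {S\<in>Pow I. \<exists>A\<in>N' (Suc J). \<bar>\<Sum>i\<in>A. sgn_of S i\<bar> > (\<Sum>i<Suc J. s i)}" using I by simp
    show "{S\<in>Pow I. \<exists>A\<in>T. \<bar>\<Sum>i\<in>A. sgn_of S i\<bar> > 24 * sqrt (card I * (D + L))}
      \<subseteq> {S\<in>Pow I. \<exists>A\<in>N' (Suc J). \<bar>\<Sum>i\<in>A. sgn_of S i\<bar> > (\<Sum>i<Suc J. s i)}"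
    proof
      fix S assume "S \<in> {S\<in>Pow I. \<exists>A\<in>T. \<bar>\<Sum>i\<in>A. sgn_of S i\<bar> > 24 * sqrt (card I * (D + L))}"
      then obtain A where A: "S \<in> Pow I" "A \<in> T" "\<bar>\<Sum>i\<in>A. sgn_of S i\<bar> > 24 * sqrt (card I * (D + L))"
        by blast
      have "\<bar>\<Sum>i\<in>A. sgn_of S i\<bar> > (\<Sum>i<Suc J. s i)" using A(3) ss unfolding n_def by linarith
      then show "S \<in> {S\<in>Pow I. \<exists>A\<in>N' (Suc J). \<bar>\<Sum>i\<in>A. sgn_of S i\<bar> > (\<Sum>i<Suc J. s i)}"
        using A(1,2) TN by blast
    qed
  qed
  also have "real (card {S\<in>Pow I. \<exists>A\<in>N' (Suc J). \<bar>\<Sum>i\<in>A. sgn_of S i\<bar> > (\<Sum>i<Suc J. s i)})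
      \<le> 4 * 2 ^ n * exp (- L) * (\<Sum>i<Suc J. 1 / 2 ^ Suc i)" by (rule step)
  also have "\<dots> \<le> 4 * 2 ^ n * exp (- L) * 1"
    by (intro mult_left_mono sum_half_power) auto
  finally show ?thesis by (simp add: n_def)
qed

section \<open>Uniform deviations by symmetrization\<close>

text \<open>Passing from sets in the sample space to their traces on the indices of a sample does not
increase the dimension: an index set can be shattered only if its points are distinct.\<close>

lemma shatters_preimage:
  assumes sh: "shatters ((\<lambda>h. {i\<in>I. X i \<in> h}) ` H) S" and S: "S \<subseteq> I"
  shows "inj_on X S" "shatters H (X ` S)"
proof -
  have tr: "\<exists>h\<in>H. \<forall>i\<in>S. X i \<in> h \<longleftrightarrow> i \<in> T" if T: "T \<subseteq> S" for T
  proof -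
    from sh[unfolded shatters_def, rule_format, OF T]
    obtain h where h: "h \<in> H" "{i\<in>I. X i \<in> h} \<inter> S = T" by (elim bexE imageE) simp
    have "X i \<in> h \<longleftrightarrow> i \<in> T" if "i \<in> S" for i
      using h(2) that S by (auto dest: equalityD1 equalityD2)
    then show ?thesis using h(1) by (intro bexI[of _ h] ballI)
  qed
  show "inj_on X S"
  proof (rule inj_onI, rule ccontr)
    fix i j assume ij: "i \<in> S" "j \<in> S" "X i = X j" "i \<noteq> j"
    then obtain h where h: "\<forall>l\<in>S. X l \<in> h \<longleftrightarrow> l \<in> {i}" using tr[of "{i}"] by auto
    from h[rule_format, OF ij(1)] h[rule_format, OF ij(2)] ij(3,4) show False by simp
  qed
  show "shatters H (X ` S)"
    unfolding shatters_def
  proof (intro allI impI)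
    fix T assume T: "T \<subseteq> X ` S"
    obtain h where h: "h \<in> H" "\<forall>i\<in>S. X i \<in> h \<longleftrightarrow> i \<in> {i\<in>S. X i \<in> T}"
      using tr[of "{i\<in>S. X i \<in> T}"] by (metis (no_types, lifting) mem_Collect_eq subsetI)
    have "h \<inter> X ` S = T"
    proof (rule set_eqI, rule iffI)
      fix x assume "x \<in> h \<inter> X ` S"
      then obtain i where "i \<in> S" "x = X i" "x \<in> h" by blast
      then show "x \<in> T" using h(2)[rule_format, of i] by simp
    next
      fix x assume "x \<in> T"
      then obtain i where "i \<in> S" "x = X i" using T by blast
      then show "x \<in> h \<inter> X ` S" using h(2)[rule_format, of i] \<open>x \<in> T\<close> by simp
    qed
    then show "\<exists>A\<in>H. A \<inter> X ` S = T" using h(1) by (intro bexI[of _ h])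
  qed
qed

text \<open>The differences split into one sum over the first sample and one over the second, so two
applications of chaining double the constant \<open>24\<close>.\<close>

lemma card_sign_deviation_le:
  fixes X Y :: "nat \<Rightarrow> 'a" and L :: real and n :: nat
  assumes n: "n > 0" and vc: "\<And>S. finite S \<Longrightarrow> shatters H S \<Longrightarrow> card S \<le> D" and D: "D \<ge> 1" and L: "L \<ge> 0"
  shows "card {S\<in>Pow {1..n}. \<exists>h\<in>H. \<bar>\<Sum>i=1..n. sgn_of S i * (indicat_real h (X i) - indicat_real h (Y i))\<bar>
      > 48 * sqrt (n * (D + L))} \<le> 8 * (2 ^ n * exp (- L))"
proof -
  let ?I = "{1..n}" and ?t = "24 * sqrt (n * (D + L))"
  define T where "T Z = (\<lambda>h. {i\<in>?I. Z i \<in> h}) ` H" for Z :: "nat \<Rightarrow> 'a"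
  define E where "E Z = {S\<in>Pow ?I. \<exists>A\<in>T Z. \<bar>\<Sum>i\<in>A. sgn_of S i\<bar> > ?t}" for Z
  have E: "real (card (E Z)) \<le> 4 * (2 ^ n * exp (- L))" for Z
  proof -
    have "card {S\<in>Pow ?I. \<exists>A\<in>T Z. \<bar>\<Sum>i\<in>A. sgn_of S i\<bar> > 24 * sqrt (card ?I * (D + L))} \<le> 4 * (2 ^ card ?I * exp (- L))"
    proof (rule chaining[OF _ _ _ _ D L])
      fix S assume S: "S \<subseteq> ?I" "shatters (T Z) S"
      from shatters_preimage[OF S(2)[unfolded T_def] S(1)] vc[of "Z ` S"] S(1)
      show "card S \<le> D" by (simp add: card_image finite_subset)
    qed (use n in \<open>auto simp: T_def\<close>)
    then show ?thesis by (simp add: E_def)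
  qed
  have "{S\<in>Pow ?I. \<exists>h\<in>H. \<bar>\<Sum>i=1..n. sgn_of S i * (indicat_real h (X i) - indicat_real h (Y i))\<bar>
      > 48 * sqrt (n * (D + L))} \<subseteq> E X \<union> E Y"
  proof
    fix S assume "S \<in> {S\<in>Pow ?I. \<exists>h\<in>H. \<bar>\<Sum>i=1..n. sgn_of S i * (indicat_real h (X i) - indicat_real h (Y i))\<bar>
      > 48 * sqrt (n * (D + L))}"
    then obtain h where h: "S \<subseteq> ?I" "h \<in> H"
      "\<bar>\<Sum>i=1..n. sgn_of S i * (indicat_real h (X i) - indicat_real h (Y i))\<bar> > 48 * sqrt (n * (D + L))" by auto
    have s: "(\<Sum>i=1..n. sgn_of S i * indicat_real h (Z i)) = (\<Sum>i\<in>{i\<in>?I. Z i \<in> h}. sgn_of S i)" for Z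
    proof -
      have "(\<Sum>i\<in>{i\<in>?I. Z i \<in> h}. sgn_of S i) = (\<Sum>i=1..n. if Z i \<in> h then sgn_of S i else 0)"
        by (rule sum.inter_filter) simp
      also have "\<dots> = (\<Sum>i=1..n. sgn_of S i * indicat_real h (Z i))"
        by (rule sum.cong) (auto simp: indicator_def)
      finally show ?thesis ..
    qed
    have "\<bar>\<Sum>i\<in>{i\<in>?I. X i \<in> h}. sgn_of S i\<bar> > ?t \<or> \<bar>\<Sum>i\<in>{i\<in>?I. Y i \<in> h}. sgn_of S i\<bar> > ?t"
      using h(3) unfolding right_diff_distrib sum_subtractf s by linarith
    then show "S \<in> E X \<union> E Y" using h(1,2) by (auto simp: E_def T_def)
  qed
  then have "card {S\<in>Pow ?I. \<exists>h\<in>H. \<bar>\<Sum>i=1..n. sgn_of S i * (indicat_real h (X i) - indicat_real h (Y i))\<bar>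
      > 48 * sqrt (n * (D + L))} \<le> card (E X \<union> E Y)" by (intro card_mono) (auto simp: E_def)
  also have "\<dots> \<le> card (E X) + card (E Y)" by (rule card_Un_le)
  finally show ?thesis using E[of X] E[of Y] by simp
qed

lemma PiM_same_permute:
  assumes M: "prob_space M" and f: "inj_on f K" "f ` K \<subseteq> K" and A: "A \<in> sets (PiM K (\<lambda>_. M))"
  shows "emeasure (PiM K (\<lambda>_. M)) {z\<in>space (PiM K (\<lambda>_. M)). (\<lambda>k\<in>K. z (f k)) \<in> A} = emeasure (PiM K (\<lambda>_. M)) A"
proof -
  have d: "distr (PiM K (\<lambda>_. M)) (PiM K (\<lambda>_. M)) (\<lambda>z. \<lambda>k\<in>K. z (f k)) = PiM K (\<lambda>_. M)"
    using distr_PiM_reindex[of K "\<lambda>_. M" f K] M f by auto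
  have m: "(\<lambda>z. \<lambda>k\<in>K. z (f k)) \<in> PiM K (\<lambda>_. M) \<rightarrow>\<^sub>M PiM K (\<lambda>_. M)"
    using f(2) by (intro measurable_restrict measurable_component_singleton) auto
  have "emeasure (PiM K (\<lambda>_. M)) A = emeasure (distr (PiM K (\<lambda>_. M)) (PiM K (\<lambda>_. M)) (\<lambda>z. \<lambda>k\<in>K. z (f k))) A"
    by (simp only: d)
  also have "\<dots> = emeasure (PiM K (\<lambda>_. M)) ((\<lambda>z. \<lambda>k\<in>K. z (f k)) -` A \<inter> space (PiM K (\<lambda>_. M)))"
    by (rule emeasure_distr[OF m A])
  also have "(\<lambda>z. \<lambda>k\<in>K. z (f k)) -` A \<inter> space (PiM K (\<lambda>_. M)) = {z\<in>space (PiM K (\<lambda>_. M)). (\<lambda>k\<in>K. z (f k)) \<in> A}"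
    by auto
  finally show ?thesis by simp
qed

text \<open>Exchanging the paired coordinates \<open>i\<close> and \<open>i + n\<close> for all \<open>i \<in> S\<close> preserves the product measure.
Averaging over all \<open>S\<close> therefore bounds the probability of the deviation by the largest proportion
of sign vectors that produce it for a fixed double sample.\<close>

lemma symmetrized_deviation:
  fixes L :: real and n :: nat
  assumes M: "prob_space M" and n: "n > 0" and H: "finite H" "H \<subseteq> sets M"
    and vc: "\<And>S. finite S \<Longrightarrow> shatters H S \<Longrightarrow> card S \<le> D" and D: "D \<ge> 1" and L: "L \<ge> 0"
  defines "K \<equiv> {1..n} \<union> {n+1..2*n}"
  defines "B \<equiv> {z\<in>space (PiM K (\<lambda>_. M)). \<exists>h\<in>H. \<bar>\<Sum>i=1..n. indicat_real h (z i) - indicat_real h (z (i + n))\<bar>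
      > 48 * sqrt (n * (D + L))}"
  shows "emeasure (PiM K (\<lambda>_. M)) B \<le> ennreal (8 * exp (- L))" "B \<in> sets (PiM K (\<lambda>_. M))"
proof -
  let ?P = "PiM K (\<lambda>_. M)"
  interpret P: prob_space ?P by (intro prob_space_PiM M)
  have [measurable]: "(\<lambda>z. indicat_real h (z i)) \<in> borel_measurable ?P" if "h \<in> H" "i \<in> K" for h i
  proof -
    have "h \<in> sets M" using that H by auto
    then show ?thesis using that by measurable
  qed
  have iK: "i \<in> K" "i + n \<in> K" if "i \<in> {1..n}" for i using that by (auto simp: K_def)
  show B[measurable]: "B \<in> sets ?P"
  proof -
    have m: "(\<lambda>z. \<Sum>i=1..n. indicat_real h (z i) - indicat_real h (z (i + n))) \<in> borel_measurable ?P" if "h \<in> H" for h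
      using that iK by (intro borel_measurable_sum borel_measurable_diff) auto
    have "B = (\<Union>h\<in>H. {z\<in>space ?P. \<bar>\<Sum>i=1..n. indicat_real h (z i) - indicat_real h (z (i + n))\<bar> > 48 * sqrt (n * (D + L))})"
      by (auto simp: B_def)
    also have "\<dots> \<in> sets ?P"
      by (intro sets.finite_UN H) (use m in measurable)
    finally show ?thesis .
  qed
  \<comment> \<open>The involution that swaps \<open>i\<close> and \<open>i + n\<close> for \<open>i \<in> S\<close>.\<close>
  define f where "f S i = (if i \<in> S then i + n else if i - n \<in> S \<and> i > n then i - n else i)" for S and i :: nat
  define B' where "B' S = {z\<in>space ?P. (\<lambda>k\<in>K. z (f S k)) \<in> B}" for S
  have fK: "f S ` K \<subseteq> K" and finj: "inj_on (f S) K" if "S \<subseteq> {1..n}" for S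
  proof -
    have S: "i \<le> n \<and> 1 \<le> i" if "i \<in> S" for i using \<open>S \<subseteq> {1..n}\<close> that by auto
    show "f S ` K \<subseteq> K" using S by (fastforce simp: f_def K_def)
    have inv: "f S (f S i) = i" if "i \<in> K" for i
      using S[of i] S[of "i - n"] S[of "i + n"] that by (auto simp: f_def K_def)
    show "inj_on (f S) K" by (rule inj_on_inverseI[of _ "f S"]) (rule inv)
  qed
  have B'm: "B' S \<in> sets ?P" if "S \<subseteq> {1..n}" for S
  proof -
    have "(\<lambda>z. \<lambda>k\<in>K. z (f S k)) \<in> ?P \<rightarrow>\<^sub>M ?P"
      using fK[OF that] by (intro measurable_restrict measurable_component_singleton) auto
    from measurable_sets[OF this B] show ?thesis by (simp add: B'_def vimage_def Int_def conj_commute)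
  qed
  have B'P: "emeasure ?P (B' S) = emeasure ?P B" if "S \<subseteq> {1..n}" for S
    unfolding B'_def by (rule PiM_same_permute[OF M finj[OF that] fK[OF that] B])
  have count: "(\<Sum>S\<in>Pow {1..n}. indicator (B' S) z) \<le> ennreal (8 * (2 ^ n * exp (- L)))" if z: "z \<in> space ?P" for z
  proof -
    have mem: "z \<in> B' S \<longleftrightarrow> S \<in> {S\<in>Pow {1..n}. \<exists>h\<in>H. \<bar>\<Sum>i=1..n. sgn_of S i * (indicat_real h (z i) - indicat_real h (z (i + n)))\<bar>
      > 48 * sqrt (n * (D + L))}" if S: "S \<subseteq> {1..n}" for S
    proof -
      have sw: "\<bar>\<Sum>i=1..n. indicat_real h ((\<lambda>k\<in>K. z (f S k)) i) - indicat_real h ((\<lambda>k\<in>K. z (f S k)) (i + n))\<bar>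
        = \<bar>\<Sum>i=1..n. sgn_of S i * (indicat_real h (z i) - indicat_real h (z (i + n)))\<bar>" for h
      proof -
        have "(\<Sum>i=1..n. indicat_real h ((\<lambda>k\<in>K. z (f S k)) i) - indicat_real h ((\<lambda>k\<in>K. z (f S k)) (i + n)))
          = (\<Sum>i=1..n. - (sgn_of S i * (indicat_real h (z i) - indicat_real h (z (i + n)))))"
        proof (rule sum.cong[OF refl])
          fix i assume i: "i \<in> {1..n}"
          have "i + n \<notin> S" using S i by auto
          then have "f S i = (if i \<in> S then i + n else i)" "f S (i + n) = (if i \<in> S then i else i + n)"
            using i by (auto simp: f_def)
          then show "indicat_real h ((\<lambda>k\<in>K. z (f S k)) i) - indicat_real h ((\<lambda>k\<in>K. z (f S k)) (i + n))
             = - (sgn_of S i * (indicat_real h (z i) - indicat_real h (z (i + n))))"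
            using iK[OF i] by (simp add: sgn_of_def)
        qed
        then show ?thesis by (simp add: sum_negf)
      qed
      have w: "(\<lambda>k\<in>K. z (f S k)) \<in> space ?P"
        using z fK[OF S] by (auto simp: space_PiM PiE_def Pi_def)
      show ?thesis by (simp only: B'_def B_def mem_Collect_eq sw Pow_iff S z w simp_thms)
    qed
    have "(\<Sum>S\<in>Pow {1..n}. indicator (B' S) z :: ennreal) = (\<Sum>S\<in>Pow {1..n}. if z \<in> B' S then 1 else 0)"
      by (rule sum.cong) (auto simp: indicator_def)
    also have "\<dots> = (\<Sum>S\<in>{S\<in>Pow {1..n}. z \<in> B' S}. 1)" by (rule sum.inter_filter[symmetric]) simp
    also have "\<dots> = of_nat (card {S\<in>Pow {1..n}. z \<in> B' S})" by simp
    also have eq: "{S\<in>Pow {1..n}. z \<in> B' S} = {S\<in>Pow {1..n}. \<exists>h\<in>H. \<bar>\<Sum>i=1..n. sgn_of S i * (indicat_real h (z i) - indicat_real h (z (i + n)))\<bar>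
      > 48 * sqrt (n * (D + L))}" 
    proof (rule set_eqI, goal_cases)
      case (1 S)
      show ?case using mem[of S] by (cases "S \<subseteq> {1..n}") simp_all
    qed
    also have "of_nat (card \<dots>) \<le> ennreal (8 * (2 ^ n * exp (- L)))"
      using card_sign_deviation_le[OF n vc D L, of H z "\<lambda>i. z (i + n)"]
      by (simp add: ennreal_of_nat_eq_real_of_nat ennreal_leI)
    finally show ?thesis .
  qed
  have "ennreal (2 ^ n) * emeasure ?P B = (\<Sum>S\<in>Pow {1..n}. emeasure ?P B)"
    by (simp add: card_Pow ennreal_of_nat_eq_real_of_nat)
  also have "\<dots> = (\<Sum>S\<in>Pow {1..n}. emeasure ?P (B' S))"
    by (rule sum.cong) (simp_all add: B'P)
  also have "\<dots> = (\<Sum>S\<in>Pow {1..n}. \<integral>\<^sup>+z. indicator (B' S) z \<partial>?P)"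
    by (rule sum.cong) (use B'm in simp_all)
  also have "\<dots> = (\<integral>\<^sup>+z. (\<Sum>S\<in>Pow {1..n}. indicator (B' S) z) \<partial>?P)"
    by (rule nn_integral_sum[symmetric]) (use B'm in simp)
  also have "\<dots> \<le> (\<integral>\<^sup>+z. ennreal (8 * (2 ^ n * exp (- L))) \<partial>?P)"
    by (intro nn_integral_mono count)
  also have "\<dots> = ennreal (8 * (2 ^ n * exp (- L)))"
    using P.emeasure_space_1 by simp
  finally have *: "ennreal (2 ^ n) * emeasure ?P B \<le> ennreal (8 * (2 ^ n * exp (- L)))" .
  have "ennreal (2 ^ n * measure ?P B) \<le> ennreal (8 * (2 ^ n * exp (- L)))"
    using * by (simp only: P.emeasure_eq_measure ennreal_mult'[symmetric] zero_le_power zero_le_numeral)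
  then have "2 ^ n * measure ?P B \<le> 2 ^ n * (8 * exp (- L))"
    by (subst (asm) ennreal_le_iff) (simp_all add: mult_ac)
  then have "measure ?P B \<le> 8 * exp (- L)" by simp
  then show "emeasure ?P B \<le> ennreal (8 * exp (- L))"
    unfolding P.emeasure_eq_measure by (rule ennreal_leI)
qed

text \<open>Hoeffding's inequality for the frequency of one event among the coordinates of a product measure.\<close>

lemma hoeffding_indicator_PiM:
  assumes M: "prob_space M" and J: "finite J" "J \<noteq> {}" and h: "h \<in> sets M" and e: "e \<ge> 0"
  shows "measure (PiM J (\<lambda>_. M)) {Y\<in>space (PiM J (\<lambda>_. M)). \<bar>(\<Sum>j\<in>J. indicat_real h (Y j)) - card J * measure M h\<bar> \<ge> e}
     \<le> 2 * exp (- 2 * e\<^sup>2 / card J)"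
proof -
  let ?P = "PiM J (\<lambda>_. M)"
  interpret M: prob_space M by fact
  interpret P: prob_space ?P by (intro prob_space_PiM M)
  have d: "distr ?P M (\<lambda>Y. Y j) = M" if "j \<in> J" for j
    by (rule distr_PiM_component[OF M that])
  have "P.indep_vars (\<lambda>_. M) (\<lambda>j Y. Y j) J"
  proof (subst P.indep_vars_iff_distr_eq_PiM')
    show "distr ?P ?P (\<lambda>x. \<lambda>i\<in>J. x i) = PiM J (\<lambda>i. distr ?P M (\<lambda>Y. Y i))"
    proof -
      have "distr ?P ?P (\<lambda>x. \<lambda>i\<in>J. x i) = distr ?P ?P (\<lambda>x. x)"
        by (rule distr_cong) (auto simp: space_PiM PiE_def extensional_restrict)
      also have "\<dots> = ?P" by simp
      also have "\<dots> = PiM J (\<lambda>i. distr ?P M (\<lambda>Y. Y i))"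
        by (rule PiM_cong[OF refl]) (simp add: d)
      finally show ?thesis .
    qed
  qed (use J in auto)
  then have ind: "P.indep_vars (\<lambda>_. borel) (\<lambda>j Y. indicat_real h (Y j)) J"
    by (rule P.indep_vars_compose2) (use h in simp)
  have ex: "P.expectation (\<lambda>Y. indicat_real h (Y j)) = measure M h" if j: "j \<in> J" for j
  proof -
    have "measure M h = measure (distr ?P M (\<lambda>Y. Y j)) h" by (simp add: d[OF j])
    also have "\<dots> = integral\<^sup>L (distr ?P M (\<lambda>Y. Y j)) (indicat_real h)" using h by simp
    also have "\<dots> = P.expectation (\<lambda>Y. indicat_real h (Y j))"
      by (rule integral_distr) (use j h in auto)
    finally show ?thesis by simp
  qed
  interpret Hoeffding_ineq ?P J "\<lambda>j Y. indicat_real h (Y j)" "\<lambda>_. 0" "\<lambda>_. 1" "\<Sum>j\<in>J. P.expectation (\<lambda>Y. indicat_real h (Y j))"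
    by unfold_locales (use J ind in \<open>auto simp: indicator_def\<close>)
  have "(\<Sum>j\<in>J. P.expectation (\<lambda>Y. indicat_real h (Y j))) = card J * measure M h" by (simp add: ex)
  then show ?thesis
    using Hoeffding_ineq_abs_ge[OF e] J by (simp add: card_gt_0_iff)
qed

text \<open>The ghost sample, with \<open>r = sqrt (n * (D + L))\<close>: if \<open>h\<close> deviates by more than \<open>96 * r\<close> on the sample \<open>X\<close>, an independent second
sample deviates from the mean by less than \<open>48 * r\<close> with probability at least \<open>1/2\<close>, and then
the two samples differ by more than \<open>48 * r\<close>. A finite class makes the event measurable.\<close>

lemma vc_deviation_finite:
  fixes L :: real and n :: nat
  assumes M: "prob_space M" and n: "n > 0" and H: "finite H" "H \<subseteq> sets M"
    and vc: "\<And>S. finite S \<Longrightarrow> shatters H S \<Longrightarrow> card S \<le> D" and D: "D \<ge> 1" and L: "L \<ge> 0"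
  shows "measure (PiM {1..n} (\<lambda>_. M)) {X\<in>space (PiM {1..n} (\<lambda>_. M)).
      \<exists>h\<in>H. \<bar>(\<Sum>i=1..n. indicat_real h (X i)) - n * measure M h\<bar> > 96 * sqrt (n * (D + L))} \<le> 16 * exp (- L)"
proof -
  define I J where "I = {1..n}" and "J = {n+1..2*n}"
  let ?P = "PiM I (\<lambda>_. M)" and ?Q = "PiM J (\<lambda>_. M)" and ?t = "48 * sqrt (n * (D + L))"
  define A where "A = {X\<in>space ?P. \<exists>h\<in>H. \<bar>(\<Sum>i=1..n. indicat_real h (X i)) - n * measure M h\<bar> > 96 * sqrt (n * (D + L))}"
  define B where "B = {z\<in>space (PiM (I \<union> J) (\<lambda>_. M)). \<exists>h\<in>H. \<bar>\<Sum>i=1..n. indicat_real h (z i) - indicat_real h (z (i + n))\<bar> > ?t}"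
  interpret P: prob_space ?P by (intro prob_space_PiM M)
  interpret Q: prob_space ?Q by (intro prob_space_PiM M)
  interpret M: prob_space M by fact
  interpret S: product_sigma_finite "\<lambda>_. M" by unfold_locales
  have B: "emeasure (PiM (I \<union> J) (\<lambda>_. M)) B \<le> ennreal (8 * exp (- L))" "B \<in> sets (PiM (I \<union> J) (\<lambda>_. M))"
    using symmetrized_deviation[OF M n H vc D L] by (simp_all add: B_def I_def J_def)
  have Am: "A \<in> sets ?P"
  proof -
    have m: "(\<lambda>X. (\<Sum>i=1..n. indicat_real h (X i)) - n * measure M h) \<in> borel_measurable ?P" if "h \<in> H" for h
    proof -
      have "h \<in> sets M" using that H by auto
      then show ?thesis unfolding I_def by measurable
    qed
    have "A = (\<Union>h\<in>H. {X\<in>space ?P. \<bar>(\<Sum>i=1..n. indicat_real h (X i)) - n * measure M h\<bar> > 96 * sqrt (n * (D + L))})"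
      by (auto simp: A_def)
    also have "\<dots> \<in> sets ?P"
      by (intro sets.finite_UN H) (use m in measurable)
    finally show ?thesis .
  qed
  have slice: "ennreal (1 / 2) * indicator A X \<le> emeasure ?Q ((\<lambda>Y. merge I J (X, Y)) -` B \<inter> space ?Q)"
    if X: "X \<in> space ?P" for X
  proof (cases "X \<in> A")
    case True
    then obtain h where h: "h \<in> H" "\<bar>(\<Sum>i=1..n. indicat_real h (X i)) - n * measure M h\<bar> > 96 * sqrt (n * (D + L))"
      by (auto simp: A_def)
    have hM: "h \<in> sets M" using h H by auto
    define F where "F = {Y\<in>space ?Q. \<bar>(\<Sum>j\<in>J. indicat_real h (Y j)) - card J * measure M h\<bar> \<ge> ?t}"
    have cJ: "card J = n" by (simp add: J_def)
    have Fm: "F \<in> sets ?Q" unfolding F_def using hM by measurable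
    have "measure ?Q F \<le> 2 * exp (- 2 * ?t\<^sup>2 / card J)"
      unfolding F_def by (rule hoeffding_indicator_PiM[OF M _ _ hM]) (use n L in \<open>auto simp: J_def\<close>)
    also have "- 2 * ?t\<^sup>2 / card J = - (4608 * (D + L))"
      using n L by (simp add: cJ power_mult_distrib)
    also have "2 * exp (- (4608 * (D + L))) \<le> 1 / 2"
    proof -
      define y where "y = 4608 * (D + L)"
      have "4 \<le> 1 + y" unfolding y_def using D L by simp
      also have "\<dots> \<le> exp y" by (rule exp_ge_add_one_self)
      finally show ?thesis unfolding y_def[symmetric] exp_minus by (simp add: divide_simps)
    qed
    finally have F: "measure ?Q F \<le> 1 / 2" .
    have "space ?Q - F \<subseteq> (\<lambda>Y. merge I J (X, Y)) -` B \<inter> space ?Q"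
    proof
      fix Y assume Y: "Y \<in> space ?Q - F"
      then have Y1: "\<bar>(\<Sum>j\<in>J. indicat_real h (Y j)) - n * measure M h\<bar> < ?t" by (auto simp: F_def cJ)
      have sh: "(\<Sum>j\<in>J. indicat_real h (Y j)) = (\<Sum>i=1..n. indicat_real h (Y (i + n)))"
        using sum.shift_bounds_cl_nat_ivl[of "\<lambda>j. indicat_real h (Y j)" 1 n n] by (simp add: J_def add.commute mult_2)
      have mg: "(\<Sum>i=1..n. indicat_real h (merge I J (X, Y) i) - indicat_real h (merge I J (X, Y) (i + n)))
         = (\<Sum>i=1..n. indicat_real h (X i)) - (\<Sum>i=1..n. indicat_real h (Y (i + n)))"
        unfolding sum_subtractf[symmetric] by (rule sum.cong) (auto simp: merge_def I_def J_def)
      have "\<bar>\<Sum>i=1..n. indicat_real h (merge I J (X, Y) i) - indicat_real h (merge I J (X, Y) (i + n))\<bar> > ?t"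
        using h(2) Y1 unfolding mg sh by linarith
      moreover have "merge I J (X, Y) \<in> space (PiM (I \<union> J) (\<lambda>_. M))"
        using X Y by (auto simp: space_PiM PiE_def merge_def extensional_def)
      ultimately show "Y \<in> (\<lambda>Y. merge I J (X, Y)) -` B \<inter> space ?Q" using h(1) Y by (auto simp: B_def)
    qed
    moreover have "(\<lambda>Y. merge I J (X, Y)) -` B \<inter> space ?Q \<in> sets ?Q"
    proof -
      have "(\<lambda>Y. merge I J (X, Y)) \<in> ?Q \<rightarrow>\<^sub>M PiM (I \<union> J) (\<lambda>_. M)"
        using X by (intro measurable_compose[OF _ measurable_merge]) simp
      then show ?thesis using B(2) by (rule measurable_sets)
    qed
    ultimately have "emeasure ?Q (space ?Q - F) \<le> emeasure ?Q ((\<lambda>Y. merge I J (X, Y)) -` B \<inter> space ?Q)"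
      by (rule emeasure_mono)
    moreover have "ennreal (1 / 2) \<le> emeasure ?Q (space ?Q - F)"
      unfolding Q.emeasure_eq_measure using F Q.prob_compl[OF Fm] by (intro ennreal_leI) simp
    ultimately have "ennreal (1 / 2) \<le> emeasure ?Q ((\<lambda>Y. merge I J (X, Y)) -` B \<inter> space ?Q)"
      by (rule order.trans[rotated])
    then show ?thesis using True by (simp only: indicator_simps mult_1_right)
  qed simp
  have "ennreal (1 / 2) * emeasure ?P A = (\<integral>\<^sup>+X. ennreal (1 / 2) * indicator A X \<partial>?P)"
    using Am by (simp add: nn_integral_cmult_indicator)
  also have "\<dots> \<le> (\<integral>\<^sup>+X. emeasure ?Q ((\<lambda>Y. merge I J (X, Y)) -` B \<inter> space ?Q) \<partial>?P)"
    by (intro nn_integral_mono slice)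
  also have "\<dots> = emeasure (PiM (I \<union> J) (\<lambda>_. M)) B"
    by (rule S.emeasure_fold_integral[symmetric]) (use B in \<open>auto simp: I_def J_def\<close>)
  also have "\<dots> \<le> ennreal (8 * exp (- L))" by (rule B(1))
  finally have "ennreal (1 / 2 * measure ?P A) \<le> ennreal (8 * exp (- L))"
    by (simp only: P.emeasure_eq_measure ennreal_mult' measure_nonneg)
  then have "measure ?P A \<le> 16 * exp (- L)" by (subst (asm) ennreal_le_iff) auto
  then show ?thesis by (simp add: A_def I_def)
qed

text \<open>Countable classes are increasing unions of finite ones, and classes with a countable pointwise
dense subclass follow by dominated convergence. The event is stated as a measurable set of good samples, since the supremum over \<open>G\<close> itself
is not known to be measurable.\<close>

theorem vc_uniform_deviation:
  fixes L :: real and n :: nat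
  assumes M: "prob_space M" and n: "n > 0" and H: "countable H" "H \<noteq> {}" "H \<subseteq> sets M" and G: "G \<subseteq> sets M"
    and vc: "\<And>S. finite S \<Longrightarrow> shatters H S \<Longrightarrow> card S \<le> D" and D: "D \<ge> 1" and L: "L \<ge> 0"
    and approx: "\<And>g. g \<in> G \<Longrightarrow> \<exists>s. range s \<subseteq> H \<and> (\<forall>x\<in>space M. \<forall>\<^sub>F m in sequentially. x \<in> s m \<longleftrightarrow> x \<in> g)"
  shows "\<exists>E\<in>sets (PiM {1..n} (\<lambda>_. M)). measure (PiM {1..n} (\<lambda>_. M)) E \<ge> 1 - 16 * exp (- L) \<and>
     (\<forall>X\<in>E. \<forall>g\<in>G. \<bar>(\<Sum>i=1..n. indicat_real g (X i)) - n * measure M g\<bar> \<le> 96 * sqrt (n * (D + L)))"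
proof -
  let ?P = "PiM {1..n} (\<lambda>_. M)" and ?t = "96 * sqrt (n * (D + L))"
  interpret P: prob_space ?P by (intro prob_space_PiM M)
  interpret M: prob_space M by fact
  \<comment> \<open>The surjective enumeration also covers finite \<open>H\<close>.\<close>
  define hs where "hs = from_nat_into H"
  have hs: "range hs = H" unfolding hs_def using H by (simp add: range_from_nat_into)
  define dev where "dev g X = \<bar>(\<Sum>i=1..n. indicat_real g (X i)) - n * measure M g\<bar>" for g and X :: "nat \<Rightarrow> 'a"
  have devm: "dev g \<in> borel_measurable ?P" if "g \<in> sets M" for g
    using that unfolding dev_def by measurable
  define A where "A m = {X\<in>space ?P. \<exists>h\<in>hs ` {..<m}. dev h X > ?t}" for m
  have hsM: "hs m \<in> sets M" for m using hs H by auto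
  have Am: "A m \<in> sets ?P" for m
  proof -
    have "A m = (\<Union>j<m. {X\<in>space ?P. dev (hs j) X > ?t})" by (auto simp: A_def)
    also have "\<dots> \<in> sets ?P" by (intro sets.finite_UN) (use devm[OF hsM] in measurable)
    finally show ?thesis .
  qed
  have A: "measure ?P (A m) \<le> 16 * exp (- L)" for m
    unfolding A_def dev_def
  proof (rule vc_deviation_finite[OF M n _ _ _ D L])
    show "card S \<le> D" if "finite S" "shatters (hs ` {..<m}) S" for S
      using that(1) by (rule vc) (rule shatters_mono[OF that(2)], use hs in auto)
  qed (use hsM in auto)
  have inc: "incseq A" by (rule incseq_SucI) (auto simp: A_def lessThan_Suc)
  have "(\<lambda>m. measure ?P (A m)) \<longlonglongrightarrow> measure ?P (\<Union>m. A m)"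
    by (rule P.finite_Lim_measure_incseq) (use Am inc in auto)
  then have U: "measure ?P (\<Union>m. A m) \<le> 16 * exp (- L)"
    by (rule LIMSEQ_le_const2) (use A in auto)
  have Um: "(\<Union>m. A m) \<in> sets ?P" using Am by auto
  show ?thesis
  proof (intro bexI[of _ "space ?P - (\<Union>m. A m)"] conjI ballI)
    show "space ?P - (\<Union>m. A m) \<in> sets ?P" using Um by auto
    show "1 - 16 * exp (- L) \<le> measure ?P (space ?P - (\<Union>m. A m))" using U P.prob_compl[OF Um] by simp
    fix X g assume X: "X \<in> space ?P - (\<Union>m. A m)" and g: "g \<in> G"
    have Xi: "X i \<in> space M" if "i \<in> {1..n}" for i using X that by (auto simp: space_PiM)
    have devH: "dev h X \<le> ?t" if "h \<in> H" for h
    proof -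
      have "h \<in> range hs" using hs that by simp
      then obtain j where "h = hs j" by blast
      then show ?thesis using X by (auto simp: A_def not_less dest: spec[of _ "Suc j"])
    qed
    obtain s where s: "range s \<subseteq> H" "\<And>x. x \<in> space M \<Longrightarrow> \<forall>\<^sub>F m in sequentially. x \<in> s m \<longleftrightarrow> x \<in> g"
      using approx[OF g] by blast
    have gM: "g \<in> sets M" and sM: "s m \<in> sets M" for m using g G s H by auto
    have lim: "(\<lambda>m. indicat_real (s m) x) \<longlonglongrightarrow> indicat_real g x" if "x \<in> space M" for x
      by (rule tendsto_eventually) (use s(2)[OF that] in \<open>auto elim!: eventually_mono simp: indicator_def\<close>)
    have "(\<lambda>m. integral\<^sup>L M (indicat_real (s m))) \<longlonglongrightarrow> integral\<^sup>L M (indicat_real g)"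
      by (rule integral_dominated_convergence[where w = "\<lambda>_. 1"]) (use gM sM lim in \<open>auto simp: indicator_def\<close>)
    then have "(\<lambda>m. measure M (s m)) \<longlonglongrightarrow> measure M g" using gM sM by simp
    moreover have "(\<lambda>m. \<Sum>i=1..n. indicat_real (s m) (X i)) \<longlonglongrightarrow> (\<Sum>i=1..n. indicat_real g (X i))"
      by (intro tendsto_sum lim Xi)
    ultimately have "(\<lambda>m. dev (s m) X) \<longlonglongrightarrow> dev g X" unfolding dev_def
      by (intro tendsto_rabs tendsto_diff tendsto_mult tendsto_const)
    moreover have "dev (s m) X \<le> ?t" for m by (rule devH) (use s(1) in blast)
    ultimately have "dev g X \<le> ?t" by (intro LIMSEQ_le_const2[of "\<lambda>m. dev (s m) X"]) auto
    then show "\<bar>(\<Sum>i=1..n. indicat_real g (X i)) - n * measure M g\<bar> \<le> ?t" by (simp add: dev_def)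
  qed
qed

section \<open>Half-spaces\<close>

definition halfspace :: "nat \<Rightarrow> nat set \<Rightarrow> vector \<Rightarrow> real \<Rightarrow> vector set" where
  "halfspace p W u a = {x\<in>space (Rn p). a < (\<Sum>i\<in>W. u i * x i)}"

lemma halfspace_sets: "W \<subseteq> {1..p} \<Longrightarrow> halfspace p W u a \<in> sets (Rn p)"
proof -
  assume W: "W \<subseteq> {1..p}"
  have "(\<lambda>x. \<Sum>i\<in>W. u i * x i) \<in> borel_measurable (Rn p)"
    unfolding Rn_def by (intro borel_measurable_sum borel_measurable_times borel_measurable_const measurable_component_singleton) (use W in auto)
  then show ?thesis unfolding halfspace_def by measurable
qed

text \<open>Radon's argument. Among \<open>card W + 2\<close> points there is an affine dependence \<open>c\<close>. A half-space cutting
out exactly the points with \<open>c x > 0\<close> would make \<open>c x * y x\<close> nonnegative for every point, where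
\<open>y\<close> is the defining affine function, and positive for one point, although these products sum to zero.\<close>

lemma halfspaces_vc:
  assumes W: "finite W" and H: "H \<subseteq> {halfspace p W u a |u a. True}" and S: "finite S" "shatters H S"
  shows "card S \<le> card W + 1"
proof (rule ccontr)
  assume "\<not> card S \<le> card W + 1"
  then have "card (insert None (Some ` W)) < card S"
    using W by (simp add: card_image)
  \<comment> \<open>The extra index \<open>None\<close> carries the equation that makes the dependence affine.\<close>
  from homogeneous_system_nontrivial[OF _ S(1) this, of "\<lambda>i x. case i of None \<Rightarrow> 1 | Some j \<Rightarrow> x j"] W
  obtain c where c: "\<exists>x\<in>S. c x \<noteq> 0" "(\<Sum>x\<in>S. c x) = 0" "\<And>i. i \<in> W \<Longrightarrow> (\<Sum>x\<in>S. x i * c x) = 0" by auto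
  have "\<exists>x\<in>S. c x > 0"
  proof (rule ccontr)
    assume "\<not> ?thesis"
    then have "\<And>x. x \<in> S \<Longrightarrow> 0 \<le> - c x" by (auto simp: not_less)
    moreover have "(\<Sum>x\<in>S. - c x) = 0" using c(2) by (simp add: sum_negf)
    ultimately have "\<forall>x\<in>S. - c x = 0" using sum_nonneg_eq_0_iff[OF S(1), of "\<lambda>x. - c x"] by blast
    then show False using c(1) by auto
  qed
  then obtain x0 where x0: "x0 \<in> S" "c x0 > 0" by blast
  obtain h where h: "h \<in> H" "h \<inter> S = {x\<in>S. c x > 0}"
    using S(2)[unfolded shatters_def, rule_format, of "{x\<in>S. c x > 0}"] by (auto simp: Collect_conj_eq)
  obtain u a where hu: "h = halfspace p W u a" using h(1) H by blast
  \<comment> \<open>Shattered points lie in some half-space and hence in the carrier of \<open>Rn p\<close>.\<close>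
  obtain h' where h': "h' \<in> H" "h' \<inter> S = S" using S(2)[unfolded shatters_def, rule_format, of S] by auto
  have sp: "x \<in> space (Rn p)" if "x \<in> S" for x using h' H that unfolding halfspace_def by auto
  define y where "y x = (\<Sum>i\<in>W. u i * x i) - a" for x
  have y: "y x > 0 \<longleftrightarrow> c x > 0" if "x \<in> S" for x
  proof -
    have "x \<in> h \<longleftrightarrow> c x > 0" using h(2) that by blast
    then show ?thesis using sp[OF that] by (simp add: hu halfspace_def y_def)
  qed
  have "(\<Sum>x\<in>S. c x * y x) = (\<Sum>x\<in>S. \<Sum>i\<in>W. u i * (x i * c x)) - a * (\<Sum>x\<in>S. c x)"
    by (simp add: y_def right_diff_distrib sum_subtractf sum_distrib_left mult_ac)
  also have "(\<Sum>x\<in>S. \<Sum>i\<in>W. u i * (x i * c x)) = (\<Sum>i\<in>W. u i * (\<Sum>x\<in>S. x i * c x))"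
    by (subst sum.swap) (simp add: sum_distrib_left)
  also have "\<dots> = 0" by (simp add: c(3))
  finally have "(\<Sum>x\<in>S. c x * y x) = 0" by (simp add: c(2))
  moreover have "(\<Sum>x\<in>S. c x * y x) > 0"
  proof (rule sum_pos2[OF S(1) x0(1)])
    show "0 < c x0 * y x0" using x0 y by simp
    show "0 \<le> c x * y x" if "x \<in> S" for x
      using y[OF that] by (cases "c x > 0") (auto simp: not_less intro: mult_nonpos_nonpos)
  qed
  ultimately show False by simp
qed

lemma rational_approximation:
  fixes r :: real
  shows "\<exists>q\<in>\<rat>. \<bar>q - r\<bar> \<le> 1 / (real m + 1)\<^sup>2"
proof -
  have "r < r + 1 / (real m + 1)\<^sup>2" by simp
  from Rats_dense_in_real[OF this] obtain q where "q \<in> \<rat>" "r < q" "q < r + 1 / (real m + 1)\<^sup>2" by blast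
  then show ?thesis by (intro bexI[of _ q]) auto
qed

text \<open>Half-spaces with rational data are pointwise dense among all half-spaces. The threshold \<open>a\<close> is
approached from above, by \<open>a + 1 / (m + 1)\<close>, and all data with the smaller error
\<open>1 / (m + 1)\<^sup>2\<close>; this decides the membership correctly in the limit also for points on the boundary
hyperplane, which are outside the open half-space.\<close>

lemma halfspace_deviation:
  fixes L :: real and n :: nat
  assumes M: "prob_space M" "sets M = sets (Rn p)" and n: "n > 0" and W: "W \<subseteq> {1..p}" and L: "L \<ge> 0"
  shows "\<exists>E\<in>sets (PiM {1..n} (\<lambda>_. M)). measure (PiM {1..n} (\<lambda>_. M)) E \<ge> 1 - 16 * exp (- L) \<and>
     (\<forall>X\<in>E. \<forall>u a. \<bar>(\<Sum>i=1..n. indicat_real (halfspace p W u a) (X i)) - n * measure M (halfspace p W u a)\<bar>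
         \<le> 96 * sqrt (n * (real (card W) + 1 + L)))"
proof -
  have finW: "finite W" using W finite_subset by auto
  have sp: "space M = space (Rn p)" using M(2) by (rule sets_eq_imp_space_eq)
  define H where "H = (\<lambda>(u, a). halfspace p W u a) ` (PiE W (\<lambda>_. \<rat>) \<times> \<rat>)"
  define G where "G = {halfspace p W u a |u a. True}"
  have "\<exists>E\<in>sets (PiM {1..n} (\<lambda>_. M)). measure (PiM {1..n} (\<lambda>_. M)) E \<ge> 1 - 16 * exp (- L) \<and>
     (\<forall>X\<in>E. \<forall>g\<in>G. \<bar>(\<Sum>i=1..n. indicat_real g (X i)) - n * measure M g\<bar> \<le> 96 * sqrt (n * (real (card W + 1) + L)))"
  proof (rule vc_uniform_deviation[OF M(1) n])
    show "countable H" unfolding H_def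
      by (intro countable_image countable_SIGMA countable_PiE finW countable_rat)
    show "H \<noteq> {}"
    proof -
      have "((\<lambda>i\<in>W. 0), 0::real) \<in> PiE W (\<lambda>_. \<rat>) \<times> \<rat>" by auto
      then show ?thesis unfolding H_def by blast
    qed
    show "H \<subseteq> sets M" "G \<subseteq> sets M" using halfspace_sets[OF W] M(2) by (auto simp: H_def G_def)
    show "card S \<le> card W + 1" if "finite S" "shatters H S" for S
      by (rule halfspaces_vc[OF finW _ that]) (auto simp: H_def)
    fix g assume "g \<in> G"
    then obtain u a where g: "g = halfspace p W u a" by (auto simp: G_def)
    have "\<forall>m i. \<exists>q. q \<in> \<rat> \<and> \<bar>q - u i\<bar> \<le> 1 / (real m + 1)\<^sup>2"
      using rational_approximation by blast
    then obtain v where v: "\<And>m i. v m i \<in> \<rat>" "\<And>m i. \<bar>v m i - u i\<bar> \<le> 1 / (real m + 1)\<^sup>2" by metis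
    have "\<forall>m. \<exists>q. q \<in> \<rat> \<and> \<bar>q - (a + 1 / (real m + 1))\<bar> \<le> 1 / (real m + 1)\<^sup>2"
      using rational_approximation by blast
    then obtain b where b: "\<And>m. b m \<in> \<rat>" "\<And>m. \<bar>b m - (a + 1 / (real m + 1))\<bar> \<le> 1 / (real m + 1)\<^sup>2" by metis
    define s where "s m = halfspace p W (restrict (v m) W) (b m)" for m
    have "range s \<subseteq> H" unfolding s_def H_def using v(1) b(1) by auto
    moreover have "\<forall>\<^sub>F m in sequentially. x \<in> s m \<longleftrightarrow> x \<in> g" if x: "x \<in> space M" for x
    proof -
      define K where "K = (\<Sum>i\<in>W. \<bar>x i\<bar>) + 1"
      have K: "K > 0" unfolding K_def by (intro add_nonneg_pos sum_nonneg) auto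
      \<comment> \<open>The error of the approximating affine function against the one with threshold \<open>a + 1 / (m + 1)\<close>.\<close>
      define d where "d m = ((\<Sum>i\<in>W. v m i * x i) - b m) - ((\<Sum>i\<in>W. u i * x i) - a - 1 / (real m + 1))" for m
      have d: "\<bar>d m\<bar> \<le> K / (real m + 1)\<^sup>2" for m
      proof -
        have "d m = (\<Sum>i\<in>W. (v m i - u i) * x i) - (b m - (a + 1 / (real m + 1)))"
          by (simp add: d_def left_diff_distrib sum_subtractf)
        also have "\<bar>\<dots>\<bar> \<le> \<bar>\<Sum>i\<in>W. (v m i - u i) * x i\<bar> + \<bar>b m - (a + 1 / (real m + 1))\<bar>" by linarith
        also have "\<dots> \<le> (\<Sum>i\<in>W. 1 / (real m + 1)\<^sup>2 * \<bar>x i\<bar>) + 1 / (real m + 1)\<^sup>2"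
          by (intro add_mono b(2) order.trans[OF sum_abs] sum_mono) (simp only: abs_mult, intro mult_right_mono v(2) abs_ge_zero)
        also have "\<dots> = K / (real m + 1)\<^sup>2" by (simp add: K_def add_divide_distrib flip: sum_divide_distrib)
        finally show ?thesis .
      qed
      have l1: "(\<lambda>m. 1 / (real m + 1)) \<longlonglongrightarrow> 0"
        using LIMSEQ_Suc[OF lim_1_over_n] by (simp add: add.commute)
      show ?thesis
      proof (cases "a < (\<Sum>i\<in>W. u i * x i)")
        case True
        define r where "r = (\<Sum>i\<in>W. u i * x i) - a"
        have "(\<lambda>m. (1 + K) * (1 / (real m + 1))) \<longlonglongrightarrow> (1 + K) * 0" by (intro tendsto_intros l1)
        then have "\<forall>\<^sub>F m in sequentially. (1 + K) * (1 / (real m + 1)) < r"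
          by (rule order_tendstoD(2)) (use True in \<open>simp add: r_def\<close>)
        then show ?thesis
        proof eventually_elim
          case (elim m)
          have "K / (real m + 1)\<^sup>2 \<le> K / (real m + 1)"
            using K by (intro divide_left_mono) (auto simp: power2_eq_square)
          then have "(\<Sum>i\<in>W. v m i * x i) > b m" using elim d[of m] K
            by (simp add: d_def r_def distrib_right add_divide_distrib)
          then show ?case using True x sp by (simp add: s_def g halfspace_def cong: sum.cong)
        qed
      next
        case False
        have "(\<lambda>m. K * (1 / (real m + 1))) \<longlonglongrightarrow> K * 0" by (intro tendsto_intros l1)
        then have "\<forall>\<^sub>F m in sequentially. K * (1 / (real m + 1)) < 1"
          by (rule order_tendstoD(2)) simp
        then show ?thesis
        proof eventually_elim
          case (elim m)
          have "K / (real m + 1)\<^sup>2 = K * (1 / (real m + 1)) * (1 / (real m + 1))" by (simp add: power2_eq_square)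
          also have "\<dots> \<le> 1 * (1 / (real m + 1))" by (rule mult_right_mono) (use elim in auto)
          finally have "(\<Sum>i\<in>W. v m i * x i) \<le> b m" using d[of m] False by (simp add: d_def)
          then show ?case using False x sp by (simp add: s_def g halfspace_def cong: sum.cong)
        qed
      qed
    qed
    ultimately show "\<exists>s. range s \<subseteq> H \<and> (\<forall>x\<in>space M. \<forall>\<^sub>F m in sequentially. x \<in> s m \<longleftrightarrow> x \<in> g)" by blast
  qed (use L in auto)
  then obtain E where E: "E \<in> sets (PiM {1..n} (\<lambda>_. M))" "measure (PiM {1..n} (\<lambda>_. M)) E \<ge> 1 - 16 * exp (- L)"
    "\<And>X g. X \<in> E \<Longrightarrow> g \<in> G \<Longrightarrow>
      \<bar>(\<Sum>i=1..n. indicat_real g (X i)) - n * measure M g\<bar> \<le> 96 * sqrt (n * (real (card W + 1) + L))"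
    by (elim bexE conjE) metis
  show ?thesis
  proof (intro bexI[of _ E] conjI ballI allI E(1,2))
    fix X u a assume "X \<in> E"
    moreover have "halfspace p W u a \<in> G" by (auto simp: G_def)
    ultimately show "\<bar>(\<Sum>i=1..n. indicat_real (halfspace p W u a) (X i)) - n * measure M (halfspace p W u a)\<bar>
         \<le> 96 * sqrt (n * (real (card W) + 1 + L))"
      using E(3)[of X "halfspace p W u a"] by (simp only: of_nat_add of_nat_1)
  qed
qed

section \<open>Quadratic forms, singular values and the operator norm\<close>

lemma quad_form_eq: "quad_form p B u = (\<Sum>i=1..p. \<Sum>j=1..p. B i j * u i * u j)"
  by (simp add: quad_form_def dot_def mat_vec_def sum_distrib_left mult_ac)

lemma enorm_power2: "(enorm p u)\<^sup>2 = (\<Sum>i=1..p. (u i)\<^sup>2)"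
  by (simp add: enorm_def L2_set_def sum_nonneg)

lemma enorm_nonneg: "0 \<le> enorm p u"
  by (simp add: enorm_def)

lemma unit_sphereD: "u \<in> unit_sphere p \<Longrightarrow> (\<Sum>i=1..p. (u i)\<^sup>2) = 1"
  using enorm_power2[of p u] by (simp add: unit_sphere_def)

lemma quad_form_scale: "quad_form p B (\<lambda>i. c * u i) = c\<^sup>2 * quad_form p B u"
  by (simp add: quad_form_eq sum_distrib_left power2_eq_square mult_ac)

lemma quad_form_cong: "(\<And>i. i \<in> {1..p} \<Longrightarrow> u i = v i) \<Longrightarrow> quad_form p B u = quad_form p B v"
  unfolding quad_form_eq by (intro sum.cong refl) simp

lemma quad_form_diff: "quad_form p (\<lambda>i j. A i j - B i j) u = quad_form p A u - quad_form p B u"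
  by (simp add: quad_form_eq left_diff_distrib sum_subtractf)

definition bilin :: "nat \<Rightarrow> matrix \<Rightarrow> vector \<Rightarrow> vector \<Rightarrow> real" where
  "bilin p B u v = (\<Sum>i=1..p. \<Sum>j=1..p. B i j * u i * v j)"

lemma bilin_sym:
  assumes "\<And>i j. i \<in> {1..p} \<Longrightarrow> j \<in> {1..p} \<Longrightarrow> B i j = B j i"
  shows "bilin p B u v = bilin p B v u"
proof -
  have "bilin p B u v = (\<Sum>j=1..p. \<Sum>i=1..p. B i j * u i * v j)"
    unfolding bilin_def by (rule sum.swap)
  also have "\<dots> = bilin p B v u"
    unfolding bilin_def by (intro sum.cong refl) (use assms in \<open>simp add: mult_ac\<close>)
  finally show ?thesis .
qed

lemma quad_form_add:
  assumes "\<And>i j. i \<in> {1..p} \<Longrightarrow> j \<in> {1..p} \<Longrightarrow> B i j = B j i"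
  shows "quad_form p B (\<lambda>i. u i + t * v i) = quad_form p B u + 2 * t * bilin p B u v + t\<^sup>2 * quad_form p B v"
proof -
  have "quad_form p B (\<lambda>i. u i + t * v i) = quad_form p B u + t * bilin p B u v + t * bilin p B v u + t\<^sup>2 * quad_form p B v"
    by (simp add: quad_form_eq bilin_def algebra_simps sum.distrib sum_distrib_left power2_eq_square)
  then show ?thesis using bilin_sym[of p B v u] assms by simp
qed

text \<open>Vectors are functions on all natural numbers that are fixed outside \<open>{1..p}\<close>, so the sphere is a
closed subset of a product of compact sets, and Tychonoff's theorem applies.\<close>

lemma compact_unit_sphere: "compact (unit_sphere p)"
proof -
  define S where "S i = (if i \<in> {1..p} then {-1..1} else {undefined :: real})" for i :: nat
  have "compactin (product_topology (\<lambda>i. euclidean) UNIV) (PiE UNIV S)"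
    unfolding compactin_PiE by (auto simp: S_def compactin_euclidean_iff)
  then have c: "compact (PiE UNIV S)" by (simp add: euclidean_product_topology compactin_euclidean_iff)
  have "closed {u :: vector. (\<Sum>i=1..p. (u i)\<^sup>2) = 1}"
    by (intro closed_Collect_eq continuous_intros) auto
  then have "compact (PiE UNIV S \<inter> {u. (\<Sum>i=1..p. (u i)\<^sup>2) = 1})" using c by (rule compact_Int_closed[rotated])
  also have "PiE UNIV S \<inter> {u. (\<Sum>i=1..p. (u i)\<^sup>2) = 1} = unit_sphere p"
  proof (intro set_eqI iffI)
    fix u :: vector assume u: "u \<in> PiE UNIV S \<inter> {u. (\<Sum>i=1..p. (u i)\<^sup>2) = 1}"
    then have "u i = undefined" if "i \<notin> {1..p}" for i
    proof -
      have "u i \<in> S i" using u by auto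
      then show ?thesis using that by (auto simp: S_def)
    qed
    moreover have "enorm p u = 1" using u by (simp add: enorm_def L2_set_def)
    ultimately show "u \<in> unit_sphere p" by (auto simp: unit_sphere_def extensional_def)
  next
    fix u assume u: "u \<in> unit_sphere p"
    note s = unit_sphereD[OF u]
    have "u i \<in> S i" for i
    proof (cases "i \<in> {1..p}")
      case True
      have "(u i)\<^sup>2 \<le> (\<Sum>i=1..p. (u i)\<^sup>2)" using True by (intro member_le_sum) auto
      then have "\<bar>u i\<bar> \<le> 1" using s by (simp add: abs_square_le_1)
      then show ?thesis using True by (auto simp: S_def)
    next
      case False
      then have "u i = undefined" using u by (auto simp: unit_sphere_def extensional_def)
      moreover have "S i = {undefined}" unfolding S_def by (rule if_not_P[OF False])
      ultimately show ?thesis by simp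
    qed
    then show "u \<in> PiE UNIV S \<inter> {u. (\<Sum>i=1..p. (u i)\<^sup>2) = 1}" using s by auto
  qed
  finally show ?thesis .
qed

lemma first_axis_in_unit_sphere:
  assumes "p > 0"
  shows "(\<lambda>i\<in>{1..p}. if i = 1 then 1 else 0) \<in> unit_sphere p"
proof -
  have "(\<Sum>i=1..p. ((\<lambda>i\<in>{1..p}. if i = 1 then 1 else 0 :: real) i)\<^sup>2) = (\<Sum>i=1..p. if i = 1 then 1 else 0)"
    by (rule sum.cong) auto
  also have "\<dots> = 1" using assms by (simp add: sum.delta)
  finally show ?thesis by (auto simp: unit_sphere_def enorm_def L2_set_def)
qed

lemma rayleigh_minimum:
  assumes p: "p > 0"
  shows "\<exists>v\<in>unit_sphere p. \<forall>u. quad_form p B u \<ge> quad_form p B v * (enorm p u)\<^sup>2"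
proof -
  have "continuous_on (unit_sphere p) (quad_form p B)"
    unfolding quad_form_eq[abs_def] by (intro continuous_intros continuous_on_subset[OF continuous_on_product_coordinates]) auto
  then obtain v where v: "v \<in> unit_sphere p" "\<And>u. u \<in> unit_sphere p \<Longrightarrow> quad_form p B v \<le> quad_form p B u"
    using continuous_attains_inf[OF compact_unit_sphere] first_axis_in_unit_sphere[OF p] by blast
  show ?thesis
  proof (intro bexI[OF _ v(1)] allI)
    fix u :: vector
    show "quad_form p B u \<ge> quad_form p B v * (enorm p u)\<^sup>2"
    proof (cases "enorm p u = 0")
      case True
      then have "\<forall>i\<in>{1..p}. (u i)\<^sup>2 = 0" using enorm_power2[of p u] by (simp add: sum_nonneg_eq_0_iff)
      then have "quad_form p B u = 0" by (simp add: quad_form_eq)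
      then show ?thesis using True by simp
    next
      case False
      define w where "w = (\<lambda>i\<in>{1..p}. 1 / enorm p u * u i)"
      have "(\<Sum>i=1..p. (w i)\<^sup>2) = (\<Sum>i=1..p. (1 / enorm p u)\<^sup>2 * (u i)\<^sup>2)"
        by (rule sum.cong) (auto simp: w_def power_mult_distrib power_divide)
      also have "\<dots> = (1 / enorm p u)\<^sup>2 * (enorm p u)\<^sup>2"
        unfolding enorm_power2 sum_distrib_left ..
      also have "\<dots> = 1" using False by (simp add: field_simps)
      finally have "w \<in> unit_sphere p" by (simp add: unit_sphere_def enorm_def L2_set_def w_def)
      from v(2)[OF this] have "quad_form p B v \<le> quad_form p B (\<lambda>i. 1 / enorm p u * u i)"
        using quad_form_cong[of p w "\<lambda>i. 1 / enorm p u * u i"] by (simp add: w_def)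
      then have "quad_form p B v \<le> (1 / enorm p u)\<^sup>2 * quad_form p B u" by (simp only: quad_form_scale)
      then show ?thesis using False by (simp add: field_simps power_divide)
    qed
  qed
qed

text \<open>The first-order condition at a minimum, applied below to the perturbation of a minimizing vector.\<close>

lemma linear_term_zero:
  fixes b c :: real
  assumes "\<And>t. 0 \<le> 2 * t * b + t\<^sup>2 * c"
  shows "b = 0"
proof -
  \<comment> \<open>The coefficient \<open>c\<close> may vanish or be negative; \<open>t = - b / d\<close> still makes the linear term dominate.\<close>
  define d where "d = \<bar>c\<bar> + 1"
  have d: "d > 0" by (simp add: d_def)
  have "0 \<le> 2 * (- b / d) * b + (- b / d)\<^sup>2 * c" by (rule assms)
  also have "\<dots> \<le> 2 * (- b / d) * b + (- b / d)\<^sup>2 * d" by (intro add_left_mono mult_left_mono) (auto simp: d_def)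
  also have "\<dots> = - (b\<^sup>2 / d)" using d by (simp add: field_simps power2_eq_square)
  finally have "b\<^sup>2 / d \<le> 0" by simp
  then have "b\<^sup>2 \<le> 0" using d by (simp add: divide_le_0_iff)
  then show ?thesis by simp
qed

text \<open>Perturbing the minimizer along a coordinate axis, the first-order term must vanish; its value is the
corresponding coordinate of \<open>B v - l v\<close>.\<close>

lemma rayleigh_minimizer_eigenvector:
  assumes sym: "\<And>i j. i \<in> {1..p} \<Longrightarrow> j \<in> {1..p} \<Longrightarrow> B i j = B j i"
    and v: "(enorm p v)\<^sup>2 = 1" and min: "\<And>u. quad_form p B u \<ge> quad_form p B v * (enorm p u)\<^sup>2"
    and i: "i \<in> {1..p}"
  shows "(\<Sum>j=1..p. B i j * v j) = quad_form p B v * v i"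
proof -
  define l where "l = quad_form p B v"
  define e where "e j = (if j = i then 1 else 0 :: real)" for j
  have "0 \<le> 2 * t * (bilin p B v e - l * v i) + t\<^sup>2 * (quad_form p B e - l)" for t
  proof -
    have "(enorm p (\<lambda>i. v i + t * e i))\<^sup>2 = (\<Sum>j=1..p. (v j)\<^sup>2 + (if j = i then 2 * t * v i + t\<^sup>2 else 0))"
      unfolding enorm_power2 by (rule sum.cong) (auto simp: e_def power2_sum)
    also have "\<dots> = 1 + 2 * t * v i + t\<^sup>2"
      using i v by (simp add: sum.distrib enorm_power2)
    finally have "quad_form p B v + 2 * t * bilin p B v e + t\<^sup>2 * quad_form p B e \<ge> l * (1 + 2 * t * v i + t\<^sup>2)"
      using min[of "\<lambda>i. v i + t * e i"] quad_form_add[of p B v t e] sym unfolding l_def by auto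
    then show ?thesis by (simp add: l_def algebra_simps)
  qed
  then have "bilin p B v e = l * v i" using linear_term_zero by fastforce
  moreover have "bilin p B v e = (\<Sum>j=1..p. B i j * v j)"
  proof -
    have "bilin p B v e = (\<Sum>j=1..p. B j i * v j)"
      using i by (simp add: bilin_def e_def if_distrib cong: if_cong)
    also have "\<dots> = (\<Sum>j=1..p. B i j * v j)"
      by (intro sum.cong refl) (simp only: sym[OF _ i])
    finally show ?thesis .
  qed
  ultimately show ?thesis by (simp add: l_def)
qed

lemma gram_eigenvector:
  assumes sym: "\<And>i j. i \<in> {1..p} \<Longrightarrow> j \<in> {1..p} \<Longrightarrow> \<Gamma> i j = \<Gamma> j i"
    and ev: "\<And>i. i \<in> {1..p} \<Longrightarrow> (\<Sum>j=1..p. \<Gamma> i j * v j) = l * v i"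
  shows "mat_vec p p (\<lambda>i j. \<Sum>k=1..p. \<Gamma> k i * \<Gamma> k j) v = (\<lambda>i\<in>{1..p}. l\<^sup>2 * v i)"
  unfolding mat_vec_def
proof (rule restrict_ext)
  fix i assume i: "i \<in> {1..p}"
  have "(\<Sum>j=1..p. (\<Sum>k=1..p. \<Gamma> k i * \<Gamma> k j) * v j) = (\<Sum>k=1..p. \<Gamma> k i * (\<Sum>j=1..p. \<Gamma> k j * v j))"
    unfolding sum_distrib_right sum_distrib_left by (subst sum.swap) (simp add: mult_ac)
  also have "\<dots> = (\<Sum>k=1..p. \<Gamma> i k * (l * v k))"
    using sym i ev by (intro sum.cong refl) auto
  also have "\<dots> = l * (\<Sum>k=1..p. \<Gamma> i k * v k)" by (simp add: sum_distrib_left mult_ac)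
  also have "\<dots> = l * (l * v i)" by (simp only: ev[OF i])
  also have "\<dots> = l\<^sup>2 * v i" by (simp add: power2_eq_square)
  finally show "(\<Sum>j=1..p. (\<Sum>k=1..p. \<Gamma> k i * \<Gamma> k j) * v j) = l\<^sup>2 * v i" .
qed

text \<open>Singular values are defined through eigenvectors of the Gram matrix. Eigenvectors for distinct
eigenvalues are orthogonal, and \<open>p + 1\<close> nonzero orthogonal vectors do not fit into dimension \<open>p\<close>.
Finiteness is what makes the maximum and the minimum of the singular values meaningful.\<close>

lemma finite_singular_values: "finite (singular_values p \<Gamma>)"
proof (rule ccontr)
  assume inf: "infinite (singular_values p \<Gamma>)"
  define C where "C i j = (\<Sum>l=1..p. \<Gamma> l i * \<Gamma> l j)" for i j
  have Csym: "C i j = C j i" for i j by (simp add: C_def mult.commute)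
  obtain J where J: "J \<subseteq> singular_values p \<Gamma>" "finite J" "card J = p + 1"
    using infinite_arbitrarily_large[OF inf] by blast
  have "\<forall>s\<in>J. \<exists>v. 0 \<le> s \<and> (\<exists>i\<in>{1..p}. v i \<noteq> 0) \<and> (\<forall>i\<in>{1..p}. (\<Sum>j=1..p. C i j * v j) = s\<^sup>2 * v i)"
  proof
    fix s assume "s \<in> J"
    then obtain v where v: "0 \<le> s" "\<exists>i\<in>{1..p}. v i \<noteq> 0" "mat_vec p p C v = (\<lambda>i\<in>{1..p}. s\<^sup>2 * v i)"
      using J(1) unfolding singular_values_def C_def by blast
    have "(\<Sum>j=1..p. C i j * v j) = s\<^sup>2 * v i" if "i \<in> {1..p}" for i
      using fun_cong[OF v(3), of i] that by (simp add: mat_vec_def)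
    then show "\<exists>v. 0 \<le> s \<and> (\<exists>i\<in>{1..p}. v i \<noteq> 0) \<and> (\<forall>i\<in>{1..p}. (\<Sum>j=1..p. C i j * v j) = s\<^sup>2 * v i)" using v by blast
  qed
  from bchoice[OF this] obtain v where v: "\<And>s. s \<in> J \<Longrightarrow> 0 \<le> s" "\<And>s. s \<in> J \<Longrightarrow> \<exists>i\<in>{1..p}. v s i \<noteq> 0"
    "\<And>s i. s \<in> J \<Longrightarrow> i \<in> {1..p} \<Longrightarrow> (\<Sum>j=1..p. C i j * v s j) = s\<^sup>2 * v s i" by blast
  have bil: "bilin p C u (v s) = s\<^sup>2 * (\<Sum>i=1..p. u i * v s i)" if "s \<in> J" for s u
  proof -
    have "bilin p C u (v s) = (\<Sum>i=1..p. u i * (\<Sum>j=1..p. C i j * v s j))"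
      by (simp add: bilin_def sum_distrib_left mult_ac)
    also have "\<dots> = (\<Sum>i=1..p. u i * (s\<^sup>2 * v s i))" using v(3)[OF that] by (intro sum.cong) auto
    finally show ?thesis by (simp add: sum_distrib_left mult_ac)
  qed
  have orth: "(\<Sum>i=1..p. v s i * v t i) = 0" if "s \<in> J" "t \<in> J" "s \<noteq> t" for s t
  proof -
    have "s\<^sup>2 * (\<Sum>i=1..p. v s i * v t i) = bilin p C (v t) (v s)" by (simp add: bil that(1) mult.commute)
    also have "\<dots> = bilin p C (v s) (v t)" using Csym by (intro bilin_sym) auto
    also have "\<dots> = t\<^sup>2 * (\<Sum>i=1..p. v s i * v t i)" by (simp add: bil that(2))
    finally have "(s\<^sup>2 - t\<^sup>2) * (\<Sum>i=1..p. v s i * v t i) = 0" by (simp add: algebra_simps)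
    moreover have "s\<^sup>2 \<noteq> t\<^sup>2" using v(1) that by (simp add: power2_eq_iff_nonneg)
    ultimately show ?thesis by simp
  qed
  have "card {1..p} < card J" using J by simp
  from homogeneous_system_nontrivial[OF _ J(2) this, of "\<lambda>i s. v s i"] obtain c
    where "(\<exists>s\<in>J. c s \<noteq> 0) \<and> (\<forall>i\<in>{1..p}. (\<Sum>s\<in>J. v s i * c s) = 0)" by blast
  then have c: "\<exists>s\<in>J. c s \<noteq> 0" "\<And>i. i \<in> {1..p} \<Longrightarrow> (\<Sum>s\<in>J. v s i * c s) = 0" by blast+
  from c(1) obtain t where t: "t \<in> J" "c t \<noteq> 0" by blast
  have "0 = (\<Sum>i=1..p. v t i * (\<Sum>s\<in>J. v s i * c s))" by (simp add: c(2))
  also have "\<dots> = (\<Sum>s\<in>J. \<Sum>i=1..p. v t i * (v s i * c s))" unfolding sum_distrib_left by (rule sum.swap)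
  also have "\<dots> = (\<Sum>s\<in>J. c s * (\<Sum>i=1..p. v t i * v s i))" by (simp add: sum_distrib_left mult_ac)
  also have "\<dots> = (\<Sum>s\<in>J. if s = t then c t * (\<Sum>i=1..p. (v t i)\<^sup>2) else 0)"
    by (rule sum.cong[OF refl]) (use orth t in \<open>auto simp: power2_eq_square\<close>)
  also have "\<dots> = c t * (\<Sum>i=1..p. (v t i)\<^sup>2)" using t J(2) by (simp add: sum.delta)
  finally have "(\<Sum>i=1..p. (v t i)\<^sup>2) = 0" using t(2) by simp
  then have "\<forall>i\<in>{1..p}. (v t i)\<^sup>2 = 0" by (subst (asm) sum_nonneg_eq_0_iff) auto
  then show False using v(2)[OF t(1)] by simp
qed

lemma psd_sym: "psd p \<Gamma> \<Longrightarrow> i \<in> {1..p} \<Longrightarrow> j \<in> {1..p} \<Longrightarrow> \<Gamma> i j = \<Gamma> j i"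
  by (simp add: psd_def)

lemma psd_quad_form_nonneg:
  assumes "psd p \<Gamma>"
  shows "0 \<le> quad_form p \<Gamma> u"
proof -
  have "0 \<le> quad_form p \<Gamma> (restrict u {1..p})" using assms by (simp add: psd_def)
  also have "\<dots> = quad_form p \<Gamma> u" by (rule quad_form_cong) simp
  finally show ?thesis .
qed

lemma eigenvalue_in_singular_values:
  assumes psd: "psd p \<Gamma>" and v: "v \<in> unit_sphere p"
    and ev: "\<And>i. i \<in> {1..p} \<Longrightarrow> (\<Sum>j=1..p. \<Gamma> i j * v j) = l * v i" and l: "0 \<le> l"
  shows "l \<in> singular_values p \<Gamma>"
proof -
  have "\<exists>i\<in>{1..p}. v i \<noteq> 0"
  proof (rule ccontr)
    assume "\<not> ?thesis"
    then have "(\<Sum>i=1..p. (v i)\<^sup>2) = 0" by simp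
    then show False using unit_sphereD[OF v] by simp
  qed
  moreover have "v \<in> extensional {1..p}" using v by (simp add: unit_sphere_def)
  ultimately show ?thesis
    using gram_eigenvector[of p \<Gamma> v l] psd_sym[OF psd] ev l unfolding singular_values_def by blast
qed

text \<open>The extreme values of the quadratic form on the sphere are eigenvalues, and for a positive
semidefinite matrix these are singular values. The upper bound is the lower one for \<open>- \<Gamma>\<close>.\<close>

lemma quad_form_singular_value_bounds:
  assumes psd: "psd p \<Gamma>" and p: "p > 0"
  shows "s_min p \<Gamma> * (enorm p u)\<^sup>2 \<le> quad_form p \<Gamma> u" "quad_form p \<Gamma> u \<le> s_max p \<Gamma> * (enorm p u)\<^sup>2"
proof -
  obtain v where v: "v \<in> unit_sphere p" "\<And>u. quad_form p \<Gamma> u \<ge> quad_form p \<Gamma> v * (enorm p u)\<^sup>2"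
    using rayleigh_minimum[OF p] by blast
  have v1: "(enorm p v)\<^sup>2 = 1" using v(1) by (simp add: unit_sphere_def)
  have "quad_form p \<Gamma> v \<in> singular_values p \<Gamma>"
    by (rule eigenvalue_in_singular_values[OF psd v(1) rayleigh_minimizer_eigenvector[OF psd_sym[OF psd] v1 v(2)]])
       (auto intro: psd_quad_form_nonneg[OF psd])
  then have "s_min p \<Gamma> \<le> quad_form p \<Gamma> v" unfolding s_min_def by (intro Min_le finite_singular_values)
  then have "s_min p \<Gamma> * (enorm p u)\<^sup>2 \<le> quad_form p \<Gamma> v * (enorm p u)\<^sup>2" by (intro mult_right_mono) auto
  then show "s_min p \<Gamma> * (enorm p u)\<^sup>2 \<le> quad_form p \<Gamma> u" using v(2)[of u] by linarith
  define N where "N i j = - \<Gamma> i j" for i j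
  have qN: "quad_form p N u = - quad_form p \<Gamma> u" for u by (simp add: quad_form_eq N_def sum_negf)
  obtain w where w: "w \<in> unit_sphere p" "\<And>u. quad_form p N u \<ge> quad_form p N w * (enorm p u)\<^sup>2"
    using rayleigh_minimum[OF p] by blast
  have w1: "(enorm p w)\<^sup>2 = 1" using w(1) by (simp add: unit_sphere_def)
  have Nsym: "N i j = N j i" if "i \<in> {1..p}" "j \<in> {1..p}" for i j using psd_sym[OF psd that] by (simp add: N_def)
  have "(\<Sum>j=1..p. \<Gamma> i j * w j) = quad_form p \<Gamma> w * w i" if i: "i \<in> {1..p}" for i
    using rayleigh_minimizer_eigenvector[OF Nsym w1 w(2) i] by (simp add: qN N_def sum_negf)
  then have "quad_form p \<Gamma> w \<in> singular_values p \<Gamma>"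
    by (intro eigenvalue_in_singular_values[OF psd w(1)] psd_quad_form_nonneg[OF psd]) auto
  then have "quad_form p \<Gamma> w \<le> s_max p \<Gamma>" unfolding s_max_def by (intro Max_ge finite_singular_values)
  then have "quad_form p \<Gamma> w * (enorm p u)\<^sup>2 \<le> s_max p \<Gamma> * (enorm p u)\<^sup>2" by (intro mult_right_mono) auto
  then show "quad_form p \<Gamma> u \<le> s_max p \<Gamma> * (enorm p u)\<^sup>2" using w(2)[of u] by (simp add: qN)
qed

text \<open>Polarization: for \<open>y\<close> in the direction of \<open>B u\<close>, the norm of \<open>B u\<close> is \<open>y\<^sup>T B u\<close>, a combination of
the values of the form at \<open>y + u\<close> and \<open>y - u\<close>, whose squared norms add up to \<open>4\<close>.\<close>

lemma op_norm_le_quad_form: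
  assumes p: "p > 0" and sym: "\<And>i j. i \<in> {1..p} \<Longrightarrow> j \<in> {1..p} \<Longrightarrow> B i j = B j i"
    and S: "S \<ge> 0" and q: "\<And>u. \<bar>quad_form p B u\<bar> \<le> S * (enorm p u)\<^sup>2"
  shows "op_norm p B \<le> S"
  unfolding op_norm_def
proof (rule cSUP_least)
  show "unit_sphere p \<noteq> {}" using first_axis_in_unit_sphere[OF p] by blast
  fix u assume u: "u \<in> unit_sphere p"
  define w where "w = mat_vec p p B u"
  show "enorm p (mat_vec p p B u) \<le> S"
  proof (cases "enorm p w = 0")
    case True
    then show ?thesis using S by (simp add: w_def)
  next
    case False
    define n where "n = enorm p w"
    have n: "n > 0" using False enorm_nonneg[of p w] by (simp add: n_def)
    define y where "y i = w i / n" for i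
    have y1: "(\<Sum>i=1..p. (y i)\<^sup>2) = 1"
    proof -
      have "(\<Sum>i=1..p. (y i)\<^sup>2) = (\<Sum>i=1..p. (w i)\<^sup>2) / n\<^sup>2" by (simp add: y_def power_divide sum_divide_distrib)
      also have "\<dots> = n\<^sup>2 / n\<^sup>2" by (simp only: n_def enorm_power2)
      finally show ?thesis using n by simp
    qed
    have "bilin p B y u = (\<Sum>i=1..p. y i * w i)"
      by (simp add: bilin_def w_def mat_vec_def sum_distrib_left mult_ac)
    also have "\<dots> = (\<Sum>i=1..p. (w i)\<^sup>2) / n" by (simp add: y_def power2_eq_square sum_divide_distrib)
    also have "\<dots> = n\<^sup>2 / n" by (simp only: n_def enorm_power2)
    also have "\<dots> = n" using n by (simp add: power2_eq_square)
    finally have b: "bilin p B y u = n" .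
    have e: "(enorm p (\<lambda>i. y i + t * u i))\<^sup>2 = 1 + 2 * t * (\<Sum>i=1..p. y i * u i) + t\<^sup>2" for t
    proof -
      have "(enorm p (\<lambda>i. y i + t * u i))\<^sup>2 = (\<Sum>i=1..p. (y i)\<^sup>2 + 2 * t * (y i * u i) + t\<^sup>2 * (u i)\<^sup>2)"
        unfolding enorm_power2 by (rule sum.cong) (auto simp: power2_sum power_mult_distrib)
      then show ?thesis using y1 unit_sphereD[OF u] by (simp add: sum.distrib flip: sum_distrib_left)
    qed
    have q1: "quad_form p B (\<lambda>i. y i + t * u i) = quad_form p B y + 2 * t * n + t\<^sup>2 * quad_form p B u" for t
      using quad_form_add[of p B y t u] sym b by simp
    have "4 * n = quad_form p B (\<lambda>i. y i + 1 * u i) - quad_form p B (\<lambda>i. y i + (-1) * u i)"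
      unfolding q1 by simp
    also have "\<dots> \<le> S * (enorm p (\<lambda>i. y i + 1 * u i))\<^sup>2 + S * (enorm p (\<lambda>i. y i + (-1) * u i))\<^sup>2"
      using q[of "\<lambda>i. y i + 1 * u i"] q[of "\<lambda>i. y i + (-1) * u i"] by linarith
    also have "\<dots> = 4 * S" unfolding e by (simp add: algebra_simps)
    finally show ?thesis by (simp add: n_def w_def)
  qed
qed

section \<open>Banded matrices and truncation\<close>

lemma quad_form_restrict:
  "quad_form p B (\<lambda>i. if P i then u i else 0)
     = (\<Sum>i=1..p. \<Sum>j=1..p. of_bool (P i \<and> P j) * (B i j * u i * u j))"
  unfolding quad_form_eq by (intro sum.cong refl) auto

text \<open>Inclusion-exclusion for adjacent blocks: two block numbers at distance at most one lie in one more
adjacent pair of blocks than single blocks contain them both.\<close>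

lemma sum_of_bool_window:
  fixes c d n :: nat
  assumes "c \<in> {1..n}" "d \<in> {1..n}" "c \<le> d + 1" "d \<le> c + 1"
  shows "(\<Sum>b\<le>n. of_bool (c \<in> {b, b + 1} \<and> d \<in> {b, b + 1})) - (\<Sum>b\<le>n. of_bool (c = b \<and> d = b)) = (1::real)"
proof -
  have fin: "finite {..n}" by simp
  consider "c = d" | "c = d + 1" | "d = c + 1" using assms by linarith
  then show ?thesis
  proof cases
    case 1
    have "(\<Sum>b\<le>n. of_bool (c \<in> {b, b + 1} \<and> d \<in> {b, b + 1})) = (\<Sum>b\<le>n. (if b = c then 1 else 0) + (if b = c - 1 then 1 else 0 :: real))"
      by (rule sum.cong) (use 1 assms in auto)
    moreover have "(\<Sum>b\<le>n. of_bool (c = b \<and> d = b)) = (\<Sum>b\<le>n. if b = c then 1 else 0 :: real)"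
      by (rule sum.cong) (use 1 in auto)
    ultimately show ?thesis using assms by (auto simp: sum.distrib)
  next
    case 2
    have "(\<Sum>b\<le>n. of_bool (c \<in> {b, b + 1} \<and> d \<in> {b, b + 1})) = (\<Sum>b\<le>n. if b = d then 1 else 0 :: real)"
      by (rule sum.cong) (use 2 assms in auto)
    moreover have "(\<Sum>b\<le>n. of_bool (c = b \<and> d = b)) = (\<Sum>b\<le>n. 0 :: real)"
      by (rule sum.cong) (use 2 in auto)
    ultimately show ?thesis using assms by auto
  next
    case 3
    have "(\<Sum>b\<le>n. of_bool (c \<in> {b, b + 1} \<and> d \<in> {b, b + 1})) = (\<Sum>b\<le>n. if b = c then 1 else 0 :: real)"
      by (rule sum.cong) (use 3 assms in auto)
    moreover have "(\<Sum>b\<le>n. of_bool (c = b \<and> d = b)) = (\<Sum>b\<le>n. 0 :: real)"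
      by (rule sum.cong) (use 3 in auto)
    ultimately show ?thesis using assms by auto
  qed
qed

lemma sum_sum_swap3:
  fixes f :: "nat \<Rightarrow> nat \<Rightarrow> real" and g :: "nat \<Rightarrow> nat \<Rightarrow> nat \<Rightarrow> real"
  shows "(\<Sum>b\<in>K. \<Sum>i\<in>I. \<Sum>j\<in>J. g b i j * f i j) = (\<Sum>i\<in>I. \<Sum>j\<in>J. (\<Sum>b\<in>K. g b i j) * f i j)"
proof -
  have "(\<Sum>b\<in>K. \<Sum>i\<in>I. \<Sum>j\<in>J. g b i j * f i j) = (\<Sum>i\<in>I. \<Sum>b\<in>K. \<Sum>j\<in>J. g b i j * f i j)" by (rule sum.swap)
  also have "\<dots> = (\<Sum>i\<in>I. \<Sum>j\<in>J. \<Sum>b\<in>K. g b i j * f i j)" by (intro sum.cong refl sum.swap)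
  finally show ?thesis by (simp add: sum_distrib_right)
qed

text \<open>The coordinates are cut into blocks of length \<open>k\<close>. Entries within the band couple only equal or
adjacent blocks, so the form of \<open>u\<close> is the sum over pairs of adjacent blocks minus the sum over
single blocks. Each coordinate occurs in two pairs and in one block, which gives the factor \<open>2 + 1 = 3\<close>.\<close>

lemma banded_quad_form_bound:
  assumes k: "k > 0" and S: "S \<ge> 0"
    and band: "\<And>i j. i \<in> {1..p} \<Longrightarrow> j \<in> {1..p} \<Longrightarrow> \<bar>int i - int j\<bar> > int k \<Longrightarrow> B i j = 0"
    and win: "\<And>l u. l \<ge> 1 \<Longrightarrow> (\<And>i. i \<in> {1..p} \<Longrightarrow> i \<notin> {l..l + 2 * k - 1} \<Longrightarrow> u i = 0) \<Longrightarrow>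
        \<bar>quad_form p B u\<bar> \<le> S * (enorm p u)\<^sup>2"
  shows "\<bar>quad_form p B u\<bar> \<le> 3 * S * (enorm p u)\<^sup>2"
proof -
  \<comment> \<open>Blocks are numbered from \<open>1\<close>, so that the pair with \<open>b = 0\<close> consists of the first block alone.\<close>
  define blk where "blk i = (i - 1) div k + 1" for i
  define y where "y b i = (if blk i \<in> {b, b + 1} then u i else 0)" for b i
  define z where "z b i = (if blk i = b then u i else 0)" for b i
  have blk: "blk i \<in> {1..p}" if "i \<in> {1..p}" for i
  proof -
    have "(i - 1) div k \<le> i - 1" by (rule div_le_dividend)
    moreover have "1 \<le> i" "i \<le> p" using that by auto
    ultimately have "(i - 1) div k + 1 \<le> p" by linarith
    then show ?thesis unfolding blk_def by simp
  qed
  have blk_range: "i \<in> {c * k + 1..c * k + k}" if "blk i = c + 1" "i \<ge> 1" for i c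
  proof -
    have "(i - 1) div k = c" using that by (simp add: blk_def)
    then have c: "c * k \<le> i - 1" "i - 1 < c * k + k"
      using k div_times_less_eq_dividend[of "i - 1" k] dividend_less_div_times[of k "i - 1"] by auto
    have "c * k + 1 \<le> i" "i \<le> c * k + k" using c that(2) by linarith+
    then show ?thesis by simp
  qed
  have near: "blk i \<le> blk j + 1" if "i \<in> {1..p}" "j \<in> {1..p}" "\<not> \<bar>int i - int j\<bar> > int k" for i j
  proof -
    have "i - 1 \<le> (j - 1) + k" using that by auto
    then have "(i - 1) div k \<le> ((j - 1) + k) div k" by (rule div_le_mono)
    then show ?thesis using k by (simp add: blk_def)
  qed
  have id: "quad_form p B u = (\<Sum>b\<le>p. quad_form p B (y b)) - (\<Sum>b\<le>p. quad_form p B (z b))"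
  proof -
    have "(\<Sum>b\<le>p. quad_form p B (y b)) - (\<Sum>b\<le>p. quad_form p B (z b)) =
       (\<Sum>i=1..p. \<Sum>j=1..p. ((\<Sum>b\<le>p. of_bool (blk i \<in> {b, b + 1} \<and> blk j \<in> {b, b + 1}))
          - (\<Sum>b\<le>p. of_bool (blk i = b \<and> blk j = b))) * (B i j * u i * u j))"
      unfolding y_def z_def quad_form_restrict sum_sum_swap3 left_diff_distrib sum_subtractf ..
    also have "\<dots> = (\<Sum>i=1..p. \<Sum>j=1..p. B i j * u i * u j)"
    proof (intro sum.cong refl)
      fix i j assume ij: "i \<in> {1..p}" "j \<in> {1..p}"
      show "((\<Sum>b\<le>p. of_bool (blk i \<in> {b, b + 1} \<and> blk j \<in> {b, b + 1}))
          - (\<Sum>b\<le>p. of_bool (blk i = b \<and> blk j = b))) * (B i j * u i * u j) = B i j * u i * u j"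
      proof (cases "\<bar>int i - int j\<bar> > int k")
        case True
        then show ?thesis using band[OF ij] by simp
      next
        case False
        then have "\<not> \<bar>int j - int i\<bar> > int k" by simp
        then have n2: "blk j \<le> blk i + 1" by (rule near[OF ij(2,1)])
        show ?thesis
          unfolding sum_of_bool_window[OF blk[OF ij(1)] blk[OF ij(2)] near[OF ij False] n2] by simp
      qed
    qed
    finally show ?thesis by (simp add: quad_form_eq)
  qed
  have wy: "\<bar>quad_form p B (y b)\<bar> \<le> S * (enorm p (y b))\<^sup>2" for b
  proof (rule win[of "(b - 1) * k + 1"])
    fix i assume i: "i \<in> {1..p}" "i \<notin> {(b - 1) * k + 1..(b - 1) * k + 1 + 2 * k - 1}"
    show "y b i = 0"
    proof (rule ccontr)
      assume "y b i \<noteq> 0"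
      then have "blk i = b \<or> blk i = b + 1" by (auto simp: y_def split: if_splits)
      then show False
      proof
        assume b: "blk i = b"
        then have "b \<ge> 1" using blk[OF i(1)] by auto
        then have "blk i = (b - 1) + 1" using b by simp
        from blk_range[OF this] i show False by auto
      next
        assume b: "blk i = b + 1"
        show False
        proof (cases b)
          case 0
          then show False using blk_range[of i 0] b i by auto
        next
          case (Suc c)
          then show False using blk_range[OF b] i by (auto simp: algebra_simps)
        qed
      qed
    qed
  qed simp
  have wz: "\<bar>quad_form p B (z b)\<bar> \<le> S * (enorm p (z b))\<^sup>2" for b
  proof (rule win[of "(b - 1) * k + 1"])
    fix i assume i: "i \<in> {1..p}" "i \<notin> {(b - 1) * k + 1..(b - 1) * k + 1 + 2 * k - 1}"
    show "z b i = 0"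
    proof (rule ccontr)
      assume "z b i \<noteq> 0"
      then have b: "blk i = b" by (auto simp: z_def split: if_splits)
      then have "b \<ge> 1" using blk[OF i(1)] by auto
      then have "blk i = (b - 1) + 1" using b by simp
      from blk_range[OF this] i show False by auto
    qed
  qed simp
  have ny: "(\<Sum>b\<le>p. (enorm p (y b))\<^sup>2) = 2 * (enorm p u)\<^sup>2"
  proof -
    have "(\<Sum>b\<le>p. (enorm p (y b))\<^sup>2) = (\<Sum>i=1..p. \<Sum>b\<le>p. (y b i)\<^sup>2)"
      unfolding enorm_power2 by (rule sum.swap)
    also have "\<dots> = (\<Sum>i=1..p. 2 * (u i)\<^sup>2)"
    proof (rule sum.cong[OF refl])
      fix i assume i: "i \<in> {1..p}"
      have "(\<Sum>b\<le>p. (y b i)\<^sup>2) = (\<Sum>b\<le>p. (if b = blk i then (u i)\<^sup>2 else 0) + (if b = blk i - 1 then (u i)\<^sup>2 else 0))"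
        by (rule sum.cong) (use blk[OF i] in \<open>auto simp: y_def\<close>)
      also have "\<dots> = 2 * (u i)\<^sup>2" using blk[OF i] by (auto simp: sum.distrib)
      finally show "(\<Sum>b\<le>p. (y b i)\<^sup>2) = 2 * (u i)\<^sup>2" .
    qed
    finally show ?thesis by (simp add: enorm_power2 sum_distrib_left)
  qed
  have nz: "(\<Sum>b\<le>p. (enorm p (z b))\<^sup>2) = (enorm p u)\<^sup>2"
  proof -
    have "(\<Sum>b\<le>p. (enorm p (z b))\<^sup>2) = (\<Sum>i=1..p. \<Sum>b\<le>p. (z b i)\<^sup>2)"
      unfolding enorm_power2 by (rule sum.swap)
    also have "\<dots> = (\<Sum>i=1..p. (u i)\<^sup>2)"
    proof (rule sum.cong[OF refl])
      fix i assume i: "i \<in> {1..p}"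
      have "(\<Sum>b\<le>p. (z b i)\<^sup>2) = (\<Sum>b\<le>p. if b = blk i then (u i)\<^sup>2 else 0)"
        by (rule sum.cong) (auto simp: z_def)
      also have "\<dots> = (u i)\<^sup>2" using blk[OF i] by auto
      finally show "(\<Sum>b\<le>p. (z b i)\<^sup>2) = (u i)\<^sup>2" .
    qed
    finally show ?thesis by (simp add: enorm_power2)
  qed
  have "\<bar>quad_form p B u\<bar> \<le> (\<Sum>b\<le>p. \<bar>quad_form p B (y b)\<bar>) + (\<Sum>b\<le>p. \<bar>quad_form p B (z b)\<bar>)"
    unfolding id by (intro order.trans[OF abs_triangle_ineq4] add_mono sum_abs)
  also have "\<dots> \<le> (\<Sum>b\<le>p. S * (enorm p (y b))\<^sup>2) + (\<Sum>b\<le>p. S * (enorm p (z b))\<^sup>2)"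
    by (intro add_mono sum_mono wy wz)
  also have "\<dots> = 3 * S * (enorm p u)\<^sup>2" unfolding sum_distrib_left[symmetric] ny nz by simp
  finally show ?thesis .
qed

definition truncate :: "nat \<Rightarrow> matrix \<Rightarrow> matrix" where
  "truncate k \<Gamma> i j = (if \<bar>int i - int j\<bar> > int k then 0 else \<Gamma> i j)"

text \<open>Schur's test: \<open>\<bar>u i * u j\<bar> \<le> ((u i)\<^sup>2 + (u j)\<^sup>2) / 2\<close> and symmetry reduce the form of the removed part to its
column sums.\<close>

lemma truncation_quad_form_bound:
  assumes sym: "\<And>i j. i \<in> {1..p} \<Longrightarrow> j \<in> {1..p} \<Longrightarrow> \<Gamma> i j = \<Gamma> j i"
    and row: "\<And>j. j \<in> {1..p} \<Longrightarrow> (\<Sum>i\<in>{i\<in>{1..p}. \<bar>int i - int j\<bar> > int k}. \<bar>\<Gamma> i j\<bar>) \<le> r"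
  shows "\<bar>quad_form p \<Gamma> u - quad_form p (truncate k \<Gamma>) u\<bar> \<le> r * (enorm p u)\<^sup>2"
proof -
  define D where "D i j = (if \<bar>int i - int j\<bar> > int k then \<bar>\<Gamma> i j\<bar> else 0)" for i j
  have col: "(\<Sum>i=1..p. D i j) \<le> r" if "j \<in> {1..p}" for j
  proof -
    have "(\<Sum>i=1..p. D i j) = (\<Sum>i\<in>{i\<in>{1..p}. \<bar>int i - int j\<bar> > int k}. \<bar>\<Gamma> i j\<bar>)"
      unfolding D_def by (rule sum.inter_filter[symmetric]) simp
    then show ?thesis using row[OF that] by simp
  qed
  have Dsym: "D i j = D j i" if "i \<in> {1..p}" "j \<in> {1..p}" for i j
    using sym[OF that] by (simp add: D_def abs_minus_commute)
  have "\<bar>quad_form p \<Gamma> u - quad_form p (truncate k \<Gamma>) u\<bar>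
      = \<bar>\<Sum>i=1..p. \<Sum>j=1..p. (\<Gamma> i j - truncate k \<Gamma> i j) * u i * u j\<bar>"
    by (simp add: quad_form_eq left_diff_distrib sum_subtractf)
  also have "\<dots> \<le> (\<Sum>i=1..p. \<Sum>j=1..p. D i j * ((u i)\<^sup>2 / 2 + (u j)\<^sup>2 / 2))"
  proof (intro order.trans[OF sum_abs] sum_mono)
    fix i j
    have "\<bar>(\<Gamma> i j - truncate k \<Gamma> i j) * u i * u j\<bar> = D i j * (\<bar>u i\<bar> * \<bar>u j\<bar>)"
      by (simp add: D_def truncate_def abs_mult)
    also have "\<dots> \<le> D i j * ((u i)\<^sup>2 / 2 + (u j)\<^sup>2 / 2)"
    proof (rule mult_left_mono)
      show "\<bar>u i\<bar> * \<bar>u j\<bar> \<le> (u i)\<^sup>2 / 2 + (u j)\<^sup>2 / 2"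
        using sum_squares_bound[of "\<bar>u i\<bar>" "\<bar>u j\<bar>"] by simp
    qed (simp add: D_def)
    finally show "\<bar>(\<Gamma> i j - truncate k \<Gamma> i j) * u i * u j\<bar> \<le> D i j * ((u i)\<^sup>2 / 2 + (u j)\<^sup>2 / 2)" .
  qed
  also have "\<dots> = (\<Sum>i=1..p. \<Sum>j=1..p. D i j * (u i)\<^sup>2) / 2 + (\<Sum>i=1..p. \<Sum>j=1..p. D i j * (u j)\<^sup>2) / 2"
    by (simp add: distrib_left sum.distrib sum_divide_distrib)
  also have "(\<Sum>i=1..p. \<Sum>j=1..p. D i j * (u i)\<^sup>2) = (\<Sum>i=1..p. \<Sum>j=1..p. D j i * (u i)\<^sup>2)"
    by (intro sum.cong refl) (simp add: Dsym)
  also have "(\<Sum>i=1..p. \<Sum>j=1..p. D i j * (u j)\<^sup>2) = (\<Sum>j=1..p. \<Sum>i=1..p. D i j * (u j)\<^sup>2)" by (rule sum.swap)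
  also have "(\<Sum>i=1..p. \<Sum>j=1..p. D j i * (u i)\<^sup>2) / 2 + (\<Sum>j=1..p. \<Sum>i=1..p. D i j * (u j)\<^sup>2) / 2
      = (\<Sum>j=1..p. (\<Sum>i=1..p. D i j) * (u j)\<^sup>2)" by (simp add: sum_distrib_right)
  also have "\<dots> \<le> (\<Sum>j=1..p. r * (u j)\<^sup>2)" by (intro sum_mono mult_right_mono col) auto
  finally show ?thesis by (simp add: enorm_power2 sum_distrib_left)
qed

section \<open>Volumes of double cones in space\<close>

text \<open>The third coordinate comes first, so that the volume of a body is the integral over the height of
the areas of its horizontal sections.\<close>

definition vec3 :: "real \<times> real \<times> real \<Rightarrow> real ^ 3" where
  "vec3 q = (\<chi> i. if i = 1 then fst (snd q) else if i = 2 then snd (snd q) else fst q)"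

lemma vec3_nth [simp]: "vec3 (t, x, y) $ 1 = x" "vec3 (t, x, y) $ 2 = y" "vec3 (t, x, y) $ 3 = t"
  by (simp_all add: vec3_def)

lemma vec3_measurable [measurable]: "vec3 \<in> borel_measurable borel"
proof (rule borel_measurable_continuous_onI)
  have "continuous_on UNIV (\<lambda>q :: real \<times> real \<times> real. if i = 1 then fst (snd q) else if i = 2 then snd (snd q) else fst q)" for i :: 3
    by (cases "i = 1"; cases "i = 2"; simp; intro continuous_intros)
  then show "continuous_on UNIV vec3"
    unfolding vec3_def[abs_def] by (rule continuous_on_vec_lambda)
qed

lemma lborel_vec3: "distr lborel borel vec3 = (lborel :: (real ^ 3) measure)"
proof (rule lborel_eqI[symmetric])
  fix l u :: "real ^ 3" assume le: "\<And>b. b \<in> Basis \<Longrightarrow> l \<bullet> b \<le> u \<bullet> b"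
  have lu: "l $ i \<le> u $ i" for i
    using le[of "axis i 1"] by (simp add: inner_axis)
  have "vec3 -` box l u = {l $ 3<..<u $ 3} \<times> {l $ 1<..<u $ 1} \<times> {l $ 2<..<u $ 2}"
    by (auto simp: mem_box_cart forall_3)
  then have "emeasure (distr lborel borel vec3) (box l u)
      = emeasure (lborel \<Otimes>\<^sub>M (lborel \<Otimes>\<^sub>M lborel)) ({l $ 3<..<u $ 3} \<times> {l $ 1<..<u $ 1} \<times> {l $ 2<..<u $ 2})"
    by (subst emeasure_distr) (simp_all add: lborel_prod)
  also have "\<dots> = ennreal (u $ 3 - l $ 3) * (ennreal (u $ 1 - l $ 1) * ennreal (u $ 2 - l $ 2))"
  proof -
    have "emeasure (lborel \<Otimes>\<^sub>M lborel) ({l $ 1<..<u $ 1} \<times> {l $ 2<..<u $ 2})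
        = ennreal (u $ 1 - l $ 1) * ennreal (u $ 2 - l $ 2)"
      using lu[of 1] lu[of 2] by (subst lborel.emeasure_pair_measure_Times) auto
    then have "emeasure lborel ({l $ 1<..<u $ 1} \<times> {l $ 2<..<u $ 2}) = ennreal (u $ 1 - l $ 1) * ennreal (u $ 2 - l $ 2)"
      by (simp only: lborel_prod)
    moreover have "emeasure (lborel \<Otimes>\<^sub>M lborel) ({l $ 3<..<u $ 3} \<times> {l $ 1<..<u $ 1} \<times> {l $ 2<..<u $ 2})
        = emeasure lborel {l $ 3<..<u $ 3} * emeasure lborel ({l $ 1<..<u $ 1} \<times> {l $ 2<..<u $ 2})"
      by (rule lborel.emeasure_pair_measure_Times) (auto intro: borel_Times)
    ultimately show ?thesis using lu[of 3] by (simp only: lborel_prod emeasure_lborel_Ioo)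
  qed
  also have "\<dots> = ennreal (\<Prod>b\<in>Basis. (u - l) \<bullet> b)"
  proof -
    have B: "(Basis :: (real ^ 3) set) = (\<lambda>i. axis i 1) ` UNIV" by (auto simp: Basis_vec_def)
    have inj: "inj (\<lambda>i :: 3. axis i (1 :: real))" by (auto simp: inj_def axis_eq_axis)
    have "(\<Prod>b\<in>Basis. (u - l) \<bullet> b) = (\<Prod>b\<in>(\<lambda>i. axis i 1) ` (UNIV :: 3 set). (u - l) \<bullet> b)"
      by (rule prod.cong[OF B refl])
    also have "\<dots> = (\<Prod>i\<in>UNIV. (u - l) \<bullet> axis i 1)" using prod.reindex[OF inj] by simp
    also have "\<dots> = (\<Prod>i\<in>UNIV. u $ i - l $ i)" by (simp add: inner_axis)
    also have "\<dots> = (u $ 1 - l $ 1) * ((u $ 2 - l $ 2) * (u $ 3 - l $ 3))"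
      unfolding UNIV_3 by simp
    also have "\<dots> = (u $ 3 - l $ 3) * ((u $ 1 - l $ 1) * (u $ 2 - l $ 2))"
      by (simp only: mult_ac)
    finally have prod: "(\<Prod>b\<in>Basis. (u - l) \<bullet> b) = (u $ 3 - l $ 3) * ((u $ 1 - l $ 1) * (u $ 2 - l $ 2))" .
    have "0 \<le> u $ 1 - l $ 1" "0 \<le> u $ 2 - l $ 2" "0 \<le> u $ 3 - l $ 3"
      using lu[of 1] lu[of 2] lu[of 3] by simp_all
    then show ?thesis unfolding prod by (simp only: ennreal_mult mult_nonneg_nonneg)
  qed
  finally show "emeasure (distr lborel borel vec3) (box l u) = ennreal (\<Prod>b\<in>Basis. (u - l) \<bullet> b)" .
qed simp

lemma annulus_area:
  assumes "0 \<le> r" "r \<le> R"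
  shows "emeasure lborel (ball (0 :: real \<times> real) R - ball 0 r) = ennreal (pi * (R\<^sup>2 - r\<^sup>2))"
proof -
  have e: "emeasure lborel (ball (0 :: real \<times> real) q) = ennreal (pi * q\<^sup>2)" if "q \<ge> 0" for q
    using emeasure_ball[OF that, of "0 :: real \<times> real"] by (simp add: eval_unit_ball_vol power2_eq_square)
  have "emeasure lborel (ball (0 :: real \<times> real) R - ball 0 r)
      = emeasure lborel (ball (0 :: real \<times> real) R) - emeasure lborel (ball (0 :: real \<times> real) r)"
    by (rule emeasure_Diff) (use assms e[of r] in \<open>auto\<close>)
  also have "\<dots> = ennreal (pi * R\<^sup>2) - ennreal (pi * r\<^sup>2)" using e assms by simp
  also have "\<dots> = ennreal (pi * (R\<^sup>2 - r\<^sup>2))" by (simp add: ennreal_minus right_diff_distrib)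
  finally show ?thesis .
qed

lemma norm_vec3: "(norm (v :: real ^ 3))\<^sup>2 = (v $ 1)\<^sup>2 + (v $ 2)\<^sup>2 + (v $ 3)\<^sup>2"
proof -
  have "(norm v)\<^sup>2 = (\<Sum>i\<in>UNIV. (v $ i)\<^sup>2)" by (simp add: norm_vec_def L2_set_def sum_nonneg)
  then show ?thesis by (simp only: sum_3)
qed

text \<open>For unit vectors, the condition says that the height times \<open>\<rho>\<close> lies between \<open>a\<close> and \<open>b\<close>. The section at
height \<open>t\<close> is contained in an annulus of area \<open>\<pi> * t\<^sup>2 * (\<rho>\<^sup>2 / a\<^sup>2 - m)\<close>, where \<open>m\<close> records the inner
radius, and the section is empty unless \<open>t\<^sup>2 * m \<le> 1\<close>. Both facts together bound the area
uniformly in \<open>\<rho>\<close>, which is Archimedes' theorem up to constants.\<close>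

lemma axis_cone_volume:
  assumes a: "0 < a" and ab: "a < b" and \<rho>: "0 \<le> \<rho>"
  shows "emeasure lborel {v :: real ^ 3. norm v < 1 \<and> a * norm v < \<rho> * \<bar>v $ 3\<bar> \<and> \<rho> * \<bar>v $ 3\<bar> \<le> b * norm v}
     \<le> ennreal (2 * pi * (b\<^sup>2 / a\<^sup>2 - 1))" (is "emeasure lborel ?T \<le> _")
proof (cases "\<rho> \<le> a")
  case True
  have "\<rho> * \<bar>v $ 3\<bar> \<le> a * norm v" for v :: "real ^ 3"
    using True \<rho> component_le_norm_cart[of v 3] a by (intro mult_mono) auto
  then have empty: "?T = {}" by (auto simp: not_less)
  show ?thesis unfolding empty by simp
next
  case False
  \<comment> \<open>The inner radius of the section at height \<open>t\<close> is \<open>\<bar>t\<bar> * sqrt (m - 1)\<close>, which vanishes if \<open>\<rho> \<le> b\<close>.\<close>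
  define m where "m = max 1 (\<rho>\<^sup>2 / b\<^sup>2)"
  have b: "b > 0" using a ab by simp
  have ab2: "a\<^sup>2 < b\<^sup>2" using a ab by (simp add: power_strict_mono)
  have a\<rho>: "a\<^sup>2 < \<rho>\<^sup>2" using a False by (simp add: power_strict_mono)
  have m: "m \<ge> 1" "m \<ge> \<rho>\<^sup>2 / b\<^sup>2" "m \<le> \<rho>\<^sup>2 / a\<^sup>2"
  proof -
    have "1 \<le> \<rho>\<^sup>2 / a\<^sup>2" using a\<rho> a by (simp add: le_divide_eq)
    moreover have "\<rho>\<^sup>2 / b\<^sup>2 \<le> \<rho>\<^sup>2 / a\<^sup>2" using ab ab2 a b by (intro divide_left_mono) auto
    ultimately show "m \<le> \<rho>\<^sup>2 / a\<^sup>2" by (simp add: m_def)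
  qed (simp_all add: m_def)
  define A where "A t = ball (0 :: real \<times> real) (\<bar>t\<bar> * sqrt (\<rho>\<^sup>2 / a\<^sup>2 - 1)) - ball 0 (\<bar>t\<bar> * sqrt (m - 1))" for t
  have Tm: "?T \<in> sets borel"
    unfolding Collect_conj_eq
    by (rule sets.Int[OF borel_open[OF open_Collect_less] sets.Int[OF borel_open[OF open_Collect_less]
          borel_closed[OF closed_Collect_le]]]; intro continuous_intros)
  have slice: "emeasure lborel (Pair t -` (vec3 -` ?T)) \<le> ennreal (pi * (b\<^sup>2 / a\<^sup>2 - 1)) * indicator {-1..1} t" for t
  proof -
    have *: "w \<in> A t \<and> t\<^sup>2 * m \<le> 1" if w: "vec3 (t, w) \<in> ?T" for w
    proof -
      obtain x y where xy: "w = (x, y)" by (cases w)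
      let ?v = "vec3 (t, w)"
      have n2: "(norm ?v)\<^sup>2 = (norm w)\<^sup>2 + t\<^sup>2" by (simp add: norm_vec3 xy norm_Pair)
      have 1: "norm ?v < 1" "a * norm ?v < \<rho> * \<bar>t\<bar>" "\<rho> * \<bar>t\<bar> \<le> b * norm ?v" using w by (auto simp: xy)
      have "(a * norm ?v)\<^sup>2 < (\<rho> * \<bar>t\<bar>)\<^sup>2" using 1(2) a by (intro power_strict_mono) auto
      then have 2: "a\<^sup>2 * ((norm w)\<^sup>2 + t\<^sup>2) < \<rho>\<^sup>2 * t\<^sup>2" by (simp add: power_mult_distrib n2)
      have "(\<rho> * \<bar>t\<bar>)\<^sup>2 \<le> (b * norm ?v)\<^sup>2" using 1(3) \<rho> by (intro power_mono) auto
      then have 3: "\<rho>\<^sup>2 * t\<^sup>2 \<le> b\<^sup>2 * ((norm w)\<^sup>2 + t\<^sup>2)" by (simp add: power_mult_distrib n2)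
      have 4: "(norm w)\<^sup>2 + t\<^sup>2 < 1" using 1(1) abs_square_less_1[of "norm ?v"] by (simp add: n2)
      have "(norm w)\<^sup>2 + t\<^sup>2 < \<rho>\<^sup>2 * t\<^sup>2 / a\<^sup>2" using 2 a by (simp add: pos_less_divide_eq mult.commute)
      then have "(norm w)\<^sup>2 < t\<^sup>2 * (\<rho>\<^sup>2 / a\<^sup>2 - 1)" by (simp add: right_diff_distrib mult.commute)
      then have "sqrt ((norm w)\<^sup>2) < sqrt (t\<^sup>2 * (\<rho>\<^sup>2 / a\<^sup>2 - 1))" by (rule real_sqrt_less_mono)
      then have 5: "norm w < \<bar>t\<bar> * sqrt (\<rho>\<^sup>2 / a\<^sup>2 - 1)" by (simp add: real_sqrt_mult)
      have "t\<^sup>2 * (m - 1) \<le> (norm w)\<^sup>2"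
      proof (cases "\<rho>\<^sup>2 / b\<^sup>2 \<le> 1")
        case True
        then have "m = 1" by (simp add: m_def max_def)
        then show ?thesis by simp
      next
        case False
        then have "m = \<rho>\<^sup>2 / b\<^sup>2" by (simp add: m_def max_def)
        moreover have "\<rho>\<^sup>2 * t\<^sup>2 / b\<^sup>2 \<le> (norm w)\<^sup>2 + t\<^sup>2" using 3 b by (simp add: pos_divide_le_eq mult.commute)
        ultimately show ?thesis by (simp add: right_diff_distrib mult.commute)
      qed
      then have "sqrt (t\<^sup>2 * (m - 1)) \<le> sqrt ((norm w)\<^sup>2)" by (rule real_sqrt_le_mono)
      then have 6: "\<bar>t\<bar> * sqrt (m - 1) \<le> norm w" by (simp add: real_sqrt_mult)
      have "t\<^sup>2 * m = t\<^sup>2 * (m - 1) + t\<^sup>2" by (simp add: algebra_simps)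
      then have "t\<^sup>2 * m \<le> 1" using \<open>t\<^sup>2 * (m - 1) \<le> (norm w)\<^sup>2\<close> 4 by linarith
      then show ?thesis using 5 6 by (simp add: A_def)
    qed
    show ?thesis
    proof (cases "t\<^sup>2 * m \<le> 1")
      case False
      then have empty: "Pair t -` (vec3 -` ?T) = {}" using * by blast
      show ?thesis unfolding empty by simp
    next
      case True
      have "t\<^sup>2 * 1 \<le> t\<^sup>2 * m" using m by (intro mult_left_mono) auto
      then have "t\<^sup>2 \<le> 1" using True by linarith
      then have t1: "t \<in> {-1..1}" by (simp add: abs_square_le_1 abs_le_iff)
      have "emeasure lborel (Pair t -` (vec3 -` ?T)) \<le> emeasure lborel (A t)"
      proof (rule emeasure_mono)
        show "Pair t -` (vec3 -` ?T) \<subseteq> A t" using * by blast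
      qed (simp add: A_def)
      also have "\<dots> = ennreal (pi * ((\<bar>t\<bar> * sqrt (\<rho>\<^sup>2 / a\<^sup>2 - 1))\<^sup>2 - (\<bar>t\<bar> * sqrt (m - 1))\<^sup>2))"
        unfolding A_def by (rule annulus_area) (use m in \<open>auto intro!: mult_left_mono\<close>)
      also have "(\<bar>t\<bar> * sqrt (\<rho>\<^sup>2 / a\<^sup>2 - 1))\<^sup>2 - (\<bar>t\<bar> * sqrt (m - 1))\<^sup>2 = t\<^sup>2 * (\<rho>\<^sup>2 / a\<^sup>2 - m)"
        using m by (simp add: power_mult_distrib algebra_simps)
      also have "ennreal (pi * (t\<^sup>2 * (\<rho>\<^sup>2 / a\<^sup>2 - m))) \<le> ennreal (pi * (b\<^sup>2 / a\<^sup>2 - 1))"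
      proof (intro ennreal_leI mult_left_mono)
        \<comment> \<open>The bound on the area: \<open>t\<^sup>2 * (\<rho>\<^sup>2 / a\<^sup>2 - m) \<le> t\<^sup>2 * m * (b\<^sup>2 / a\<^sup>2 - 1)\<close> and \<open>t\<^sup>2 * m \<le> 1\<close>.\<close>
        have "\<rho>\<^sup>2 / a\<^sup>2 = (\<rho>\<^sup>2 / b\<^sup>2) * (b\<^sup>2 / a\<^sup>2)" using b by simp
        also have "\<dots> \<le> m * (b\<^sup>2 / a\<^sup>2)" using m by (intro mult_right_mono) auto
        finally have "\<rho>\<^sup>2 / a\<^sup>2 - m \<le> m * (b\<^sup>2 / a\<^sup>2 - 1)" by (simp add: algebra_simps)
        then have "t\<^sup>2 * (\<rho>\<^sup>2 / a\<^sup>2 - m) \<le> t\<^sup>2 * (m * (b\<^sup>2 / a\<^sup>2 - 1))" by (intro mult_left_mono) auto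
        also have "\<dots> = t\<^sup>2 * m * (b\<^sup>2 / a\<^sup>2 - 1)" by simp
        also have "\<dots> \<le> 1 * (b\<^sup>2 / a\<^sup>2 - 1)" using True ab2 a by (intro mult_right_mono) auto
        finally show "t\<^sup>2 * (\<rho>\<^sup>2 / a\<^sup>2 - m) \<le> b\<^sup>2 / a\<^sup>2 - 1" by simp
      qed simp
      finally show ?thesis using t1 by simp
    qed
  qed
  have "emeasure lborel ?T = emeasure (distr lborel borel vec3) ?T" by (simp only: lborel_vec3)
  also have "\<dots> = emeasure (lborel \<Otimes>\<^sub>M lborel) (vec3 -` ?T)"
    by (subst emeasure_distr) (use Tm in \<open>simp_all add: lborel_prod\<close>)
  also have "\<dots> = (\<integral>\<^sup>+t. emeasure lborel (Pair t -` (vec3 -` ?T)) \<partial>lborel)"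
  proof (rule lborel.emeasure_pair_measure_alt)
    have "vec3 -` ?T \<inter> space borel \<in> sets borel" using vec3_measurable Tm by (rule measurable_sets)
    moreover have "sets (lborel \<Otimes>\<^sub>M lborel :: (real \<times> real \<times> real) measure) = sets borel"
      by (simp only: lborel_prod sets_lborel)
    ultimately show "vec3 -` ?T \<in> sets (lborel \<Otimes>\<^sub>M lborel)" by (simp only: space_borel Int_UNIV_right)
  qed
  also have "\<dots> \<le> (\<integral>\<^sup>+t. ennreal (pi * (b\<^sup>2 / a\<^sup>2 - 1)) * indicator {-1..1::real} t \<partial>lborel)"
    by (intro nn_integral_mono slice)
  also have "\<dots> = ennreal (pi * (b\<^sup>2 / a\<^sup>2 - 1)) * 2" by (simp add: nn_integral_cmult_indicator)
  also have "\<dots> = ennreal (2 * pi * (b\<^sup>2 / a\<^sup>2 - 1))"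
    using ab2 a by (simp add: ennreal_mult'[symmetric] mult_ac flip: ennreal_numeral)
  finally show ?thesis .
qed

text \<open>A rotation moves \<open>x\<close> to the third axis.\<close>

lemma cone_volume:
  fixes x :: "real ^ 3"
  assumes a: "0 < a" and ab: "a < b"
  shows "emeasure lborel {v. norm v < 1 \<and> a * norm v < \<bar>v \<bullet> x\<bar> \<and> \<bar>v \<bullet> x\<bar> \<le> b * norm v}
     \<le> ennreal (2 * pi * (b\<^sup>2 / a\<^sup>2 - 1))"
proof -
  define y :: "real ^ 3" where "y = norm x *\<^sub>R axis 3 1"
  have "norm x = norm y" by (simp add: y_def norm_axis_1)
  then obtain f where f: "orthogonal_transformation f" "f x = y" by (rule orthogonal_transformation_exists)
  define S where "S = {v. norm v < 1 \<and> a * norm v < \<bar>v \<bullet> x\<bar> \<and> \<bar>v \<bullet> x\<bar> \<le> b * norm v}"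
  define T where "T = {v :: real ^ 3. norm v < 1 \<and> a * norm v < norm x * \<bar>v $ 3\<bar> \<and> norm x * \<bar>v $ 3\<bar> \<le> b * norm v}"
  have Sm: "S \<in> sets borel" unfolding S_def Collect_conj_eq
    by (rule sets.Int[OF borel_open[OF open_Collect_less] sets.Int[OF borel_open[OF open_Collect_less]
          borel_closed[OF closed_Collect_le]]]; intro continuous_intros)
  have Tm: "T \<in> sets borel" unfolding T_def Collect_conj_eq
    by (rule sets.Int[OF borel_open[OF open_Collect_less] sets.Int[OF borel_open[OF open_Collect_less]
          borel_closed[OF closed_Collect_le]]]; intro continuous_intros)
  have lm: "Z \<in> lmeasurable" if "Z \<subseteq> ball 0 1" "Z \<in> sets borel" for Z :: "(real ^ 3) set"
    by (rule bounded_set_imp_lmeasurable[OF bounded_subset[OF bounded_ball that(1)]]) (use that(2) in simp)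
  have bS: "S \<in> lmeasurable" by (rule lm[OF _ Sm]) (auto simp: S_def)
  have bT: "T \<in> lmeasurable" by (rule lm[OF _ Tm]) (auto simp: T_def)
  have fn: "norm (f v) = norm v" for v using f(1) by (simp add: orthogonal_transformation_norm)
  have fi: "\<bar>v \<bullet> x\<bar> = norm x * \<bar>f v $ 3\<bar>" for v
  proof -
    have "v \<bullet> x = f v \<bullet> f x" using f(1) by (simp add: orthogonal_transformation_def)
    also have "\<dots> = f v $ 3 * norm x" by (simp add: f(2) y_def inner_axis)
    finally show ?thesis by (simp add: abs_mult)
  qed
  have memf: "f v \<in> T \<longleftrightarrow> v \<in> S" for v unfolding S_def T_def by (simp add: fn fi)
  have img: "f ` S = T"
  proof (intro set_eqI iffI)
    fix w assume w: "w \<in> T"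
    obtain v where "w = f v" using orthogonal_transformation_surj[OF f(1)] by (meson surjD)
    then show "w \<in> f ` S" using w memf by blast
  qed (use memf in blast)
  have "emeasure lborel S = emeasure lebesgue S" using Sm by simp
  also have "\<dots> = ennreal (measure lebesgue S)" using bS by (rule emeasure_eq_measure2)
  also have "measure lebesgue S = measure lebesgue T"
    using measure_orthogonal_image[OF f(1) bS] by (simp only: img)
  also have "ennreal \<dots> = emeasure lebesgue T" using bT by (rule emeasure_eq_measure2[symmetric])
  also have "\<dots> = emeasure lborel T" using Tm by simp
  also have "\<dots> \<le> ennreal (2 * pi * (b\<^sup>2 / a\<^sup>2 - 1))"
    unfolding T_def by (rule axis_cone_volume[OF a ab]) simp
  finally show ?thesis by (simp only: S_def)
qed

section \<open>Lipschitz continuity of elliptical marginals\<close>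

lemma bilin_quad: "bilin p B u u = quad_form p B u"
  by (simp add: bilin_def quad_form_eq)

text \<open>Fewer than \<open>p\<close> orthogonality conditions have a nonzero common solution, which positive definiteness
allows to normalize.\<close>

lemma orthonormal_extension:
  assumes pd: "\<And>u. \<exists>i\<in>{1..p}. u i \<noteq> 0 \<Longrightarrow> quad_form p B u > 0" and F: "finite F" "card F < p"
  shows "\<exists>w. quad_form p B w = 1 \<and> (\<forall>f\<in>F. bilin p B f w = 0)"
proof -
  have "card F < card {1..p}" using F by simp
  from homogeneous_system_nontrivial[OF F(1) _ this, of "\<lambda>f j. \<Sum>i=1..p. B i j * f i"]
  obtain c where c: "(\<exists>j\<in>{1..p}. c j \<noteq> 0) \<and> (\<forall>f\<in>F. (\<Sum>j=1..p. (\<Sum>i=1..p. B i j * f i) * c j) = 0)" by blast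
  define q where "q = quad_form p B c"
  have q: "q > 0" unfolding q_def using pd c by blast
  define w where "w j = 1 / sqrt q * c j" for j
  have "quad_form p B w = (1 / sqrt q)\<^sup>2 * q"
    unfolding w_def[abs_def] quad_form_scale q_def ..
  then have "quad_form p B w = 1" using q by (simp add: power_divide)
  moreover have "bilin p B f w = 0" if "f \<in> F" for f
  proof -
    have "bilin p B f w = (\<Sum>j=1..p. (\<Sum>i=1..p. B i j * f i) * w j)"
      unfolding bilin_def sum_distrib_right by (rule sum.swap)
    also have "\<dots> = 1 / sqrt q * (\<Sum>j=1..p. (\<Sum>i=1..p. B i j * f i) * c j)"
      by (simp add: w_def sum_distrib_left mult_ac)
    also have "\<dots> = 0" using c that by simp
    finally show ?thesis .
  qed
  ultimately show ?thesis by blast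
qed

lemma orthonormal_triple:
  assumes sym: "\<And>i j. i \<in> {1..p} \<Longrightarrow> j \<in> {1..p} \<Longrightarrow> B i j = B j i"
    and pd: "\<And>u. \<exists>i\<in>{1..p}. u i \<noteq> 0 \<Longrightarrow> quad_form p B u > 0" and p: "p \<ge> 3"
  shows "\<exists>f :: 3 \<Rightarrow> vector. \<forall>i j. bilin p B (f i) (f j) = (if i = j then 1 else 0)"
proof -
  obtain f1 where f1: "quad_form p B f1 = 1" using orthonormal_extension[OF pd, of "{}"] p by auto
  obtain f2 where f2: "quad_form p B f2 = 1" "bilin p B f1 f2 = 0"
    using orthonormal_extension[OF pd, of "{f1}"] p by auto
  have "card {f1, f2} < p" using p card_insert_le_m1[of 2 "{f2}" f1] by (simp add: card_insert_if)
  then obtain f3 where f3: "quad_form p B f3 = 1" "bilin p B f1 f3 = 0" "bilin p B f2 f3 = 0"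
    using orthonormal_extension[OF pd, of "{f1, f2}"] by auto
  have s: "bilin p B f2 f1 = 0" "bilin p B f3 f1 = 0" "bilin p B f3 f2 = 0"
    using f2(2) f3(2,3) bilin_sym[of p B] sym by auto
  define f :: "3 \<Rightarrow> vector" where "f i = (if i = 1 then f1 else if i = 2 then f2 else f3)" for i
  have "\<forall>i j. bilin p B (f i) (f j) = (if i = j then 1 else 0)"
    unfolding forall_3 f_def by (simp add: f1 f2 f3 s bilin_quad)
  then show ?thesis by blast
qed

lemma quad_form_combination:
  fixes v :: "real ^ 3"
  assumes "\<And>i j. bilin p B (f i) (f j) = (if i = j then 1 else 0)"
  shows "quad_form p B (\<lambda>l. \<Sum>m\<in>UNIV. v $ m * f m l) = (norm v)\<^sup>2"
proof -
  have "quad_form p B (\<lambda>l. \<Sum>m\<in>UNIV. v $ m * f m l)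
      = (\<Sum>i=1..p. \<Sum>j=1..p. \<Sum>m\<in>UNIV. \<Sum>m'\<in>UNIV. v $ m * v $ m' * (B i j * f m i * f m' j))"
    by (simp add: quad_form_eq sum_distrib_left sum_distrib_right mult_ac)
  also have "\<dots> = (\<Sum>m\<in>UNIV. \<Sum>m'\<in>UNIV. v $ m * v $ m' * bilin p B (f m) (f m'))"
    unfolding bilin_def sum_distrib_left
    by (simp only: sum.swap[of _ UNIV "{1..p}"])
  also have "\<dots> = (\<Sum>m\<in>UNIV. (v $ m)\<^sup>2)"
    by (simp add: assms power2_eq_square if_distrib cong: if_cong)
  also have "\<dots> = (norm v)\<^sup>2" by (simp add: norm_vec_def L2_set_def sum_nonneg)
  finally show ?thesis .
qed

text \<open>Let \<open>f\<close> be a triple that is orthonormal for \<open>\<Gamma>\<close>. For every nonzero \<open>v\<close> in the three-dimensional unit ball the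
mass \<open>G t - G s\<close> is the probability that \<open>\<bar>v \<bullet> x\<^sub>3\<bar> / norm v\<close> lies between \<open>sqrt s\<close> and
\<open>sqrt t\<close>, where \<open>x\<^sub>3\<close> collects the three marginals \<open>f\<^sub>m\<^sup>T x\<close>; it does not depend on \<open>v\<close>. Integrating over
the ball and exchanging the integrals, one only needs, for each fixed \<open>x\<close>, the volume of the set of
such \<open>v\<close>, which \<open>cone_volume\<close> bounds by \<open>2 * \<pi> * (t - s) / s\<close>. Division by the volume
\<open>4 / 3 * \<pi>\<close> of the ball gives the constant.\<close>

lemma marginal_cdf_lipschitz:
  assumes P: "elliptical p \<Gamma> \<eta> P" "prob_space P" "sets P = sets (Rn p)"
    and sym: "\<And>i j. i \<in> {1..p} \<Longrightarrow> j \<in> {1..p} \<Longrightarrow> \<Gamma> i j = \<Gamma> j i"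
    and pd: "\<And>u. \<exists>i\<in>{1..p}. u i \<noteq> 0 \<Longrightarrow> quad_form p \<Gamma> u > 0" and p: "p \<ge> 3"
    and s: "0 < s" and st: "s < t" and u: "quad_form p \<Gamma> u > 0"
  shows "marginal_cdf p P \<Gamma> u t - marginal_cdf p P \<Gamma> u s \<le> 3 / 2 * ((t - s) / s)"
proof -
  interpret P: prob_space P by fact
  interpret PL: pair_sigma_finite P "lborel :: (real ^ 3) measure" by unfold_locales
  obtain f :: "3 \<Rightarrow> vector" where f: "\<And>i j. bilin p \<Gamma> (f i) (f j) = (if i = j then 1 else 0)"
    using orthonormal_triple[OF sym pd p] by blast
  define a b where "a = sqrt s" and "b = sqrt t"
  have a: "0 < a" "a < b" "b\<^sup>2 / a\<^sup>2 - 1 = (t - s) / s" using s st by (auto simp: a_def b_def field_simps)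
  define w where "w v = (\<lambda>l. \<Sum>m\<in>UNIV. v $ m * f m l)" for v :: "real ^ 3"
  define x3 where "x3 x = (\<chi> m. dot p (f m) x)" for x
  have [measurable]: "dot p u' \<in> borel_measurable P" for u'
    using dot_measurable[of p u'] P(3) by (simp cong: measurable_cong_sets)
  have dw: "dot p (w v) x = v \<bullet> x3 x" for v x
  proof -
    have "dot p (w v) x = (\<Sum>m\<in>UNIV. \<Sum>l=1..p. v $ m * (f m l * x l))"
      unfolding dot_def w_def sum_distrib_right by (subst sum.swap) (simp add: mult_ac)
    then show ?thesis by (simp add: inner_vec_def x3_def dot_def sum_distrib_left)
  qed
  define g where "g = marginal_cdf p P \<Gamma> u t - marginal_cdf p P \<Gamma> u s"
  \<comment> \<open>The set whose product measure is computed in both orders of integration.\<close>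
  define C where "C = {(x, v). x \<in> space P \<and> norm v < 1 \<and> a * norm v < \<bar>v \<bullet> x3 x\<bar> \<and> \<bar>v \<bullet> x3 x\<bar> \<le> b * norm v}"
  have im: "(\<lambda>q. snd q \<bullet> x3 (fst q)) \<in> borel_measurable (P \<Otimes>\<^sub>M lborel)"
  proof -
    have "(\<lambda>q. \<Sum>m\<in>UNIV. snd q $ m * dot p (f m) (fst q)) \<in> borel_measurable (P \<Otimes>\<^sub>M (lborel :: (real ^ 3) measure))"
    proof (intro borel_measurable_sum borel_measurable_times)
      fix m :: 3
      have "(\<lambda>v :: real ^ 3. v $ m) \<in> borel_measurable lborel"
        by (simp add: borel_measurable_continuous_onI continuous_intros)
      then show "(\<lambda>q. snd q $ m) \<in> borel_measurable (P \<Otimes>\<^sub>M (lborel :: (real ^ 3) measure))"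
        by (rule measurable_compose[OF measurable_snd])
      show "(\<lambda>q. dot p (f m) (fst q)) \<in> borel_measurable (P \<Otimes>\<^sub>M (lborel :: (real ^ 3) measure))" by measurable
    qed
    then show ?thesis by (simp add: inner_vec_def x3_def)
  qed
  have Cm: "C \<in> sets (P \<Otimes>\<^sub>M lborel)"
  proof -
    have "C = {q\<in>space (P \<Otimes>\<^sub>M lborel). norm (snd q) < 1 \<and> a * norm (snd q) < \<bar>snd q \<bullet> x3 (fst q)\<bar> \<and> \<bar>snd q \<bullet> x3 (fst q)\<bar> \<le> b * norm (snd q)}"
      by (auto simp: C_def space_pair_measure)
    also have "\<dots> \<in> sets (P \<Otimes>\<^sub>M lborel)" using im by measurable
    finally show ?thesis .
  qed
  \<comment> \<open>For fixed \<open>x\<close>: the section is a double cone.\<close>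
  have slice1: "emeasure lborel (Pair x -` C) \<le> ennreal (2 * pi * ((t - s) / s))" for x
  proof -
    have "emeasure lborel (Pair x -` C) \<le> emeasure lborel {v. norm v < 1 \<and> a * norm v < \<bar>v \<bullet> x3 x\<bar> \<and> \<bar>v \<bullet> x3 x\<bar> \<le> b * norm v}"
    proof (rule emeasure_mono)
      show "{v. norm v < 1 \<and> a * norm v < \<bar>v \<bullet> x3 x\<bar> \<and> \<bar>v \<bullet> x3 x\<bar> \<le> b * norm v} \<in> sets lborel"
        unfolding Collect_conj_eq sets_lborel
        by (rule sets.Int[OF borel_open[OF open_Collect_less] sets.Int[OF borel_open[OF open_Collect_less]
              borel_closed[OF closed_Collect_le]]]; intro continuous_intros)
    qed (auto simp: C_def)
    also have "\<dots> \<le> ennreal (2 * pi * (b\<^sup>2 / a\<^sup>2 - 1))" by (rule cone_volume[OF a(1,2)])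
    finally show ?thesis by (simp only: a(3))
  qed
  \<comment> \<open>For fixed \<open>v\<close>: independence of the direction makes each section carry at least the mass \<open>g\<close>.\<close>
  have slice2: "ennreal g * indicator (ball 0 1) v \<le> emeasure P ((\<lambda>x. (x, v)) -` C)" if v: "v \<noteq> 0" for v
  proof (cases "v \<in> ball 0 1")
    case True
    have q: "quad_form p \<Gamma> (w v) = (norm v)\<^sup>2" unfolding w_def by (rule quad_form_combination[OF f])
    have qpos: "quad_form p \<Gamma> (w v) > 0" using v by (simp add: q)
    let ?L = "\<lambda>r. {x\<in>space P. \<bar>dot p (w v) x\<bar>\<^sup>2 / quad_form p \<Gamma> (w v) \<le> r}"
    have Lm: "?L r \<in> sets P" for r by measurable
    have "marginal_cdf p P \<Gamma> u r = measure P (?L r)" for r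
      using marginal_cdf_indep[OF P(1) u qpos, of r] by (simp only: marginal_cdf_def[of p P \<Gamma> "w v"])
    then have "g = measure P (?L t) - measure P (?L s)" by (simp only: g_def)
    also have "\<dots> = measure P (?L t - ?L s)"
      by (rule P.finite_measure_Diff[symmetric]) (use Lm st in auto)
    also have "?L t - ?L s \<subseteq> (\<lambda>x. (x, v)) -` C"
    proof
      fix x assume x: "x \<in> ?L t - ?L s"
      have n: "norm v > 0" using v by simp
      have "\<bar>v \<bullet> x3 x\<bar>\<^sup>2 \<le> t * (norm v)\<^sup>2" "s * (norm v)\<^sup>2 < \<bar>v \<bullet> x3 x\<bar>\<^sup>2"
        using x n by (auto simp: q dw field_simps not_le)
      then have "\<bar>v \<bullet> x3 x\<bar>\<^sup>2 \<le> (b * norm v)\<^sup>2" "(a * norm v)\<^sup>2 < \<bar>v \<bullet> x3 x\<bar>\<^sup>2"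
        using s st by (auto simp: a_def b_def power_mult_distrib)
      then have "\<bar>v \<bullet> x3 x\<bar> \<le> b * norm v" "a * norm v < \<bar>v \<bullet> x3 x\<bar>"
        using a n power2_le_imp_le[of "\<bar>v \<bullet> x3 x\<bar>" "b * norm v"]
          power_less_imp_less_base[of "a * norm v" 2 "\<bar>v \<bullet> x3 x\<bar>"] by simp_all
      then show "x \<in> (\<lambda>x. (x, v)) -` C" using x True by (simp add: C_def)
    qed
    then have "measure P (?L t - ?L s) \<le> measure P ((\<lambda>x. (x, v)) -` C)"
      using sets_Pair2[OF Cm] by (intro P.finite_measure_mono) auto
    finally have "ennreal g \<le> emeasure P ((\<lambda>x. (x, v)) -` C)"
      by (simp add: P.emeasure_eq_measure ennreal_leI)
    then show ?thesis using True by simp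
  qed simp
  have "ennreal g * emeasure lborel (ball (0 :: real ^ 3) 1) = (\<integral>\<^sup>+v. ennreal g * indicator (ball (0 :: real ^ 3) 1) v \<partial>lborel)"
    by (simp add: nn_integral_cmult_indicator)
  also have "\<dots> \<le> (\<integral>\<^sup>+v. emeasure P ((\<lambda>x. (x, v)) -` C) \<partial>lborel)"
  proof (rule nn_integral_mono_AE)
    have "AE v :: real ^ 3 in lborel. v \<noteq> 0" by (rule AE_lborel_singleton)
    then show "AE v in lborel. ennreal g * indicator (ball (0 :: real ^ 3) 1) v \<le> emeasure P ((\<lambda>x. (x, v)) -` C)"
      by eventually_elim (rule slice2)
  qed
  also have "\<dots> = emeasure (P \<Otimes>\<^sub>M lborel) C" by (rule PL.emeasure_pair_measure_alt2[OF Cm, symmetric])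
  also have "\<dots> = (\<integral>\<^sup>+x. emeasure lborel (Pair x -` C) \<partial>P)" by (rule lborel.emeasure_pair_measure_alt[OF Cm])
  also have "\<dots> \<le> (\<integral>\<^sup>+x. ennreal (2 * pi * ((t - s) / s)) \<partial>P)" by (intro nn_integral_mono slice1)
  also have "\<dots> = ennreal (2 * pi * ((t - s) / s))" using P.emeasure_space_1 by simp
  finally have "ennreal g * ennreal (4 / 3 * pi) \<le> ennreal (2 * pi * ((t - s) / s))"
    using emeasure_ball[of 1 "0 :: real ^ 3"] by (simp add: eval_unit_ball_vol)
  moreover have g0: "0 \<le> g"
  proof -
    have "marginal_cdf p P \<Gamma> u s \<le> marginal_cdf p P \<Gamma> u t"
      unfolding marginal_cdf_def using st by (intro P.finite_measure_mono) auto
    then show ?thesis by (simp add: g_def)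
  qed
  ultimately have "g * (4 / 3 * pi) \<le> 2 * pi * ((t - s) / s)"
    using s st by (simp add: ennreal_mult'[symmetric] ennreal_le_iff)
  then have "pi * (g * (4 / 3)) \<le> pi * (2 * ((t - s) / s))" by (simp add: mult_ac)
  then have "g * (4 / 3) \<le> 2 * ((t - s) / s)" using pi_gt_zero by (simp only: mult_le_cancel_left_pos)
  moreover define y where "y = (t - s) / s"
  ultimately have "g \<le> 3 / 2 * y" by linarith
  then show ?thesis by (simp only: g_def y_def)
qed

section \<open>Slabs in the admissible directions\<close>

text \<open>Deviations are linear in the indicator function, so the triangle inequality handles events whose
indicator is a constant minus two indicators.\<close>

lemma deviation_of_difference:
  fixes a :: real and n :: nat
  assumes M: "prob_space M" and AB: "A \<in> sets M" "B \<in> sets M"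
    and Q: "\<And>x. x \<in> space M \<Longrightarrow> of_bool (Q x) = a - indicat_real A x - indicat_real B x"
    and X: "\<And>i. i \<in> {1..n} \<Longrightarrow> X i \<in> space M"
    and dev: "\<bar>(\<Sum>i=1..n. indicat_real A (X i)) - n * measure M A\<bar> \<le> t"
      "\<bar>(\<Sum>i=1..n. indicat_real B (X i)) - n * measure M B\<bar> \<le> t"
  shows "\<bar>(\<Sum>i=1..n. of_bool (Q (X i))) - n * measure M {x\<in>space M. Q x}\<bar> \<le> 2 * t"
proof -
  interpret prob_space M by fact
  have Qs: "{x\<in>space M. Q x} \<in> sets M"
  proof -
    have "{x\<in>space M. Q x} = {x\<in>space M. a - indicat_real A x - indicat_real B x > 0}"
      by (rule Collect_cong, rule conj_cong[OF refl]) (simp add: Q[symmetric])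
    also have "\<dots> \<in> sets M" using AB by measurable
    finally show ?thesis .
  qed
  have "measure M {x\<in>space M. Q x} = (\<integral>x. indicat_real {x\<in>space M. Q x} x \<partial>M)" using Qs by simp
  also have "\<dots> = (\<integral>x. a - indicat_real A x - indicat_real B x \<partial>M)"
  proof (rule Bochner_Integration.integral_cong[OF refl])
    fix x assume x: "x \<in> space M"
    then have "indicat_real {x\<in>space M. Q x} x = of_bool (Q x)" by (simp add: indicator_def)
    then show "indicat_real {x\<in>space M. Q x} x = a - indicat_real A x - indicat_real B x" by (simp only: Q[OF x])
  qed
  also have "\<dots> = a - measure M A - measure M B"
  proof -
    have i: "integrable M (indicat_real A)" "integrable M (indicat_real B)"
      using AB by (auto intro!: integrable_real_indicator simp: less_top[symmetric])
    show ?thesis using AB by (simp add: i prob_space)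
  qed
  finally have m: "measure M {x\<in>space M. Q x} = a - measure M A - measure M B" .
  have "(\<Sum>i=1..n. of_bool (Q (X i)) :: real) = (\<Sum>i=1..n. a - indicat_real A (X i) - indicat_real B (X i))"
    by (rule sum.cong[OF refl]) (rule Q[OF X])
  also have "\<dots> = n * a - (\<Sum>i=1..n. indicat_real A (X i)) - (\<Sum>i=1..n. indicat_real B (X i))"
    by (simp add: sum_subtractf)
  finally have "(\<Sum>i=1..n. of_bool (Q (X i)) :: real) - n * measure M {x\<in>space M. Q x}
     = - ((\<Sum>i=1..n. indicat_real A (X i)) - n * measure M A) - ((\<Sum>i=1..n. indicat_real B (X i)) - n * measure M B)"
    by (simp add: m algebra_simps)
  then show ?thesis using dev by linarith
qed

text \<open>The two slab events are kept together because the depth always involves both.\<close>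

abbreviation slab_counts_within :: "nat \<Rightarrow> nat \<Rightarrow> vector measure \<Rightarrow> (nat \<Rightarrow> vector) \<Rightarrow> vector \<Rightarrow> real \<Rightarrow> real \<Rightarrow> bool" where
  "slab_counts_within n p M X u c t \<equiv>
     \<bar>(\<Sum>i=1..n. of_bool (\<bar>dot p u (X i)\<bar>\<^sup>2 \<le> c)) - n * measure M {x\<in>space M. \<bar>dot p u x\<bar>\<^sup>2 \<le> c}\<bar> \<le> t \<and>
     \<bar>(\<Sum>i=1..n. of_bool (\<bar>dot p u (X i)\<bar>\<^sup>2 \<ge> c)) - n * measure M {x\<in>space M. \<bar>dot p u x\<bar>\<^sup>2 \<ge> c}\<bar> \<le> t"

text \<open>The slab \<open>\<bar>u\<^sup>T x\<bar>\<^sup>2 \<le> c\<close> is the complement of two disjoint open half-spaces. The indicator of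
\<open>\<bar>u\<^sup>T x\<bar>\<^sup>2 \<ge> c\<close> for \<open>c > 0\<close> is \<open>2\<close> minus the indicators of the two open half-spaces with threshold
\<open>- sqrt c\<close>, which together cover the space and overlap in the complementary open slab.\<close>

lemma slab_deviation:
  fixes L :: real and n :: nat
  assumes M: "prob_space M" "sets M = sets (Rn p)" and n: "n > 0" and W: "W \<subseteq> {1..p}" and L: "L \<ge> 0"
  shows "\<exists>E\<in>sets (PiM {1..n} (\<lambda>_. M)). measure (PiM {1..n} (\<lambda>_. M)) E \<ge> 1 - 16 * exp (- L) \<and>
     (\<forall>X\<in>E. \<forall>u c. (\<forall>i\<in>{1..p} - W. u i = 0) \<longrightarrow> 0 \<le> c \<longrightarrow>
        slab_counts_within n p M X u c (192 * sqrt (n * (real (card W) + 1 + L))))"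
proof -
  interpret M: prob_space M by fact
  have sp: "space M = space (Rn p)" using M(2) by (rule sets_eq_imp_space_eq)
  define t where "t = 96 * sqrt (n * (real (card W) + 1 + L))"
  have t0: "t \<ge> 0" using L by (simp add: t_def)
  obtain E where E: "E \<in> sets (PiM {1..n} (\<lambda>_. M))" "measure (PiM {1..n} (\<lambda>_. M)) E \<ge> 1 - 16 * exp (- L)"
    and dev: "\<And>X u a. X \<in> E \<Longrightarrow>
      \<bar>(\<Sum>i=1..n. indicat_real (halfspace p W u a) (X i)) - n * measure M (halfspace p W u a)\<bar> \<le> t"
    using halfspace_deviation[OF M n W L] unfolding t_def by blast
  have H: "halfspace p W u a \<in> sets M" for u a using halfspace_sets[OF W] M(2) by simp
  show ?thesis
  proof (rule bexI[OF _ E(1)], intro conjI[OF E(2)] ballI allI impI)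
    fix X and u :: vector and c :: real assume X: "X \<in> E" and u: "\<forall>i\<in>{1..p} - W. u i = 0" and c: "0 \<le> c"
    have Xi: "X i \<in> space M" if "i \<in> {1..n}" for i
    proof -
      have "X \<in> space (PiM {1..n} (\<lambda>_. M))" using sets.sets_into_space[OF E(1)] X by blast
      then show ?thesis using that by (auto simp: space_PiM PiE_def Pi_def)
    qed
    have d: "dot p u x = (\<Sum>i\<in>W. u i * x i)" for x
      unfolding dot_def by (rule sum.mono_neutral_right) (use u W in auto)
    have dm: "(\<Sum>i\<in>W. - u i * x i) = - dot p u x" for x
      by (simp add: d sum_negf)
    define b0 where "b0 = sqrt c"
    have sq: "y\<^sup>2 \<le> c \<longleftrightarrow> \<bar>y\<bar> \<le> b0" "c \<le> y\<^sup>2 \<longleftrightarrow> b0 \<le> \<bar>y\<bar>" for y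
      unfolding b0_def using c real_sqrt_le_iff[of "y\<^sup>2" c] real_sqrt_le_iff[of c "y\<^sup>2"] by simp_all
    have sc: "b0 \<ge> 0" using c by (simp add: b0_def)
    have hu: "indicat_real (halfspace p W u b) x = of_bool (b < dot p u x)" if "x \<in> space M" for b x
      using that by (simp add: indicator_def halfspace_def sp d)
    have hn: "indicat_real (halfspace p W (\<lambda>i. - u i) b) x = of_bool (b < - dot p u x)" if "x \<in> space M" for b x
    proof -
      have "x \<in> halfspace p W (\<lambda>i. - u i) b \<longleftrightarrow> b < - dot p u x"
        unfolding halfspace_def mem_Collect_eq dm using that sp by simp
      then show ?thesis by (simp add: indicator_def)
    qed
    have "\<bar>(\<Sum>i=1..n. of_bool (\<bar>dot p u (X i)\<bar>\<^sup>2 \<le> c)) - n * measure M {x\<in>space M. \<bar>dot p u x\<bar>\<^sup>2 \<le> c}\<bar> \<le> 2 * t"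
    proof (rule deviation_of_difference[OF M(1) H H _ Xi dev[OF X] dev[OF X]])
      fix x assume x: "x \<in> space M"
      show "of_bool (\<bar>dot p u x\<bar>\<^sup>2 \<le> c)
          = 1 - indicat_real (halfspace p W u (b0)) x - indicat_real (halfspace p W (\<lambda>i. - u i) (b0)) x"
        unfolding hu[OF x] hn[OF x] using sc by (auto simp: sq abs_le_iff)
    qed
    moreover have "\<bar>(\<Sum>i=1..n. of_bool (\<bar>dot p u (X i)\<bar>\<^sup>2 \<ge> c)) - n * measure M {x\<in>space M. \<bar>dot p u x\<bar>\<^sup>2 \<ge> c}\<bar> \<le> 2 * t"
    \<comment> \<open>For \<open>c = 0\<close> the event is the whole space, and its indicator is not of the form below.\<close>
    proof (cases "c = 0")
      case True
      then show ?thesis using t0 M.prob_space by simp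
    next
      case False
      then have sc: "b0 > 0" using c by (simp add: b0_def)
      show ?thesis
      proof (rule deviation_of_difference[OF M(1) H H _ Xi dev[OF X] dev[OF X]])
        fix x assume x: "x \<in> space M"
        show "of_bool (\<bar>dot p u x\<bar>\<^sup>2 \<ge> c)
            = 2 - indicat_real (halfspace p W u (- b0)) x - indicat_real (halfspace p W (\<lambda>i. - u i) (- b0)) x"
          unfolding hu[OF x] hn[OF x] using sc by (auto simp: sq abs_if)
      qed
    qed
    ultimately show "slab_counts_within n p M X u c (192 * sqrt (n * (real (card W) + 1 + L)))"
      by (simp add: t_def)
  qed
qed

definition windows :: "nat \<Rightarrow> nat \<Rightarrow> nat set set" where
  "windows p k = (if 2 * k \<le> p then (\<lambda>l. {l..l + 2 * k - 1}) ` {1..p + 1 - 2 * k} else {{1..p}})"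

lemma windows_properties:
  assumes "p > 0" "k > 0"
  shows "finite (windows p k)" "card (windows p k) \<le> p" "W \<in> windows p k \<Longrightarrow> W \<subseteq> {1..p}"
    "W \<in> windows p k \<Longrightarrow> card W \<le> min (2 * k) p"
proof -
  show "finite (windows p k)" by (simp add: windows_def)
  show "card (windows p k) \<le> p"
  proof (cases "2 * k \<le> p")
    case True
    have "card ((\<lambda>l. {l..l + 2 * k - 1}) ` {1..p + 1 - 2 * k}) \<le> card {1..p + 1 - 2 * k}" by (rule card_image_le) simp
    also have "\<dots> \<le> p" using assms by simp
    finally show ?thesis using True by (simp add: windows_def)
  qed (use assms in \<open>simp add: windows_def\<close>)
  show "W \<in> windows p k \<Longrightarrow> W \<subseteq> {1..p}" by (auto simp: windows_def split: if_splits)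
  show "W \<in> windows p k \<Longrightarrow> card W \<le> min (2 * k) p" using assms by (auto simp: windows_def split: if_splits)
qed

lemma direction_window:
  assumes "u \<in> directions p k"
  shows "\<exists>W\<in>windows p k. \<forall>i\<in>{1..p} - W. u i = 0"
proof (cases "2 * k \<le> p")
  case True
  then obtain l where "l \<in> {1..p + 1 - 2 * k}" "u \<in> interval_directions p l (l + 2 * k - 1)"
    using assms by (auto simp: directions_def)
  then show ?thesis using True
    by (intro bexI[of _ "{l..l + 2 * k - 1}"]) (auto simp: interval_directions_def windows_def)
qed (auto simp: windows_def)

lemma directions_subset: "directions p k \<subseteq> unit_sphere p"
  by (auto simp: directions_def interval_directions_def)

lemma directions_nonempty:
  assumes "p > 0" "k > 0"
  shows "directions p k \<noteq> {}"
proof -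
  let ?e = "\<lambda>i\<in>{1..p}. if i = 1 then 1 else 0 :: real"
  note e = first_axis_in_unit_sphere[OF assms(1)]
  have "?e \<in> directions p k"
  proof (cases "2 * k \<le> p")
    case True
    have "?e \<in> interval_directions p 1 (1 + 2 * k - 1)"
      using e assms(2) by (auto simp: interval_directions_def)
    moreover have "1 \<in> {1..p + 1 - 2 * k}" using True by simp
    ultimately show ?thesis using True unfolding directions_def by (simp only: if_True) blast
  qed (use e in \<open>simp add: directions_def\<close>)
  then show ?thesis by blast
qed

text \<open>A union bound over the at most \<open>p\<close> windows, each with failure probability \<open>\<delta> / p\<close>.\<close>

lemma directional_deviation:
  fixes \<delta> :: real and n p k :: nat
  assumes M: "prob_space M" "sets M = sets (Rn p)" and n: "n > 0" and p: "p > 0" and k: "k > 0"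
    and \<delta>: "0 < \<delta>" "\<delta> < 1"
  defines "t \<equiv> 192 * sqrt (n * (real (min (2 * k) p) + 1 + ln (16 * p / \<delta>)))"
  shows "\<exists>E\<in>sets (iid_sample n M). measure (iid_sample n M) E \<ge> 1 - \<delta> \<and>
     (\<forall>X\<in>E. \<forall>u\<in>directions p k. \<forall>c\<ge>0.
        slab_counts_within n p M X u c t)"
proof -
  let ?P = "PiM {1..n} (\<lambda>_. M)"
  interpret P: prob_space ?P by (intro prob_space_PiM M)
  define L where "L = ln (16 * p / \<delta>)"
  have eL: "exp (- L) = \<delta> / (16 * p)" using \<delta> p by (simp add: L_def exp_minus)
  have L: "L \<ge> 0" unfolding L_def by (rule ln_ge_zero) (use \<delta> p in \<open>simp add: le_divide_eq\<close>)
  note w = windows_properties[OF p k]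
  have "\<forall>W\<in>windows p k. \<exists>E. E \<in> sets ?P \<and> measure ?P E \<ge> 1 - 16 * exp (- L) \<and>
     (\<forall>X\<in>E. \<forall>u c. (\<forall>i\<in>{1..p} - W. u i = 0) \<longrightarrow> 0 \<le> c \<longrightarrow>
        slab_counts_within n p M X u c (192 * sqrt (n * (real (card W) + 1 + L))))"
    using slab_deviation[OF M n w(3) L] by blast
  from bchoice[OF this] obtain E where E: "\<And>W. W \<in> windows p k \<Longrightarrow> E W \<in> sets ?P"
    "\<And>W. W \<in> windows p k \<Longrightarrow> measure ?P (E W) \<ge> 1 - 16 * exp (- L)"
    and dev: "\<And>W X u c. W \<in> windows p k \<Longrightarrow> X \<in> E W \<Longrightarrow> (\<forall>i\<in>{1..p} - W. u i = 0) \<Longrightarrow> 0 \<le> c \<Longrightarrow>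
        slab_counts_within n p M X u c (192 * sqrt (n * (real (card W) + 1 + L)))"
    by (elim exE) (simp, blast)
  define F where "F = space ?P - (\<Union>W\<in>windows p k. space ?P - E W)"
  have Um: "(\<Union>W\<in>windows p k. space ?P - E W) \<in> sets ?P"
    by (intro sets.finite_UN w(1) sets.compl_sets E(1))
  have "measure ?P (\<Union>W\<in>windows p k. space ?P - E W) \<le> (\<Sum>W\<in>windows p k. measure ?P (space ?P - E W))"
    by (rule P.finite_measure_subadditive_finite) (use E(1) w(1) in auto)
  also have "\<dots> \<le> (\<Sum>W\<in>windows p k. 16 * exp (- L))"
    by (intro sum_mono) (use E P.prob_compl in fastforce)
  also have "\<dots> = card (windows p k) * (16 * exp (- L))" by simp
  also have "\<dots> \<le> p * (16 * exp (- L))" using w(2) by (intro mult_right_mono) auto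
  also have "\<dots> = \<delta>" using p by (simp add: eL)
  finally have "measure ?P F \<ge> 1 - \<delta>" unfolding F_def using P.prob_compl[OF Um] by simp
  moreover have "F \<in> sets ?P" unfolding F_def using Um by auto
  moreover have "slab_counts_within n p M X u c t"
    if X: "X \<in> F" and u: "u \<in> directions p k" and c: "0 \<le> c" for X u c
  proof -
    obtain W where W: "W \<in> windows p k" "\<forall>i\<in>{1..p} - W. u i = 0" using direction_window[OF u] by blast
    have XE: "X \<in> E W" using X W(1) by (auto simp: F_def)
    have "192 * sqrt (n * (real (card W) + 1 + L)) \<le> t"
      unfolding t_def L_def[symmetric]
      using w(4)[OF W(1)] by (intro mult_left_mono real_sqrt_le_mono add_right_mono of_nat_mono) auto
    then show ?thesis using dev[OF W(1) XE W(2) c] by linarith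
  qed
  ultimately show ?thesis unfolding iid_sample_def by (intro bexI[of _ F]) auto
qed

section \<open>From depth to quadratic forms\<close>

text \<open>Normalization keeps the support, so bounds on unit vectors supported in a window extend to all
vectors supported there.\<close>

lemma quad_form_bound_from_unit_vectors:
  assumes "\<And>v. v \<in> unit_sphere p \<Longrightarrow> (\<And>i. i \<in> {1..p} \<Longrightarrow> u i = 0 \<Longrightarrow> v i = 0) \<Longrightarrow> \<bar>quad_form p B v\<bar> \<le> S"
  shows "\<bar>quad_form p B u\<bar> \<le> S * (enorm p u)\<^sup>2"
proof (cases "enorm p u = 0")
  case True
  then have "\<forall>i\<in>{1..p}. (u i)\<^sup>2 = 0" using enorm_power2[of p u] by (simp add: sum_nonneg_eq_0_iff)
  then have "quad_form p B u = 0" by (simp add: quad_form_eq)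
  then show ?thesis using True by simp
next
  case False
  define v where "v = (\<lambda>i\<in>{1..p}. 1 / enorm p u * u i)"
  have "(\<Sum>i=1..p. (v i)\<^sup>2) = (\<Sum>i=1..p. (1 / enorm p u)\<^sup>2 * (u i)\<^sup>2)"
    by (rule sum.cong) (auto simp: v_def power_mult_distrib power_divide)
  also have "\<dots> = (1 / enorm p u)\<^sup>2 * (enorm p u)\<^sup>2"
    unfolding enorm_power2 sum_distrib_left ..
  also have "\<dots> = 1" using False by (simp add: field_simps)
  finally have "v \<in> unit_sphere p" by (simp add: unit_sphere_def enorm_def L2_set_def v_def)
  then have "\<bar>quad_form p B v\<bar> \<le> S" by (rule assms) (simp add: v_def)
  also have "quad_form p B v = quad_form p B (\<lambda>i. 1 / enorm p u * u i)"
    by (rule quad_form_cong) (simp add: v_def)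
  also have "\<dots> = (1 / enorm p u)\<^sup>2 * quad_form p B u" by (rule quad_form_scale)
  also have "\<bar>\<dots>\<bar> = \<bar>quad_form p B u\<bar> / (enorm p u)\<^sup>2" by (simp add: abs_mult power_divide)
  finally show ?thesis using False enorm_nonneg[of p u] by (simp add: pos_divide_le_eq)
qed

text \<open>The block argument uses windows that may stick out beyond \<open>p\<close>. Such a window can be shifted back
into the range of the admissible directions. If \<open>2 * k > p\<close>, all unit vectors are admissible.\<close>

lemma banded_difference_bound:
  assumes p: "p > 0" and k: "k > 0" and B: "B \<in> banded p k" and B': "B' \<in> banded p k"
    and S: "S \<ge> 0" and dir: "\<And>u. u \<in> directions p k \<Longrightarrow> \<bar>quad_form p (\<lambda>i j. B i j - B' i j) u\<bar> \<le> S"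
  shows "\<bar>quad_form p (\<lambda>i j. B i j - B' i j) u\<bar> \<le> 3 * S * (enorm p u)\<^sup>2"
proof (cases "2 * k \<le> p")
  case True
  show ?thesis
  proof (rule banded_quad_form_bound[OF k S])
    show "B i j - B' i j = 0" if "i \<in> {1..p}" "j \<in> {1..p}" "\<bar>int i - int j\<bar> > int k" for i j
      using B B' that by (simp add: banded_def)
    fix l and u :: vector assume l: "1 \<le> l" and u: "\<And>i. i \<in> {1..p} \<Longrightarrow> i \<notin> {l..l + 2 * k - 1} \<Longrightarrow> u i = 0"
    \<comment> \<open>Shift the window to the left until it fits.\<close>
    define l' where "l' = min l (p + 1 - 2 * k)"
    have l': "l' \<in> {1..p + 1 - 2 * k}" using l True by (auto simp: l'_def)
    show "\<bar>quad_form p (\<lambda>i j. B i j - B' i j) u\<bar> \<le> S * (enorm p u)\<^sup>2"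
    proof (rule quad_form_bound_from_unit_vectors)
      fix v assume v: "v \<in> unit_sphere p" "\<And>i. i \<in> {1..p} \<Longrightarrow> u i = 0 \<Longrightarrow> v i = 0"
      have "v i = 0" if "i \<in> {1..p}" "i \<notin> {l'..l' + 2 * k - 1}" for i
      proof -
        have "i \<notin> {l..l + 2 * k - 1}" using that True by (auto simp: l'_def min_def split: if_splits)
        then show ?thesis using v(2) u that(1) by blast
      qed
      then have "v \<in> interval_directions p l' (l' + 2 * k - 1)" using v(1) by (simp add: interval_directions_def)
      then have "v \<in> directions p k" using l' True unfolding directions_def by (simp only: if_True) blast
      then show "\<bar>quad_form p (\<lambda>i j. B i j - B' i j) v\<bar> \<le> S" by (rule dir)
    qed
  qed
next
  case False
  have "\<bar>quad_form p (\<lambda>i j. B i j - B' i j) u\<bar> \<le> S * (enorm p u)\<^sup>2"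
    by (rule quad_form_bound_from_unit_vectors) (use False dir in \<open>simp add: directions_def\<close>)
  also have "\<dots> \<le> 3 * S * (enorm p u)\<^sup>2" using S by (intro mult_right_mono) auto
  finally show ?thesis .
qed

lemma matrix_depth_ge:
  assumes "U \<noteq> {}"
    and "\<And>u. u \<in> U \<Longrightarrow> d \<le> 1 / real n * (\<Sum>i=1..n. of_bool (\<bar>dot p u (X i)\<bar>\<^sup>2 \<le> quad_form p \<Gamma> u))"
    and "\<And>u. u \<in> U \<Longrightarrow> d \<le> 1 / real n * (\<Sum>i=1..n. of_bool (\<bar>dot p u (X i)\<bar>\<^sup>2 \<ge> quad_form p \<Gamma> u))"
  shows "d \<le> matrix_depth p n U \<Gamma> X"
  unfolding matrix_depth_def using assms by (intro cINF_greatest min.boundedI) auto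

lemma matrix_depth_le:
  assumes u: "u \<in> U"
  shows "matrix_depth p n U \<Gamma> X \<le> 1 / real n * (\<Sum>i=1..n. of_bool (\<bar>dot p u (X i)\<bar>\<^sup>2 \<le> quad_form p \<Gamma> u))"
    and "matrix_depth p n U \<Gamma> X \<le> 1 / real n * (\<Sum>i=1..n. of_bool (\<bar>dot p u (X i)\<bar>\<^sup>2 \<ge> quad_form p \<Gamma> u))"
proof -
  have "bdd_below ((\<lambda>u. min
     (1 / real n * (\<Sum>i=1..n. of_bool (\<bar>dot p u (X i)\<bar>\<^sup>2 \<le> quad_form p \<Gamma> u)))
     (1 / real n * (\<Sum>i=1..n. of_bool (\<bar>dot p u (X i)\<bar>\<^sup>2 \<ge> quad_form p \<Gamma> u)))) ` U)"
    by (rule bdd_belowI[of _ 0]) (auto intro!: sum_nonneg)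
  from cINF_lower[OF this u]
  have "matrix_depth p n U \<Gamma> X \<le> min
     (1 / real n * (\<Sum>i=1..n. of_bool (\<bar>dot p u (X i)\<bar>\<^sup>2 \<le> quad_form p \<Gamma> u)))
     (1 / real n * (\<Sum>i=1..n. of_bool (\<bar>dot p u (X i)\<bar>\<^sup>2 \<ge> quad_form p \<Gamma> u)))"
    unfolding matrix_depth_def .
  then show "matrix_depth p n U \<Gamma> X \<le> 1 / real n * (\<Sum>i=1..n. of_bool (\<bar>dot p u (X i)\<bar>\<^sup>2 \<le> quad_form p \<Gamma> u))"
    "matrix_depth p n U \<Gamma> X \<le> 1 / real n * (\<Sum>i=1..n. of_bool (\<bar>dot p u (X i)\<bar>\<^sup>2 \<ge> quad_form p \<Gamma> u))"
    by linarith+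
qed

text \<open>The form in which the marginal condition is used: a small change of the distribution function forces a
small change of the argument.\<close>

lemma marginal_condition_near:
  assumes mc: "marginal_condition p P \<Gamma> \<tau> \<alpha>\<^sub>0 \<kappa>" and u: "u \<in> unit_sphere p" and pos: "\<alpha>\<^sub>0 > 0" "\<kappa> > 0"
    and e: "\<bar>marginal_cdf p P \<Gamma> u 1 - marginal_cdf p P \<Gamma> u (1 + t)\<bar> \<le> e" "e < \<tau>"
  shows "\<bar>t\<bar> \<le> e * sqrt \<kappa>" "\<bar>t\<bar> < \<alpha>\<^sub>0"
proof -
  let ?G = "marginal_cdf p P \<Gamma> u"
  have mc': "(INF t\<in>{t. \<bar>t\<bar> \<ge> \<alpha>\<^sub>0}. \<bar>?G 1 - ?G (1 + t)\<bar>) \<ge> \<tau>"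
    "(INF t\<in>{t. 0 < \<bar>t\<bar> \<and> \<bar>t\<bar> < \<alpha>\<^sub>0}. \<bar>?G 1 - ?G (1 + t)\<bar> / \<bar>t\<bar>) \<ge> \<kappa> powr (- 1 / 2)"
    using mc u by (auto simp: marginal_condition_def Let_def)
  show t: "\<bar>t\<bar> < \<alpha>\<^sub>0"
  proof (rule ccontr)
    assume "\<not> \<bar>t\<bar> < \<alpha>\<^sub>0"
    then have "(INF t\<in>{t. \<bar>t\<bar> \<ge> \<alpha>\<^sub>0}. \<bar>?G 1 - ?G (1 + t)\<bar>) \<le> \<bar>?G 1 - ?G (1 + t)\<bar>"
      by (intro cINF_lower bdd_belowI2[of _ 0]) auto
    then show False using mc'(1) e by linarith
  qed
  have e0: "0 \<le> e" using e(1) by linarith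
  show "\<bar>t\<bar> \<le> e * sqrt \<kappa>"
  proof (cases "t = 0")
    case True
    then show ?thesis using e0 pos by simp
  next
    case False
    have "(INF t\<in>{t. 0 < \<bar>t\<bar> \<and> \<bar>t\<bar> < \<alpha>\<^sub>0}. \<bar>?G 1 - ?G (1 + t)\<bar> / \<bar>t\<bar>) \<le> \<bar>?G 1 - ?G (1 + t)\<bar> / \<bar>t\<bar>"
      by (intro cINF_lower bdd_belowI2[of _ 0]) (use t False in auto)
    then have "\<kappa> powr (- 1 / 2) \<le> e / \<bar>t\<bar>"
      using mc'(2) divide_right_mono[OF e(1), of "\<bar>t\<bar>"] by linarith
    moreover have "\<kappa> powr (- 1 / 2) = 1 / sqrt \<kappa>"
      using pos by (simp add: powr_minus_divide powr_half_sqrt[symmetric])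
    ultimately have "1 / sqrt \<kappa> \<le> e / \<bar>t\<bar>" by simp
    then show ?thesis using False pos by (simp add: field_simps)
  qed
qed

lemma marginal_cdf_mono:
  assumes P: "prob_space P" "sets P = sets (Rn p)" and st: "s \<le> t"
  shows "marginal_cdf p P \<Gamma> u s \<le> marginal_cdf p P \<Gamma> u t"
proof -
  interpret prob_space P by fact
  have [measurable]: "dot p u \<in> borel_measurable P"
    using dot_measurable[of p u] P(2) by (simp cong: measurable_cong_sets)
  show ?thesis unfolding marginal_cdf_def using st by (intro finite_measure_mono) auto
qed

lemma marginal_cdf_le_eq:
  assumes "quad_form p \<Gamma> u > 0"
  shows "marginal_cdf p P \<Gamma> u r = measure P {x\<in>space P. \<bar>dot p u x\<bar>\<^sup>2 \<le> r * quad_form p \<Gamma> u}"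
  unfolding marginal_cdf_def using assms by (simp add: pos_divide_le_eq)

text \<open>The two mass bounds say that the distribution function is at least \<open>1/2 - e\<close> at \<open>\<rho>\<close> and at most
\<open>1/2 + e\<close> at every point below \<open>\<rho>\<close>. For \<open>\<rho> > 1\<close> the marginal condition is applied at these
smaller points, since \<open>P\<close> may have an atom at \<open>\<rho>\<close>, and the bound passes to the limit.\<close>

lemma ratio_close_from_depth:
  assumes P: "prob_space P" "sets P = sets (Rn p)" and mc: "marginal_condition p P \<Gamma> \<tau> \<alpha>\<^sub>0 \<kappa>"
    and u: "u \<in> unit_sphere p" and pos: "\<alpha>\<^sub>0 > 0" "\<kappa> > 0" and med: "marginal_cdf p P \<Gamma> u 1 = 1 / 2"
    and q: "quad_form p \<Gamma> u > 0" and e: "0 \<le> e" "e < \<tau>"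
    and low: "measure P {x\<in>space P. \<bar>dot p u x\<bar>\<^sup>2 \<le> \<rho> * quad_form p \<Gamma> u} \<ge> 1 / 2 - e"
    and up: "measure P {x\<in>space P. \<bar>dot p u x\<bar>\<^sup>2 \<ge> \<rho> * quad_form p \<Gamma> u} \<ge> 1 / 2 - e"
  shows "\<bar>\<rho> - 1\<bar> \<le> e * sqrt \<kappa>"
proof -
  interpret prob_space P by fact
  have [measurable]: "dot p u \<in> borel_measurable P"
    using dot_measurable[of p u] P(2) by (simp cong: measurable_cong_sets)
  let ?G = "marginal_cdf p P \<Gamma> u"
  have lo: "?G \<rho> \<ge> 1 / 2 - e" using low by (simp add: marginal_cdf_le_eq[OF q])
  have hi: "?G r \<le> 1 / 2 + e" if r: "r < \<rho>" for r
  proof -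
    have "measure P {x\<in>space P. \<bar>dot p u x\<bar>\<^sup>2 \<ge> \<rho> * quad_form p \<Gamma> u}
        \<le> measure P (space P - {x\<in>space P. \<bar>dot p u x\<bar>\<^sup>2 \<le> r * quad_form p \<Gamma> u})"
    proof (rule finite_measure_mono)
      have "r * quad_form p \<Gamma> u < \<rho> * quad_form p \<Gamma> u" using r q by simp
      then show "{x\<in>space P. \<bar>dot p u x\<bar>\<^sup>2 \<ge> \<rho> * quad_form p \<Gamma> u}
        \<subseteq> space P - {x\<in>space P. \<bar>dot p u x\<bar>\<^sup>2 \<le> r * quad_form p \<Gamma> u}" by auto
    qed measurable
    also have "\<dots> = 1 - ?G r" unfolding marginal_cdf_le_eq[OF q] by (rule prob_compl) measurable
    finally show ?thesis using up by linarith
  qed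
  show ?thesis
  proof (cases "\<rho> \<le> 1")
    case True
    have "\<bar>?G 1 - ?G (1 + (\<rho> - 1))\<bar> \<le> e"
      using lo med marginal_cdf_mono[OF P True, of \<Gamma> u] by simp
    then show ?thesis using marginal_condition_near(1)[OF mc u pos _ e(2)] by blast
  next
    case False
    have "r - 1 \<le> e * sqrt \<kappa>" if r: "1 < r" "r < \<rho>" for r
    proof -
      have "\<bar>?G 1 - ?G (1 + (r - 1))\<bar> \<le> e"
        using hi[OF r(2)] med marginal_cdf_mono[OF P less_imp_le[OF r(1)], of \<Gamma> u] by simp
      then have "\<bar>r - 1\<bar> \<le> e * sqrt \<kappa>" by (rule marginal_condition_near(1)[OF mc u pos _ e(2)])
      then show ?thesis by simp
    qed
    \<comment> \<open>The bound at all \<open>r\<close> between \<open>1\<close> and \<open>\<rho>\<close> passes to \<open>\<rho>\<close>.\<close>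
    then have "\<rho> \<le> e * sqrt \<kappa> + 1"
      using False by (intro dense_le_bounded[of 1 \<rho>]) (auto simp: algebra_simps)
    then show ?thesis using False by simp
  qed
qed

text \<open>Just to the right of \<open>1\<close> the difference quotient of the distribution function is at least
\<open>1 / sqrt \<kappa>\<close> by the marginal condition and at most \<open>3/2\<close> by the Lipschitz bound.\<close>

lemma kappa_lower_bound:
  assumes mc: "marginal_condition p P \<Gamma> \<tau> \<alpha>\<^sub>0 \<kappa>" and u: "u \<in> unit_sphere p" and pos: "\<alpha>\<^sub>0 > 0" "\<kappa> > 0"
    and \<tau>: "\<tau> > 0"
    and lip: "\<And>t. 0 < t \<Longrightarrow> \<bar>marginal_cdf p P \<Gamma> u 1 - marginal_cdf p P \<Gamma> u (1 + t)\<bar> \<le> 3 / 2 * t"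
  shows "4 / 9 \<le> \<kappa>"
proof -
  \<comment> \<open>Any \<open>t\<close> with \<open>3 / 2 * t < \<tau>\<close> would do.\<close>
  define t where "t = \<tau> / 2"
  have t: "0 < t" "3 / 2 * t < \<tau>" using \<tau> by (auto simp: t_def)
  have "\<bar>t\<bar> \<le> 3 / 2 * t * sqrt \<kappa>" by (rule marginal_condition_near(1)[OF mc u pos lip[OF t(1)] t(2)])
  then have "t * 1 \<le> t * (3 / 2 * sqrt \<kappa>)" using t(1) by (simp add: mult_ac)
  then have "2 / 3 \<le> sqrt \<kappa>" using t(1) by (simp only: mult_le_cancel_left_pos)
  then have "(2 / 3)\<^sup>2 \<le> (sqrt \<kappa>)\<^sup>2" by (intro power_mono) auto
  then show ?thesis using pos by (simp add: power_divide)
qed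

lemma elliptical_prob_space:
  assumes "elliptical p \<Gamma> \<eta> P"
  shows "prob_space P" "sets P = sets (Rn p)"
proof -
  from assms obtain r A U where \<eta>: "prob_space \<eta>" "sets \<eta> = sets borel" and U: "prob_space U" "sets U = sets (Rn r)"
    and Peq: "P = distr (\<eta> \<Otimes>\<^sub>M U) (Rn p) (\<lambda>(s, x). \<lambda>i\<in>{1..p}. s * mat_vec p r A x i)"
    unfolding elliptical_def uniform_on_sphere_def by blast
  interpret \<eta>: prob_space \<eta> by fact
  interpret U: prob_space U by fact
  interpret pair_prob_space \<eta> U ..
  have "(\<lambda>q. \<lambda>i\<in>{1..p}. fst q * (\<Sum>j=1..r. A i j * snd q j)) \<in> borel \<Otimes>\<^sub>M Rn r \<rightarrow>\<^sub>M Rn p"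
    unfolding Rn_def by measurable
  then have "(\<lambda>(s, x). \<lambda>i\<in>{1..p}. s * mat_vec p r A x i) \<in> borel \<Otimes>\<^sub>M Rn r \<rightarrow>\<^sub>M Rn p"
    by (simp add: mat_vec_def split_beta' cong: restrict_cong)
  moreover have "sets (\<eta> \<Otimes>\<^sub>M U) = sets (borel \<Otimes>\<^sub>M Rn r)" by (rule sets_pair_measure_cong) fact+
  ultimately have "(\<lambda>(s, x). \<lambda>i\<in>{1..p}. s * mat_vec p r A x i) \<in> \<eta> \<Otimes>\<^sub>M U \<rightarrow>\<^sub>M Rn p"
    by (simp cong: measurable_cong_sets)
  then show "prob_space P" unfolding Peq by (rule prob_space_distr)
  show "sets P = sets (Rn p)" by (simp add: Peq)
qed

lemma measure_contamination:
  assumes P: "prob_space P" and Q: "prob_space Q" and PQ: "sets Q = sets P" and \<epsilon>: "0 \<le> \<epsilon>" "\<epsilon> \<le> 1"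
  shows "prob_space (contamination \<epsilon> P Q)"
    and "A \<in> sets P \<Longrightarrow> measure (contamination \<epsilon> P Q) A = (1 - \<epsilon>) * measure P A + \<epsilon> * measure Q A"
proof -
  interpret P: prob_space P by fact
  interpret Q: prob_space Q by fact
  have e: "emeasure (contamination \<epsilon> P Q) A = ennreal ((1 - \<epsilon>) * measure P A + \<epsilon> * measure Q A)" if "A \<in> sets P" for A
    using \<epsilon> by (simp add: emeasure_contamination[OF PQ that] P.emeasure_eq_measure Q.emeasure_eq_measure ennreal_mult' ennreal_plus)
  have "space Q = space P" using PQ by (rule sets_eq_imp_space_eq)
  then show "prob_space (contamination \<epsilon> P Q)"
    by (intro prob_spaceI) (use e[of "space P"] P.prob_space Q.prob_space in simp)
  show "measure (contamination \<epsilon> P Q) A = (1 - \<epsilon>) * measure P A + \<epsilon> * measure Q A" if "A \<in> sets P"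
    unfolding measure_def[of "contamination \<epsilon> P Q"] e[OF that]
    by (rule enn2real_ennreal) (use \<epsilon> in simp)
qed

text \<open>A threshold within the factor \<open>1 \<plusminus> \<beta>\<close> of the median is nearly a median, by the Lipschitz bound. The
left side loses \<open>3/2 * \<beta> / (1 - \<beta>) \<le> 3 * \<beta>\<close>. The Lipschitz bound is only asked for when \<open>\<beta> \<noteq> 0\<close>, since it
fails in low dimensions, where no bias occurs.\<close>

lemma near_median_mass:
  assumes P: "prob_space P" "sets P = sets (Rn p)" and med: "marginal_cdf p P \<Gamma> u 1 = 1 / 2"
    and q: "quad_form p \<Gamma> u > 0" and \<beta>: "0 \<le> \<beta>" "\<beta> \<le> 1 / 2"
    and lip: "\<And>s t. \<beta> \<noteq> 0 \<Longrightarrow> 0 < s \<Longrightarrow> s < t \<Longrightarrow>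
        marginal_cdf p P \<Gamma> u t - marginal_cdf p P \<Gamma> u s \<le> 3 / 2 * ((t - s) / s)"
    and c: "\<bar>c - quad_form p \<Gamma> u\<bar> \<le> \<beta> * quad_form p \<Gamma> u"
  shows "measure P {x\<in>space P. \<bar>dot p u x\<bar>\<^sup>2 \<le> c} \<ge> 1 / 2 - 3 * \<beta>"
    and "measure P {x\<in>space P. \<bar>dot p u x\<bar>\<^sup>2 \<ge> c} \<ge> 1 / 2 - 3 * \<beta>"
proof -
  interpret prob_space P by fact
  have [measurable]: "dot p u \<in> borel_measurable P"
    using dot_measurable[of p u] P(2) by (simp cong: measurable_cong_sets)
  let ?G = "marginal_cdf p P \<Gamma> u" and ?q = "quad_form p \<Gamma> u"
  have lo: "?G (1 - \<beta>) \<ge> 1 / 2 - 3 * \<beta>"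
  proof (cases "\<beta> = 0")
    case False
    then have "?G 1 - ?G (1 - \<beta>) \<le> 3 / 2 * ((1 - (1 - \<beta>)) / (1 - \<beta>))" using \<beta> by (intro lip) auto
    also have "(1 - (1 - \<beta>)) / (1 - \<beta>) \<le> 2 * \<beta>"
    proof -
      have "\<beta> * 1 \<le> \<beta> * (2 * (1 - \<beta>))" using \<beta> by (intro mult_left_mono) auto
      then have "\<beta> \<le> 2 * \<beta> * (1 - \<beta>)" by (simp only: mult_1_right mult_ac)
      then have "\<beta> / (1 - \<beta>) \<le> 2 * \<beta>" using \<beta> by (subst pos_divide_le_eq) auto
      then show ?thesis by simp
    qed
    finally show ?thesis using med by simp
  qed (use med in simp)
  have hi: "?G (1 + \<beta>) \<le> 1 / 2 + 3 * \<beta>"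
  proof (cases "\<beta> = 0")
    case False
    then have "?G (1 + \<beta>) - ?G 1 \<le> 3 / 2 * ((1 + \<beta> - 1) / 1)" using \<beta> by (intro lip) auto
    then show ?thesis using med \<beta> by simp
  qed (use med in simp)
  have "?G (1 - \<beta>) \<le> measure P {x\<in>space P. \<bar>dot p u x\<bar>\<^sup>2 \<le> c}"
    unfolding marginal_cdf_le_eq[OF q]
  proof (rule finite_measure_mono)
    have "(1 - \<beta>) * ?q \<le> c" using c by (simp add: left_diff_distrib abs_le_iff)
    then show "{x\<in>space P. \<bar>dot p u x\<bar>\<^sup>2 \<le> (1 - \<beta>) * ?q} \<subseteq> {x\<in>space P. \<bar>dot p u x\<bar>\<^sup>2 \<le> c}" by auto
  qed measurable
  then show "measure P {x\<in>space P. \<bar>dot p u x\<bar>\<^sup>2 \<le> c} \<ge> 1 / 2 - 3 * \<beta>" using lo by linarith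
  have "1 - ?G (1 + \<beta>) = measure P (space P - {x\<in>space P. \<bar>dot p u x\<bar>\<^sup>2 \<le> (1 + \<beta>) * ?q})"
    unfolding marginal_cdf_le_eq[OF q] by (rule prob_compl[symmetric]) measurable
  also have "\<dots> \<le> measure P {x\<in>space P. \<bar>dot p u x\<bar>\<^sup>2 \<ge> c}"
  proof (rule finite_measure_mono)
    have "c \<le> (1 + \<beta>) * ?q" using c by (simp add: distrib_right abs_le_iff)
    then show "space P - {x\<in>space P. \<bar>dot p u x\<bar>\<^sup>2 \<le> (1 + \<beta>) * ?q} \<subseteq> {x\<in>space P. \<bar>dot p u x\<bar>\<^sup>2 \<ge> c}" by auto
  qed measurable
  finally show "measure P {x\<in>space P. \<bar>dot p u x\<bar>\<^sup>2 \<ge> c} \<ge> 1 / 2 - 3 * \<beta>" using hi by linarith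
qed

text \<open>The comparison of the maximizer with a competitor \<open>\<Gamma>\<^sub>0\<close> close to \<open>\<Gamma>\<close>: population depth of \<open>\<Gamma>\<^sub>0\<close>, sample depth
of \<open>\<Gamma>\<^sub>0\<close>, sample depth of the maximizer, population depth of the maximizer. Each passage between sample and
population costs \<open>s\<close>. Contamination only lowers masses to a multiple \<open>1 - \<epsilon>\<close> on the way in, and adds
at most \<open>\<epsilon>\<close> on the way out.\<close>

lemma maximizer_ratio_bound:
  fixes n p k :: nat and \<epsilon> \<tau> \<kappa> \<beta> s :: real
  assumes n: "n > 0" and p: "p > 0" and k: "k > 0" and P: "prob_space P" "sets P = sets (Rn p)"
    and Q: "prob_space Q" "sets Q = sets (Rn p)" and \<epsilon>: "0 \<le> \<epsilon>" "\<epsilon> < 1"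
    and mc: "marginal_condition p P \<Gamma> \<tau> \<alpha>\<^sub>0 \<kappa>" and pos: "\<alpha>\<^sub>0 > 0" "\<kappa> > 0"
    and med: "\<And>u. u \<in> unit_sphere p \<Longrightarrow> marginal_cdf p P \<Gamma> u 1 = 1 / 2"
    and q: "\<And>u. u \<in> unit_sphere p \<Longrightarrow> quad_form p \<Gamma> u > 0" and \<beta>: "0 \<le> \<beta>" "\<beta> \<le> 1 / 2"
    and lip: "\<And>u s t. u \<in> unit_sphere p \<Longrightarrow> \<beta> \<noteq> 0 \<Longrightarrow> 0 < s \<Longrightarrow> s < t \<Longrightarrow>
        marginal_cdf p P \<Gamma> u t - marginal_cdf p P \<Gamma> u s \<le> 3 / 2 * ((t - s) / s)"
    and \<Gamma>\<^sub>0: "\<Gamma>\<^sub>0 \<in> banded p k"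
      "\<And>u. u \<in> unit_sphere p \<Longrightarrow> \<bar>quad_form p \<Gamma>\<^sub>0 u - quad_form p \<Gamma> u\<bar> \<le> \<beta> * quad_form p \<Gamma> u"
    and max: "is_depth_maximizer p n k \<Gamma>\<^sub>h X"
    and dev: "\<And>u c. u \<in> directions p k \<Longrightarrow> 0 \<le> c \<Longrightarrow> slab_counts_within n p (contamination \<epsilon> P Q) X u c (n * s)"
    and s: "0 \<le> s"
  defines "e \<equiv> 3 * \<beta> + (\<epsilon> + 2 * s) / (1 - \<epsilon>)"
  assumes e: "e < \<tau>" and u: "u \<in> directions p k"
  shows "\<bar>quad_form p \<Gamma>\<^sub>h u - quad_form p \<Gamma> u\<bar> \<le> e * sqrt \<kappa> * quad_form p \<Gamma> u"
proof -
  note dev = dev[unfolded space_contamination, THEN conjunct1] dev[unfolded space_contamination, THEN conjunct2]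
  let ?M = "contamination \<epsilon> P Q"
  have PQ: "sets Q = sets P" using P(2) Q(2) by simp
  note cont = measure_contamination[OF P(1) Q(1) PQ \<epsilon>(1) less_imp_le[OF \<epsilon>(2)]]
  have Lm: "{x\<in>space P. \<bar>dot p u x\<bar>\<^sup>2 \<le> c} \<in> sets P" "{x\<in>space P. \<bar>dot p u x\<bar>\<^sup>2 \<ge> c} \<in> sets P" for u c
  proof -
    have [measurable]: "dot p u \<in> borel_measurable P"
      using dot_measurable[of p u] P(2) by (simp cong: measurable_cong_sets)
    show "{x\<in>space P. \<bar>dot p u x\<bar>\<^sup>2 \<le> c} \<in> sets P" "{x\<in>space P. \<bar>dot p u x\<bar>\<^sup>2 \<ge> c} \<in> sets P" by measurable
  qed
  have lower: "(1 - \<epsilon>) * measure P A \<le> measure ?M A" if "A \<in> sets P" for A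
    using cont(2)[OF that] \<epsilon> by simp
  have upper: "measure ?M A \<le> (1 - \<epsilon>) * measure P A + \<epsilon>" if "A \<in> sets P" for A
  proof -
    have "\<epsilon> * measure Q A \<le> \<epsilon> * 1" using \<epsilon> prob_space.prob_le_1[OF Q(1)] by (intro mult_left_mono) auto
    then show ?thesis using cont(2)[OF that] by simp
  qed
  have emp: "measure ?M A - s \<le> 1 / n * F" "1 / n * F \<le> measure ?M A + s" if "\<bar>F - n * measure ?M A\<bar> \<le> n * s" for F A
  proof -
    have "n * (measure ?M A - s) \<le> F" "F \<le> n * (measure ?M A + s)"
      using that unfolding abs_le_iff right_diff_distrib distrib_left by linarith+
    then show "measure ?M A - s \<le> 1 / n * F" "1 / n * F \<le> measure ?M A + s" using n by (simp_all add: field_simps)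
  qed
  \<comment> \<open>A lower bound for the sample depth of the competitor.\<close>
  define d where "d = (1 - \<epsilon>) * (1 / 2 - 3 * \<beta>) - s"
  have "d \<le> matrix_depth p n (directions p k) \<Gamma>\<^sub>0 X"
  proof (rule matrix_depth_ge[OF directions_nonempty[OF p k]])
    fix v assume v: "v \<in> directions p k"
    then have v1: "v \<in> unit_sphere p" using directions_subset by blast
    have c0: "0 \<le> quad_form p \<Gamma>\<^sub>0 v" using \<Gamma>\<^sub>0(1) by (auto simp: banded_def intro: psd_quad_form_nonneg)
    note mass = near_median_mass[OF P med[OF v1] q[OF v1] \<beta> lip[OF v1] \<Gamma>\<^sub>0(2)[OF v1]]
    have m: "d \<le> measure ?M A - s" if "A \<in> sets P" "1 / 2 - 3 * \<beta> \<le> measure P A" for A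
    proof -
      have "(1 - \<epsilon>) * (1 / 2 - 3 * \<beta>) \<le> (1 - \<epsilon>) * measure P A" using that(2) \<epsilon> by (intro mult_left_mono) auto
      then show ?thesis using lower[OF that(1)] by (simp add: d_def)
    qed
    show "d \<le> 1 / real n * (\<Sum>i=1..n. of_bool (\<bar>dot p v (X i)\<bar>\<^sup>2 \<le> quad_form p \<Gamma>\<^sub>0 v))"
      by (rule order.trans[OF m[OF Lm(1) mass(1)] emp(1)[OF dev(1)[OF v c0]]])
    show "d \<le> 1 / real n * (\<Sum>i=1..n. of_bool (\<bar>dot p v (X i)\<bar>\<^sup>2 \<ge> quad_form p \<Gamma>\<^sub>0 v))"
      by (rule order.trans[OF m[OF Lm(2) mass(2)] emp(1)[OF dev(2)[OF v c0]]])
  qed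
  also have "\<dots> \<le> matrix_depth p n (directions p k) \<Gamma>\<^sub>h X" using max \<Gamma>\<^sub>0(1) by (simp add: is_depth_maximizer_def)
  finally have dh: "d \<le> matrix_depth p n (directions p k) \<Gamma>\<^sub>h X" .
  have u1: "u \<in> unit_sphere p" using u directions_subset by blast
  have ch: "0 \<le> quad_form p \<Gamma>\<^sub>h u"
    using max by (auto simp: is_depth_maximizer_def banded_def intro: psd_quad_form_nonneg)
  have mass: "1 / 2 - e \<le> measure P A" if "A \<in> sets P" "d \<le> measure ?M A + s" for A
  proof -
    have "(1 - \<epsilon>) * (1 / 2 - 3 * \<beta>) - (\<epsilon> + 2 * s) \<le> (1 - \<epsilon>) * measure P A"
      using upper[OF that(1)] that(2) by (simp add: d_def)
    moreover have "(1 - \<epsilon>) * (1 / 2 - e) = (1 - \<epsilon>) * (1 / 2 - 3 * \<beta>) - (\<epsilon> + 2 * s)"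
    proof -
      have "(1 - \<epsilon>) * (1 / 2 - e) = (1 - \<epsilon>) * (1 / 2 - 3 * \<beta>) - (1 - \<epsilon>) * ((\<epsilon> + 2 * s) / (1 - \<epsilon>))"
        unfolding e_def by (simp only: diff_diff_eq[symmetric] right_diff_distrib)
      then show ?thesis using \<epsilon> by simp
    qed
    ultimately have "(1 - \<epsilon>) * (1 / 2 - e) \<le> (1 - \<epsilon>) * measure P A" by simp
    then show ?thesis using \<epsilon> by (simp only: mult_le_cancel_left_pos diff_gt_0_iff_gt)
  qed
  define \<rho> where "\<rho> = quad_form p \<Gamma>\<^sub>h u / quad_form p \<Gamma> u"
  have \<rho>: "\<rho> * quad_form p \<Gamma> u = quad_form p \<Gamma>\<^sub>h u" using q[OF u1] by (simp add: \<rho>_def)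
  have e0: "0 \<le> e" using \<beta> \<epsilon> s by (simp add: e_def)
  have "\<bar>\<rho> - 1\<bar> \<le> e * sqrt \<kappa>"
  proof (rule ratio_close_from_depth[OF P mc u1 pos med[OF u1] q[OF u1] e0 e], unfold \<rho>)
    show "1 / 2 - e \<le> measure P {x\<in>space P. \<bar>dot p u x\<bar>\<^sup>2 \<le> quad_form p \<Gamma>\<^sub>h u}"
      by (rule mass[OF Lm(1)], rule order.trans[OF dh order.trans[OF matrix_depth_le(1)[OF u] emp(2)[OF dev(1)[OF u ch]]]])
    show "1 / 2 - e \<le> measure P {x\<in>space P. \<bar>dot p u x\<bar>\<^sup>2 \<ge> quad_form p \<Gamma>\<^sub>h u}"
      by (rule mass[OF Lm(2)], rule order.trans[OF dh order.trans[OF matrix_depth_le(2)[OF u] emp(2)[OF dev(2)[OF u ch]]]])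
  qed
  then have "\<bar>\<rho> - 1\<bar> * quad_form p \<Gamma> u \<le> e * sqrt \<kappa> * quad_form p \<Gamma> u"
    using q[OF u1] by (intro mult_right_mono) auto
  moreover have "\<bar>\<rho> - 1\<bar> * quad_form p \<Gamma> u = \<bar>quad_form p \<Gamma>\<^sub>h u - quad_form p \<Gamma> u\<bar>"
  proof -
    have "\<bar>\<rho> - 1\<bar> * quad_form p \<Gamma> u = \<bar>(\<rho> - 1) * quad_form p \<Gamma> u\<bar>" using q[OF u1] by (simp add: abs_mult)
    then show ?thesis by (simp add: left_diff_distrib \<rho>)
  qed
  ultimately show ?thesis by simp
qed

section \<open>The error bound\<close>

text \<open>Squaring the error costs the constants \<open>3\<close> and \<open>2\<close> for sums of three and two terms. The part of
the bias without the factor \<open>\<kappa>\<close> is compensated by \<open>9 / 4 * \<kappa> \<ge> 1\<close>. The number \<open>331776\<close> is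
\<open>9 * 192\<^sup>2\<close>, the squared constant of the deviation bound times the constant in \<open>bandwidth_rate\<close>.\<close>

lemma squared_error_arith:
  fixes A B e \<beta> \<epsilon> s r \<kappa> M M\<^sub>0 m x :: real
  assumes nn: "0 \<le> \<beta>" "0 \<le> \<epsilon>" "0 \<le> s" "0 \<le> r" "0 \<le> A" "0 \<le> B" "0 < \<kappa>" "0 < M" "0 < m" "0 \<le> e" "0 \<le> x"
    and e: "e \<le> 3 * \<beta> + 6 / 5 * (\<epsilon> + 2 * s)" and \<beta>: "\<beta> = r / m" and r: "r\<^sup>2 \<le> M\<^sub>0\<^sup>2 * A"
    and \<kappa>: "r \<noteq> 0 \<Longrightarrow> 4 / 9 \<le> \<kappa>" and s: "s\<^sup>2 \<le> 331776 * (A + B)"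
    and x: "x \<le> 3 * (e * sqrt \<kappa> * M) + 4 * r"
  shows "x\<^sup>2 \<le> (486 * M\<^sup>2 * M\<^sub>0\<^sup>2 / m\<^sup>2 + 72 * M\<^sub>0\<^sup>2 + 90 * M\<^sup>2 + 324 * 331776 * M\<^sup>2) * \<kappa> * (max A (\<epsilon>\<^sup>2) + B)"
proof -
  define T where "T = max A (\<epsilon>\<^sup>2) + B"
  have T: "A \<le> T" "\<epsilon>\<^sup>2 \<le> T" "A + B \<le> T" "0 \<le> T" using nn by (auto simp: T_def)
  have sq2: "(a + b)\<^sup>2 \<le> 2 * a\<^sup>2 + 2 * b\<^sup>2" for a b :: real
    using sum_squares_bound[of a b] by (simp add: power2_sum)
  have sq3: "(a + b + c)\<^sup>2 \<le> 3 * a\<^sup>2 + 3 * b\<^sup>2 + 3 * c\<^sup>2" for a b c :: real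
    using sum_squares_bound[of a b] sum_squares_bound[of a c] sum_squares_bound[of b c]
    by (simp add: power2_sum algebra_simps power2_eq_square)
  have "e \<le> 3 * \<beta> + 6 / 5 * \<epsilon> + 12 / 5 * s" using e by argo
  then have "e\<^sup>2 \<le> (3 * \<beta> + 6 / 5 * \<epsilon> + 12 / 5 * s)\<^sup>2" using nn by (intro power_mono) auto
  also have "\<dots> \<le> 3 * (3 * \<beta>)\<^sup>2 + 3 * (6 / 5 * \<epsilon>)\<^sup>2 + 3 * (12 / 5 * s)\<^sup>2" by (rule sq3)
  also have "\<dots> = 27 * \<beta>\<^sup>2 + 108 / 25 * \<epsilon>\<^sup>2 + 432 / 25 * s\<^sup>2" by (simp add: power_mult_distrib power_divide)
  also have "\<dots> \<le> 27 * (M\<^sub>0\<^sup>2 / m\<^sup>2 * T) + 5 * T + 18 * (331776 * T)"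
  proof -
    have "\<beta>\<^sup>2 = r\<^sup>2 / m\<^sup>2" by (simp add: \<beta> power_divide)
    also have "\<dots> \<le> M\<^sub>0\<^sup>2 * T / m\<^sup>2"
      using r mult_left_mono[OF T(1), of "M\<^sub>0\<^sup>2"] by (intro divide_right_mono) auto
    finally have 1: "\<beta>\<^sup>2 \<le> M\<^sub>0\<^sup>2 / m\<^sup>2 * T" by simp
    have 2: "s\<^sup>2 \<le> 331776 * T" using s T(3) by argo
    have "108 / 25 * \<epsilon>\<^sup>2 \<le> 5 * T" using T(2,4) zero_le_power2[of \<epsilon>] by argo
    moreover have "432 / 25 * s\<^sup>2 \<le> 18 * (331776 * T)" using 2 T(4) by argo
    ultimately show ?thesis using 1 by argo
  qed
  finally have e2: "e\<^sup>2 \<le> (27 * (M\<^sub>0\<^sup>2 / m\<^sup>2) + 5 + 18 * 331776) * T" by (simp add: algebra_simps)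
  have r2: "r\<^sup>2 \<le> 9 / 4 * \<kappa> * (M\<^sub>0\<^sup>2 * T)"
  proof (cases "r = 0")
    case True
    then show ?thesis using nn T by simp
  next
    case False
    have "r\<^sup>2 \<le> 1 * (M\<^sub>0\<^sup>2 * T)" using r mult_left_mono[OF T(1), of "M\<^sub>0\<^sup>2"] by simp
    also have "\<dots> \<le> 9 / 4 * \<kappa> * (M\<^sub>0\<^sup>2 * T)" using \<kappa>[OF False] T by (intro mult_right_mono) auto
    finally show ?thesis .
  qed
  have "x\<^sup>2 \<le> (3 * (e * sqrt \<kappa> * M) + 4 * r)\<^sup>2" using nn x by (intro power_mono) auto
  also have "\<dots> \<le> 2 * (3 * (e * sqrt \<kappa> * M))\<^sup>2 + 2 * (4 * r)\<^sup>2" by (rule sq2)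
  also have "\<dots> = 18 * \<kappa> * M\<^sup>2 * e\<^sup>2 + 32 * r\<^sup>2" using nn by (simp add: power_mult_distrib)
  also have "\<dots> \<le> 18 * \<kappa> * M\<^sup>2 * ((27 * (M\<^sub>0\<^sup>2 / m\<^sup>2) + 5 + 18 * 331776) * T) + 32 * (9 / 4 * \<kappa> * (M\<^sub>0\<^sup>2 * T))"
    using e2 r2 nn by (intro add_mono mult_left_mono) auto
  also have "\<dots> = (486 * M\<^sup>2 * M\<^sub>0\<^sup>2 / m\<^sup>2 + 72 * M\<^sub>0\<^sup>2 + 90 * M\<^sup>2 + 324 * 331776 * M\<^sup>2) * \<kappa> * T"
    by (simp add: algebra_simps)
  finally show ?thesis by (simp only: T_def)
qed

text \<open>The truncation competes with the estimator only if it is positive semidefinite, which has to be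
ensured separately, by a small bias.\<close>

lemma truncate_banded:
  assumes psd: "psd p \<Gamma>" and nn: "\<And>u. 0 \<le> quad_form p (truncate k \<Gamma>) u"
  shows "truncate k \<Gamma> \<in> banded p k"
  using psd nn by (auto simp: banded_def psd_def truncate_def abs_minus_commute)

text \<open>The choice \<open>k = n powr (1 / (2 * \<alpha> + 1))\<close> balances the squared bias \<open>k powr (- 2 * \<alpha>)\<close> with the
variance \<open>k / n\<close>; up to rounding both equal \<open>N / n\<close>. The last bound covers both branches of the minimum \<open>R\<close>.\<close>

lemma bandwidth_rate:
  fixes \<alpha> :: real and n p :: nat
  assumes \<alpha>: "\<alpha> > 0" and n: "n > 0" and p: "p > 0"
  defines "N \<equiv> real n powr (1 / (2 * \<alpha> + 1))"
  defines "k \<equiv> min (nat \<lceil>N\<rceil>) p" and "R \<equiv> min (N + ln p) (real p)"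
  shows "1 \<le> N" "real n powr (- (2 * \<alpha>) / (2 * \<alpha> + 1)) = N / n" "N powr (2 * \<alpha>) = n / N"
    "0 < k" "1 \<le> R" "k < p \<Longrightarrow> N \<le> k \<and> N \<le> R"
    "0 < \<delta> \<Longrightarrow> \<delta> < 1 \<Longrightarrow> real (min (2 * k) p) + 1 + ln (16 * p / \<delta>) \<le> 9 * (R + ln (1 / \<delta>))"
proof -
  show N1: "1 \<le> N" unfolding N_def using n \<alpha> by (intro ge_one_powr_ge_zero) auto
  have a: "- (2 * \<alpha>) / (2 * \<alpha> + 1) = 1 / (2 * \<alpha> + 1) - 1" using \<alpha> by (simp add: field_simps)
  show "real n powr (- (2 * \<alpha>) / (2 * \<alpha> + 1)) = N / n"
    unfolding a N_def using n by (simp add: powr_diff)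
  have b: "2 * \<alpha> / (2 * \<alpha> + 1) = 1 - 1 / (2 * \<alpha> + 1)" using \<alpha> by (simp add: field_simps)
  have "N powr (2 * \<alpha>) = real n powr (2 * \<alpha> / (2 * \<alpha> + 1))" by (simp add: N_def powr_powr)
  also have "\<dots> = n / N" unfolding b N_def using n by (simp add: powr_diff)
  finally show "N powr (2 * \<alpha>) = n / N" .
  have c1: "1 \<le> \<lceil>N\<rceil>" using N1 by linarith
  show k0: "0 < k" using c1 p by (simp add: k_def)
  have lnp: "0 \<le> ln (real p)" using p by simp
  have p1: "1 \<le> real p" using p by simp
  show R1: "1 \<le> R" unfolding R_def by (rule min.boundedI) (use N1 lnp p1 in linarith)+
  show "N \<le> k \<and> N \<le> R" if "k < p"
  proof -
    have "N \<le> k" using that c1 by (simp add: k_def min_def split: if_splits)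
    moreover have "real k \<le> p" using that by simp
    ultimately show ?thesis using lnp by (simp add: R_def)
  qed
  show "real (min (2 * k) p) + 1 + ln (16 * p / \<delta>) \<le> 9 * (R + ln (1 / \<delta>))" if \<delta>: "0 < \<delta>" "\<delta> < 1"
  proof -
    \<comment> \<open>With \<open>2 * k \<le> 4 * N\<close> and \<open>1 + ln 16 \<le> 4.6\<close>, either branch of \<open>R\<close> gives the constant \<open>9\<close>.\<close>
    have l16: "ln (16 :: real) \<le> 36 / 10" using ln_2_ln_4(1) ln_realpow[of "2::real" 4] by simp
    have "ln (16 * p / \<delta>) = ln 16 + ln p + ln (1 / \<delta>)" using p \<delta> by (simp add: ln_div ln_mult)
    moreover have ld: "0 \<le> ln (1 / \<delta>)" using \<delta> by simp
    moreover have "real (min (2 * k) p) + 1 + ln 16 + ln p \<le> 9 * R"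
    proof -
      have "real (nat \<lceil>N\<rceil>) = of_int \<lceil>N\<rceil>" using c1 by simp
      then have "real (nat \<lceil>N\<rceil>) \<le> N + 1" using of_int_ceiling_le_add_one[of N] by simp
      moreover have "real k \<le> real (nat \<lceil>N\<rceil>)" by (simp add: k_def)
      ultimately have "real k \<le> N + 1" by linarith
      then have "real (min (2 * k) p) \<le> 4 * N" "real (min (2 * k) p) \<le> p" using N1 by (auto simp: min_def)
      moreover have "ln (real p) \<le> p" using p ln_le_minus_one[of "real p"] by simp
      moreover have "real p \<ge> 1" using p by simp
      moreover have "R = N + ln (real p) \<or> R = real p" unfolding R_def by linarith
      ultimately show ?thesis using N1 lnp l16 by argo
    qed
    ultimately show ?thesis by (simp add: algebra_simps)
  qed
qed

text \<open>The deterministic part of the theorem, for a sample on which all slab frequencies are accurate. The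
estimation error against the truncation is at most \<open>S + r\<close> in every admissible direction, where
\<open>S = e * sqrt \<kappa> * M\<close>, the block argument turns this into \<open>3 * (S + r)\<close>, and the bias \<open>r\<close> is added once more.\<close>

lemma scatter_error_bound:
  fixes n p k :: nat and \<epsilon> \<tau> \<kappa> m M r s :: real
  assumes n: "n > 0" and p: "p > 0" and k: "k > 0" and P: "elliptical p \<Gamma> \<eta> P"
    and Q: "prob_space Q" "sets Q = sets (Rn p)" and \<epsilon>: "0 \<le> \<epsilon>" "\<epsilon> < 1"
    and mc: "marginal_condition p P \<Gamma> \<tau> \<alpha>\<^sub>0 \<kappa>" and pos: "\<alpha>\<^sub>0 > 0" "\<kappa> > 0"
    and med: "\<And>u. u \<in> unit_sphere p \<Longrightarrow> marginal_cdf p P \<Gamma> u 1 = 1 / 2"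
    and psd: "psd p \<Gamma>" and m: "0 < m" "\<And>u. m * (enorm p u)\<^sup>2 \<le> quad_form p \<Gamma> u"
    and M: "0 < M" "\<And>u. quad_form p \<Gamma> u \<le> M * (enorm p u)\<^sup>2"
    and row: "\<And>j. j \<in> {1..p} \<Longrightarrow> (\<Sum>i\<in>{i\<in>{1..p}. \<bar>int i - int j\<bar> > int k}. \<bar>\<Gamma> i j\<bar>) \<le> r"
    and r: "0 \<le> r" "r / m \<le> 1 / 2" "r \<noteq> 0 \<Longrightarrow> p \<ge> 3"
    and max: "is_depth_maximizer p n k \<Gamma>\<^sub>h X"
    and dev: "\<And>u c. u \<in> directions p k \<Longrightarrow> 0 \<le> c \<Longrightarrow> slab_counts_within n p (contamination \<epsilon> P Q) X u c (n * s)"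
    and s: "0 \<le> s" and \<tau>: "0 < \<tau>"
  defines "e \<equiv> 3 * (r / m) + (\<epsilon> + 2 * s) / (1 - \<epsilon>)"
  assumes e: "e < \<tau>"
  shows "op_norm p (\<lambda>i j. \<Gamma>\<^sub>h i j - \<Gamma> i j) \<le> 3 * (e * sqrt \<kappa> * M) + 4 * r"
    and "r \<noteq> 0 \<Longrightarrow> 4 / 9 \<le> \<kappa>"
proof -
  note PP = elliptical_prob_space[OF P]
  have en: "(enorm p u)\<^sup>2 = 1" if "u \<in> unit_sphere p" for u using that by (simp add: unit_sphere_def)
  have pd: "quad_form p \<Gamma> u > 0" if u: "\<exists>i\<in>{1..p}. u i \<noteq> 0" for u
  proof -
    obtain i where i: "i \<in> {1..p}" "u i \<noteq> 0" using u by blast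
    have "0 < (\<Sum>i=1..p. (u i)\<^sup>2)" by (rule sum_pos2[OF _ i(1)]) (use i in auto)
    then have "0 < m * (enorm p u)\<^sup>2" using m(1) by (simp add: enorm_power2)
    then show ?thesis using m(2)[of u] by linarith
  qed
  have q: "quad_form p \<Gamma> u > 0" if "u \<in> unit_sphere p" for u using m(2)[of u] m(1) en[OF that] by simp
  have lip: "marginal_cdf p P \<Gamma> u t' - marginal_cdf p P \<Gamma> u s' \<le> 3 / 2 * ((t' - s') / s')"
    if "u \<in> unit_sphere p" "r \<noteq> 0" "0 < s'" "s' < t'" for u s' t'
    by (rule marginal_cdf_lipschitz[OF P PP psd_sym[OF psd] pd r(3)[OF that(2)] that(3,4) q[OF that(1)]])
  note trunc = truncation_quad_form_bound[OF psd_sym[OF psd] row]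
  \<comment> \<open>A bias below the least eigenvalue leaves the truncation positive semidefinite.\<close>
  have nn: "0 \<le> quad_form p (truncate k \<Gamma>) u" for u
  proof -
    have "r \<le> m" using r(2) m(1) by (simp add: pos_divide_le_eq)
    then have "r * (enorm p u)\<^sup>2 \<le> m * (enorm p u)\<^sup>2" by (intro mult_right_mono) auto
    then show ?thesis using trunc[of u] m(2)[of u] by linarith
  qed
  have T: "truncate k \<Gamma> \<in> banded p k" by (rule truncate_banded[OF psd nn])
  have Tq: "\<bar>quad_form p (truncate k \<Gamma>) u - quad_form p \<Gamma> u\<bar> \<le> r / m * quad_form p \<Gamma> u" if "u \<in> unit_sphere p" for u
  proof -
    have "r = r / m * (m * 1)" using m(1) by simp
    also have "\<dots> \<le> r / m * quad_form p \<Gamma> u" using m(2)[of u] r m(1) en[OF that] by (intro mult_left_mono) auto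
    finally show ?thesis using trunc[of u] en[OF that] by (simp add: abs_minus_commute)
  qed
  have e0: "0 \<le> e" unfolding e_def using r m \<epsilon> s by simp
  define S where "S = e * sqrt \<kappa> * M"
  have S: "0 \<le> S" unfolding S_def using e0 pos M by simp
  have dir: "\<bar>quad_form p \<Gamma>\<^sub>h u - quad_form p \<Gamma> u\<bar> \<le> S" if u: "u \<in> directions p k" for u
  proof -
    have u1: "u \<in> unit_sphere p" using u directions_subset by blast
    have "\<bar>quad_form p \<Gamma>\<^sub>h u - quad_form p \<Gamma> u\<bar> \<le> e * sqrt \<kappa> * quad_form p \<Gamma> u"
      unfolding e_def
      by (rule maximizer_ratio_bound[OF n p k PP Q \<epsilon> mc pos med q _ r(2) _ T Tq max dev s e[unfolded e_def] u])
         (use r m lip in auto)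
    also have "\<dots> \<le> S" unfolding S_def using M(2)[of u] en[OF u1] e0 pos by (intro mult_left_mono) auto
    finally show ?thesis .
  qed
  have \<Gamma>h: "\<Gamma>\<^sub>h \<in> banded p k" using max by (simp add: is_depth_maximizer_def)
  have "\<bar>quad_form p (\<lambda>i j. \<Gamma>\<^sub>h i j - truncate k \<Gamma> i j) u\<bar> \<le> 3 * (S + r) * (enorm p u)\<^sup>2" for u
  proof (rule banded_difference_bound[OF p k \<Gamma>h T])
    show "\<bar>quad_form p (\<lambda>i j. \<Gamma>\<^sub>h i j - truncate k \<Gamma> i j) u\<bar> \<le> S + r" if u: "u \<in> directions p k" for u
    proof -
      have "u \<in> unit_sphere p" using u directions_subset by blast
      then show ?thesis using dir[OF u] trunc[of u] en[of u] by (simp add: quad_form_diff)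
    qed
  qed (use S r in simp)
  then have "\<bar>quad_form p (\<lambda>i j. \<Gamma>\<^sub>h i j - \<Gamma> i j) u\<bar> \<le> (3 * S + 4 * r) * (enorm p u)\<^sup>2" for u
  proof -
    have "\<bar>quad_form p \<Gamma>\<^sub>h u - quad_form p (truncate k \<Gamma>) u\<bar> \<le> 3 * (S + r) * (enorm p u)\<^sup>2"
      using \<open>\<And>u. \<bar>quad_form p (\<lambda>i j. \<Gamma>\<^sub>h i j - truncate k \<Gamma> i j) u\<bar> \<le> 3 * (S + r) * (enorm p u)\<^sup>2\<close>[of u]
      by (simp only: quad_form_diff)
    moreover have "3 * (S + r) * (enorm p u)\<^sup>2 + r * (enorm p u)\<^sup>2 = (3 * S + 4 * r) * (enorm p u)\<^sup>2" by (simp add: algebra_simps)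
    ultimately show ?thesis unfolding quad_form_diff using trunc[of u] by linarith
  qed
  then show "op_norm p (\<lambda>i j. \<Gamma>\<^sub>h i j - \<Gamma> i j) \<le> 3 * (e * sqrt \<kappa> * M) + 4 * r"
    unfolding S_def[symmetric]
  proof (intro op_norm_le_quad_form[OF p])
    show "\<Gamma>\<^sub>h i j - \<Gamma> i j = \<Gamma>\<^sub>h j i - \<Gamma> j i" if "i \<in> {1..p}" "j \<in> {1..p}" for i j
      using psd_sym[OF psd that] \<Gamma>h psd_sym[of p \<Gamma>\<^sub>h, OF _ that] by (simp add: banded_def)
  qed (use S r in auto)
  show "4 / 9 \<le> \<kappa>" if r0: "r \<noteq> 0"
  proof -
    define u where "u = (\<lambda>i\<in>{1..p}. if i = 1 then 1 else 0 :: real)"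
    have u: "u \<in> unit_sphere p" unfolding u_def by (rule first_axis_in_unit_sphere[OF p])
    show ?thesis
    proof (rule kappa_lower_bound[OF mc u pos \<tau>])
      fix t :: real assume t: "0 < t"
      have "marginal_cdf p P \<Gamma> u (1 + t) - marginal_cdf p P \<Gamma> u 1 \<le> 3 / 2 * ((1 + t - 1) / 1)"
        by (rule lip[OF u r0]) (use t in auto)
      moreover have "marginal_cdf p P \<Gamma> u 1 \<le> marginal_cdf p P \<Gamma> u (1 + t)"
        by (rule marginal_cdf_mono[OF PP]) (use t in simp)
      ultimately show "\<bar>marginal_cdf p P \<Gamma> u 1 - marginal_cdf p P \<Gamma> u (1 + t)\<bar> \<le> 3 / 2 * t" by simp
    qed
  qed
qed

lemma op_norm_nonneg:
  assumes p: "p > 0"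
  shows "0 \<le> op_norm p B"
proof -
  have c: "continuous_on (unit_sphere p) (\<lambda>u. enorm p (mat_vec p p B u))"
  proof -
    have eq: "(\<lambda>u. enorm p (mat_vec p p B u)) = (\<lambda>u. sqrt (\<Sum>i=1..p. (\<Sum>j=1..p. B i j * u j)\<^sup>2))"
      by (simp add: enorm_def L2_set_def mat_vec_def)
    show ?thesis unfolding eq
      by (intro continuous_intros continuous_on_subset[OF continuous_on_product_coordinates]) auto
  qed
  have "compact ((\<lambda>u. enorm p (mat_vec p p B u)) ` unit_sphere p)"
    using c compact_unit_sphere by (rule compact_continuous_image)
  then have bdd: "bdd_above ((\<lambda>u. enorm p (mat_vec p p B u)) ` unit_sphere p)"
    by (intro bounded_imp_bdd_above compact_imp_bounded)
  show ?thesis unfolding op_norm_def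
    by (rule cSUP_upper2[OF bdd first_axis_in_unit_sphere[OF p] enorm_nonneg])
qed

text \<open>The smallness condition with \<open>C\<^sub>1\<close> is used three times, once for each summand of \<open>C\<^sub>1\<close>: if truncation
occurs then \<open>N > 2\<close> and hence \<open>p \<ge> 3\<close>; the deviation \<open>s\<close> is at most \<open>576 / 6000 * \<tau>\<close>; and the relative
bias is at most \<open>\<tau> / 12\<close>. With \<open>\<epsilon> < \<tau> / 3\<close> this keeps \<open>e\<close> below \<open>\<tau>\<close>.\<close>

theorem theorem4p3:
  fixes \<alpha> M M\<^sub>0 M_min \<tau> :: real
  assumes "\<alpha> > 0" and "M\<^sub>0 > 0" and "0 < M_min" and "M_min < M" and "0 < \<tau>" and "\<tau> < 1 / 2"
  shows "\<exists>C>0. \<exists>C\<^sub>1>0. \<forall>(n::nat) (p::nat) (\<alpha>\<^sub>0::real) (\<kappa>::real) (\<epsilon>::real).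
    n > 0 \<longrightarrow> p > 0 \<longrightarrow> \<alpha>\<^sub>0 > 0 \<longrightarrow> \<kappa> > 0 \<longrightarrow> 0 \<le> \<epsilon> \<longrightarrow> \<epsilon> < \<tau> / 3 \<longrightarrow>
    (let k = min (nat \<lceil>real n powr (1 / (2 * \<alpha> + 1))\<rceil>) p in
     \<forall>\<Gamma>hat. (\<forall>X\<in>space (iid_sample n (Rn p)). is_depth_maximizer p n k (\<Gamma>hat X) X) \<longrightarrow>
     (\<forall>\<delta>::real. 0 < \<delta> \<longrightarrow> \<delta> < 1 / 2 \<longrightarrow>
       C\<^sub>1 * ((min (real n powr (1 / (2 * \<alpha> + 1)) + ln (real p)) (real p) + ln (1 / \<delta>)) / real n) < 1 \<longrightarrow>
     (\<forall>\<Gamma>\<in>bandable_class p \<alpha> M M\<^sub>0 M_min. \<forall>\<eta> P Q.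
       canonical_elliptical p \<Gamma> \<eta> P \<longrightarrow> marginal_condition p P \<Gamma> \<tau> \<alpha>\<^sub>0 \<kappa> \<longrightarrow>
       prob_space Q \<longrightarrow> sets Q = sets (Rn p) \<longrightarrow>
       with_prob_at_least (iid_sample n (contamination \<epsilon> P Q)) (1 - 2 * \<delta>)
         (\<lambda>X. (op_norm p (\<lambda>i j. \<Gamma>hat X i j - \<Gamma> i j))\<^sup>2 \<le>
            C * \<kappa> * (max (min (real n powr (- (2 * \<alpha>) / (2 * \<alpha> + 1)) + ln (real p) / real n)
                             (real p / real n)) (\<epsilon>\<^sup>2)
                   + ln (1 / \<delta>) / real n)))))"
proof -
  define C where "C = 486 * M\<^sup>2 * M\<^sub>0\<^sup>2 / M_min\<^sup>2 + 72 * M\<^sub>0\<^sup>2 + 90 * M\<^sup>2 + 324 * 331776 * M\<^sup>2"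
  define C\<^sub>1 where "C\<^sub>1 = 2 powr (2 * \<alpha>) + (6000 / \<tau>)\<^sup>2 + (12 * M\<^sub>0 / (M_min * \<tau>))\<^sup>2"
  have M: "M > 0" using assms by simp
  have C: "C > 0" unfolding C_def using M by (intro add_nonneg_pos) auto
  have C1: "C\<^sub>1 > 0" "2 powr (2 * \<alpha>) \<le> C\<^sub>1" "(6000 / \<tau>)\<^sup>2 \<le> C\<^sub>1" "(12 * M\<^sub>0 / (M_min * \<tau>))\<^sup>2 \<le> C\<^sub>1"
    unfolding C\<^sub>1_def by (auto intro!: add_pos_nonneg)
  show ?thesis
  proof (rule exI[of _ C], rule conjI[OF C], rule exI[of _ C\<^sub>1], rule conjI[OF C1(1)], unfold Let_def, intro allI ballI impI)
    fix n p :: nat and \<alpha>\<^sub>0 \<kappa> \<epsilon> \<delta> :: real and \<Gamma>hat \<Gamma> \<eta> P Q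
    define N where "N = real n powr (1 / (2 * \<alpha> + 1))"
    define k where "k = min (nat \<lceil>N\<rceil>) p"
    define R where "R = min (N + ln (real p)) (real p)"
    assume n: "0 < n" and p: "0 < p" and pos: "0 < \<alpha>\<^sub>0" "0 < \<kappa>" and \<epsilon>: "0 \<le> \<epsilon>" "\<epsilon> < \<tau> / 3"
    assume "\<forall>X\<in>space (iid_sample n (Rn p)).
        is_depth_maximizer p n (min (nat \<lceil>real n powr (1 / (2 * \<alpha> + 1))\<rceil>) p) (\<Gamma>hat X) X"
    then have max: "is_depth_maximizer p n k (\<Gamma>hat X) X" if "X \<in> space (iid_sample n (Rn p))" for X
      using that by (simp add: k_def N_def)
    assume \<delta>: "0 < \<delta>" "\<delta> < 1 / 2"
    assume "C\<^sub>1 * ((min (real n powr (1 / (2 * \<alpha> + 1)) + ln (real p)) (real p) + ln (1 / \<delta>)) / real n) < 1"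
    then have small: "C\<^sub>1 * ((R + ln (1 / \<delta>)) / n) < 1" by (simp add: R_def N_def)
    assume \<Gamma>: "\<Gamma> \<in> bandable_class p \<alpha> M M\<^sub>0 M_min" and can: "canonical_elliptical p \<Gamma> \<eta> P"
      and mc: "marginal_condition p P \<Gamma> \<tau> \<alpha>\<^sub>0 \<kappa>" and Q: "prob_space Q" "sets Q = sets (Rn p)"
    have P: "elliptical p \<Gamma> \<eta> P" and med: "\<And>u. u \<in> unit_sphere p \<Longrightarrow> marginal_cdf p P \<Gamma> u 1 = 1 / 2"
      using can by (auto simp: canonical_elliptical_def)
    note PP = elliptical_prob_space[OF P]
    have \<epsilon>1: "\<epsilon> < 1" "1 - \<epsilon> \<ge> 5 / 6" using \<epsilon> assms by auto
    note rate = bandwidth_rate[OF assms(1) n p, folded N_def, folded k_def R_def]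
    have \<delta>1: "\<delta> < 1" using \<delta> by simp
    have ld: "0 \<le> ln (1 / \<delta>)" using \<delta> by simp
    define A where "A = R / n"
    define B where "B = ln (1 / \<delta>) / n"
    have AB: "0 \<le> A" "0 \<le> B" "C\<^sub>1 * (A + B) < 1"
      using rate(5) ld n small by (auto simp: A_def B_def add_divide_distrib)
    have psd: "psd p \<Gamma>" and smax: "s_max p \<Gamma> \<le> M" and smin: "M_min < s_min p \<Gamma>"
      and rows: "\<And>k::nat. k \<ge> 1 \<Longrightarrow> (MAX j\<in>{1..p}. \<Sum>i\<in>{i\<in>{1..p}. \<bar>int i - int j\<bar> > int k}. \<bar>\<Gamma> i j\<bar>) \<le> M\<^sub>0 * real k powr (- \<alpha>)"
      using \<Gamma> by (auto simp: bandable_class_def bounded_class_def)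
    have qlow: "M_min * (enorm p u)\<^sup>2 \<le> quad_form p \<Gamma> u" for u
      by (rule order.trans[OF _ quad_form_singular_value_bounds(1)[OF psd p]]) (use smin in \<open>auto intro: mult_right_mono\<close>)
    have qup: "quad_form p \<Gamma> u \<le> M * (enorm p u)\<^sup>2" for u
      by (rule order.trans[OF quad_form_singular_value_bounds(2)[OF psd p]]) (use smax in \<open>auto intro: mult_right_mono\<close>)
    \<comment> \<open>For \<open>k = p\<close> the truncation is the identity.\<close>
    define r where "r = (if k < p then M\<^sub>0 * real k powr (- \<alpha>) else 0)"
    have r0: "0 \<le> r" using assms by (simp add: r_def)
    have row: "(\<Sum>i\<in>{i\<in>{1..p}. \<bar>int i - int j\<bar> > int k}. \<bar>\<Gamma> i j\<bar>) \<le> r" if j: "j \<in> {1..p}" for j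
    proof (cases "k < p")
      case True
      have "(\<Sum>i\<in>{i\<in>{1..p}. \<bar>int i - int j\<bar> > int k}. \<bar>\<Gamma> i j\<bar>)
          \<le> (MAX j\<in>{1..p}. \<Sum>i\<in>{i\<in>{1..p}. \<bar>int i - int j\<bar> > int k}. \<bar>\<Gamma> i j\<bar>)"
        by (rule Max_ge) (use j in auto)
      also have "\<dots> \<le> r" using rows[of k] rate(4) True by (simp add: r_def)
      finally show ?thesis .
    next
      case False
      then have empty: "{i\<in>{1..p}. \<bar>int i - int j\<bar> > int k} = {}" using j by auto
      show ?thesis unfolding empty using r0 by simp
    qed
    \<comment> \<open>The squared bias \<open>M\<^sub>0\<^sup>2 * N powr (- 2 * \<alpha>)\<close> is \<open>M\<^sub>0\<^sup>2 * N / n\<close> by the choice of \<open>N\<close>.\<close>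
    have r2: "r\<^sup>2 \<le> M\<^sub>0\<^sup>2 * A"
    proof (cases "k < p")
      case True
      note NR = rate(6)[OF True]
      have "r \<le> M\<^sub>0 * N powr (- \<alpha>)"
        using True NR rate(1) assms by (auto simp: r_def intro!: mult_left_mono powr_mono2')
      then have "r\<^sup>2 \<le> (M\<^sub>0 * N powr (- \<alpha>))\<^sup>2" using r0 by (intro power_mono)
      also have "\<dots> = M\<^sub>0\<^sup>2 * (1 / N powr (2 * \<alpha>))"
        by (simp add: power_mult_distrib powr_minus_divide power_divide power2_eq_square flip: powr_add)
      also have "1 / N powr (2 * \<alpha>) = N / n" unfolding rate(3) by simp
      also have "M\<^sub>0\<^sup>2 * (N / n) \<le> M\<^sub>0\<^sup>2 * A" unfolding A_def using NR by (intro mult_left_mono divide_right_mono) auto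
      finally show ?thesis .
    qed (use AB in \<open>simp add: r_def\<close>)
    \<comment> \<open>The first summand of \<open>C\<^sub>1\<close>: the condition gives \<open>2 powr (2 * \<alpha>) * N < n\<close>, that is \<open>N > 2\<close>.\<close>
    have p3: "p \<ge> 3" if "r \<noteq> 0"
    proof -
      have kp: "k < p" using that by (auto simp: r_def split: if_splits)
      note NR = rate(6)[OF kp]
      have "C\<^sub>1 * (N / n) \<le> C\<^sub>1 * (A + B)"
        using C1(1) AB NR unfolding A_def by (intro mult_left_mono add_increasing2 divide_right_mono) auto
      then have "C\<^sub>1 * (N / n) < 1" using AB(3) by linarith
      then have "C\<^sub>1 * N < n" using n by (simp add: pos_divide_less_eq)
      then have "C\<^sub>1 < N powr (2 * \<alpha>)" unfolding rate(3) using rate(1) by (simp add: pos_less_divide_eq)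
      then have "2 powr (2 * \<alpha>) < N powr (2 * \<alpha>)" using C1(2) by linarith
      then have "2 < N" using assms(1) rate(1) powr_mono2[of "2 * \<alpha>" N 2] by (cases "2 < N") auto
      then have "2 < k" using NR by linarith
      then show ?thesis using kp by linarith
    qed
    have \<beta>12: "r / M_min \<le> \<tau> / 12"
    proof -
      have "(r / M_min)\<^sup>2 = r\<^sup>2 / M_min\<^sup>2" by (simp add: power_divide)
      also have "\<dots> \<le> M\<^sub>0\<^sup>2 * (A + B) / M_min\<^sup>2"
        using r2 AB mult_left_mono[of A "A + B" "M\<^sub>0\<^sup>2"] by (intro divide_right_mono) auto
      also have "\<dots> = (\<tau> / 12)\<^sup>2 * ((12 * M\<^sub>0 / (M_min * \<tau>))\<^sup>2 * (A + B))"
        using assms by (simp add: power_divide power_mult_distrib)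
      also have "\<dots> \<le> (\<tau> / 12)\<^sup>2 * (C\<^sub>1 * (A + B))" using C1(4) AB by (intro mult_left_mono mult_right_mono) auto
      also have "\<dots> \<le> (\<tau> / 12)\<^sup>2 * 1" using AB by (intro mult_left_mono) auto
      finally have "(r / M_min)\<^sup>2 \<le> (\<tau> / 12)\<^sup>2" by simp
      then show ?thesis by (rule power2_le_imp_le) (use assms in simp)
    qed
    define t where "t = 192 * sqrt (n * (real (min (2 * k) p) + 1 + ln (16 * p / \<delta>)))"
    define s where "s = t / n"
    have arg0: "0 \<le> real (min (2 * k) p) + 1 + ln (16 * p / \<delta>)"
      using p \<delta> by (intro add_nonneg_nonneg ln_ge_zero) (auto simp: le_divide_eq)
    have s0: "0 \<le> s" unfolding s_def t_def using arg0 by simp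
    have s2: "s\<^sup>2 \<le> 331776 * (A + B)"
    proof -
      have "s\<^sup>2 = 36864 * (n * (real (min (2 * k) p) + 1 + ln (16 * p / \<delta>))) / n\<^sup>2"
        using arg0 by (simp add: s_def t_def power_divide power_mult_distrib)
      also have "\<dots> = 36864 * ((real (min (2 * k) p) + 1 + ln (16 * p / \<delta>)) / n)"
        using n by (simp add: power2_eq_square)
      also have "\<dots> \<le> 36864 * (9 * (R + ln (1 / \<delta>)) / n)"
        by (intro mult_left_mono divide_right_mono rate(7) \<delta>(1) \<delta>1) auto
      also have "\<dots> = 331776 * (A + B)" by (simp add: A_def B_def add_divide_distrib)
      finally show ?thesis .
    qed
    have s\<tau>: "s \<le> 576 * \<tau> / 6000"
    proof -
      have "s\<^sup>2 \<le> (576 * \<tau> / 6000)\<^sup>2 * ((6000 / \<tau>)\<^sup>2 * (A + B))"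
        using s2 assms by (simp add: power_divide power_mult_distrib)
      also have "\<dots> \<le> (576 * \<tau> / 6000)\<^sup>2 * (C\<^sub>1 * (A + B))" using C1(3) AB by (intro mult_left_mono mult_right_mono) auto
      also have "\<dots> \<le> (576 * \<tau> / 6000)\<^sup>2 * 1" using AB by (intro mult_left_mono) auto
      finally have "s\<^sup>2 \<le> (576 * \<tau> / 6000)\<^sup>2" by simp
      then show ?thesis by (rule power2_le_imp_le) (use assms in simp)
    qed
    define e where "e = 3 * (r / M_min) + (\<epsilon> + 2 * s) / (1 - \<epsilon>)"
    have frac: "(\<epsilon> + 2 * s) / (1 - \<epsilon>) \<le> 6 / 5 * (\<epsilon> + 2 * s)"
    proof -
      have "1 * (\<epsilon> + 2 * s) \<le> (6 / 5 * (1 - \<epsilon>)) * (\<epsilon> + 2 * s)" using \<epsilon> \<epsilon>1 s0 by (intro mult_right_mono) auto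
      then have "\<epsilon> + 2 * s \<le> 6 / 5 * (\<epsilon> + 2 * s) * (1 - \<epsilon>)" by (simp only: mult_1_left mult_ac)
      then show ?thesis using \<epsilon>1 by (subst pos_divide_le_eq) auto
    qed
    have e6: "e \<le> 3 * (r / M_min) + 6 / 5 * (\<epsilon> + 2 * s)" using frac by (simp add: e_def)
    have e0: "0 \<le> e" unfolding e_def using r0 assms \<epsilon> \<epsilon>1 s0 by simp
    \<comment> \<open>The sum is \<open>\<tau> / 4 + 6 / 5 * (\<tau> / 3 + 2 * 576 / 6000 * \<tau>) < 0.89 * \<tau>\<close>.\<close>
    have e\<tau>: "e < \<tau>" using e6 \<beta>12 s\<tau> \<epsilon> assms(5) by argo
    let ?M = "contamination \<epsilon> P Q"
    have PQ: "sets Q = sets P" using PP Q by simp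
    have Mp: "prob_space ?M" using measure_contamination(1)[OF PP(1) Q(1) PQ] \<epsilon> \<epsilon>1 by simp
    have Ms: "sets ?M = sets (Rn p)" using PP by simp
    obtain E where E: "E \<in> sets (iid_sample n ?M)" "measure (iid_sample n ?M) E \<ge> 1 - \<delta>"
      and dev: "\<And>X u c. X \<in> E \<Longrightarrow> u \<in> directions p k \<Longrightarrow> 0 \<le> c \<Longrightarrow>
        slab_counts_within n p ?M X u c t"
      using directional_deviation[OF Mp Ms n p rate(4) \<delta>(1) \<delta>1] unfolding t_def by blast
    have tns: "t = n * s" using n by (simp add: s_def)
    have spE: "space (iid_sample n ?M) = space (iid_sample n (Rn p))"
      using sets_eq_imp_space_eq[OF PP(2)] by (simp add: iid_sample_def space_PiM)
    have half: "r / M_min \<le> 1 / 2" using \<beta>12 assms(6) by linarith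
    show "with_prob_at_least (iid_sample n ?M) (1 - 2 * \<delta>)
         (\<lambda>X. (op_norm p (\<lambda>i j. \<Gamma>hat X i j - \<Gamma> i j))\<^sup>2 \<le>
            C * \<kappa> * (max (min (real n powr (- (2 * \<alpha>) / (2 * \<alpha> + 1)) + ln (real p) / real n)
                             (real p / real n)) (\<epsilon>\<^sup>2)
                   + ln (1 / \<delta>) / real n))"
      unfolding with_prob_at_least_def
    proof (intro bexI[OF _ E(1)] conjI ballI)
      show "1 - 2 * \<delta> \<le> measure (iid_sample n ?M) E" using E(2) \<delta> by linarith
      fix X assume X: "X \<in> E"
      then have "X \<in> space (iid_sample n (Rn p))" using sets.sets_into_space[OF E(1)] spE by blast
      note mx = max[OF this]
      note bound = scatter_error_bound[OF n p rate(4) P Q \<epsilon>(1) \<epsilon>1(1) mc pos med psd assms(3) qlow M qup row r0 half p3 mx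
          dev[OF X, unfolded tns] s0 assms(5) e\<tau>[unfolded e_def], folded e_def]
      have x0: "0 \<le> op_norm p (\<lambda>i j. \<Gamma>hat X i j - \<Gamma> i j)" by (rule op_norm_nonneg[OF p])
      have "(op_norm p (\<lambda>i j. \<Gamma>hat X i j - \<Gamma> i j))\<^sup>2 \<le> C * \<kappa> * (max A (\<epsilon>\<^sup>2) + B)"
        unfolding C_def
        by (rule squared_error_arith[OF _ \<epsilon>(1) s0 r0 AB(1,2) pos(2) M assms(3) e0 x0 e6 refl r2 bound(2) s2 bound(1)])
           (use r0 assms in auto)
      also have "A = min (real n powr (- (2 * \<alpha>) / (2 * \<alpha> + 1)) + ln (real p) / real n) (real p / real n)"
        unfolding A_def R_def rate(2) using n by (simp add: min_def add_divide_distrib[symmetric] divide_le_cancel)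
      finally show "(op_norm p (\<lambda>i j. \<Gamma>hat X i j - \<Gamma> i j))\<^sup>2 \<le>
            C * \<kappa> * (max (min (real n powr (- (2 * \<alpha>) / (2 * \<alpha> + 1)) + ln (real p) / real n)
                             (real p / real n)) (\<epsilon>\<^sup>2) + ln (1 / \<delta>) / real n)" by (simp only: B_def)
    qed
  qed
qed

end
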